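(* Let $L,g,\kappa>0$ and let $H_0,V_0>0$ satisfy $gH_0>V_0^2$ and $gH_0<(2+\sqrt2)V_0^2$. For small $\mu>0$ let $(H^*,V^* )$ be the steady state of the viscous Saint-Venant equations with $H^*(0)=H_0$, $V^*(0)=V_0$, $V_x^*(0)=0$ (see context), and let $$\mathbf W(y)=\int_0^Ly^T(x)Q(x)y(x)\,dx,\qquad Q=\begin{pmatrix}g+\mu\widetilde q_1&0\\0&H^*+\mu\widetilde q_2\end{pmatrix},\quad \widetilde q_2=H^*,\quad \widetilde q_1=g-4(1+\mu)\frac{V_x^*}{H^*}.$$ Let $b_0,b_1,c_1\in\mathbb R$ be constants. Then the following hold for all sufficiently small $\mu>0$. 1. There exist constants $m_1,m_2>0$ such that $m_1\|y\|_{L^2}^2\le\mathbf W(y)\le m_2\|y\|_{L^2}^2$ for every $y\in L^2((0,L);\mathbb R^2)$. 2. Suppose that, for all sufficiently small $\mu>0$, $b_0\in(b_0^-,b_0^+)$, $b_1\in\mathbb R\setminus[b_1^-,b_1^+]$ and $c_1\in(c_1^-,c_1^+)$, where $$b_0^\pm=g\left(\frac1{V^*(0)}\pm\sqrt{\frac1{V^*(0)^2}-\frac1{gH^*(0)}}\right),\qquad b_1^\pm=g\left(-\frac1{V^*(L)}\pm\sqrt{\frac1{V^*(L)^2}-\frac1{gH^*(L)}}\right),$$ $$c_1^\pm=\frac{4\left(-V^*-b_1H^*\pm\sqrt{V^*\left(H^*V^*b_1^2/g+2H^*b_1+V^*\right)}\right)}{gH^*-V^{*2}}\Bigg|_{x=L}.$$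 Then there exists $\gamma>0$ such that for every solution $y\in C^1([0,+\infty);L^2((0,L);\mathbb R^2))$ of the linearized viscous Saint-Venant system around $(H^*,V^* )$ with boundary conditions $v(t,0)=-b_0h(t,0)$, $v(t,L)=b_1h(t,L)+\mu c_1v_x(t,L)$, $v_x(t,0)=0$, $$\frac{d}{dt}\mathbf W(y(t,\cdot))\le-\gamma\,\mathbf W(y(t,\cdot)).$$
   Context: **Nonlinear equations.** The viscous Saint-Venant equations on $[0,L]$ with viscosity $\mu>0$ are $$H_t+(HV)_x=0,\qquad V_t+VV_x+gH_x+\frac{f(H,V)}{H}-4\mu\frac{(HV_x)_x}{H}=0,\qquad f(H,V)=\frac{\kappa V}{1+\frac{\kappa H}{3\mu}}.$$ **Steady states.** Given $H_0,V_0>0$ with $gH_0>V_0^2$, there is $\mu^*>0$ such that for each $\mu\in(0,\mu^* )$ there is a unique time-independent solution $(H^*,V^* )\in C^2([0,L];(0,\infty))^2$ of these equations with $H^*(0)=H_0$, $V^*(0)=V_0$, $V_x^*(0)=0$ and $gH^*>V^{*2}$ on $[0,L]$. This is the steady state meant in the claim; it depends on $\mu$. **Linearized system.** For $y=(h,v)^T$, $$A y_{xx}+y_t+B(x)y_x+C(x)y=0,$$ $$A=\begin{pmatrix}0&0\\0&-4\mu\end{pmatrix},\quad B=\begin{pmatrix}V^*&H^*\\ g-4\mu\frac{V_x^*}{H^*}&V^*-4\mu\frac{H_x^*}{H^*}\end{pmatrix},$$ $$C=\begin{pmatrix}V_x^*&H_x^*\\ \frac{4\mu H_x^*V_x^*-f(H^*,V^*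 )}{H^{*2}}-\frac{f(H^*,V^* )^2}{3\mu H^*V^*}& V_x^*+\frac{f(H^*,V^* )}{H^*V^*}\end{pmatrix}.$$ **Solutions.** A $C^1([0,\infty);L^2)$ solution with the boundary conditions is a $C^1$ function $y$ with $y(t)\in D(\mathcal A)$ and $\frac{dy}{dt}=\mathcal Ay$ for all $t\ge 0$, where $\mathcal A=-(A\partial_{xx}+B\partial_x+C)$ and $D(\mathcal A)=\{(h,v)\in L^2:\ \mathcal A(h,v)^T\in L^2,\ v(0)=-b_0h(0),\ v_x(0)=0,\ v(L)=b_1h(L)+\mu c_1v_x(L)\}$ (derivatives in the sense of distributions). *)

theory Defs
  imports "HOL-Analysis.Analysis"
begin

section \<open>Function spaces on the interval\<close>

(* One-sided at the endpoints of [0, L]. *)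
definition ddx :: "real \<Rightarrow> (real \<Rightarrow> 'a::real_normed_vector) \<Rightarrow> real \<Rightarrow> 'a" where
  "ddx L f x = vector_derivative f (at x within {0..L})"

definition C1_on :: "real \<Rightarrow> (real \<Rightarrow> real) \<Rightarrow> bool" where
  "C1_on L f \<longleftrightarrow>
     (\<forall>x\<in>{0..L}. f differentiable (at x within {0..L})) \<and> continuous_on {0..L} (ddx L f)"

definition C2_on :: "real \<Rightarrow> (real \<Rightarrow> real) \<Rightarrow> bool" where
  "C2_on L f \<longleftrightarrow> C1_on L f \<and> C1_on L (ddx L f)"

abbreviation interval_measure_on :: "real \<Rightarrow> real measure" where
  "interval_measure_on L \<equiv> lebesgue_on {0<..<L}"

(* Elements of L^2((0,L); R^2) are represented by functions; two representatives that agree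
   almost everywhere are not identified, and nothing below depends on the choice. *)
definition L2_space :: "real \<Rightarrow> (real \<Rightarrow> real^2) set" where
  "L2_space L = {u. u \<in> borel_measurable (interval_measure_on L) \<and>
                    integrable (interval_measure_on L) (\<lambda>x. (norm (u x))\<^sup>2)}"

definition L2_norm :: "real \<Rightarrow> (real \<Rightarrow> real^2) \<Rightarrow> real" where
  "L2_norm L u = sqrt (\<integral>x. (norm (u x))\<^sup>2 \<partial>interval_measure_on L)"

(* y is of class C^1([0,\<infinity>); L^2) with time derivative y'. *)
definition C1_L2_derivative ::
    "real \<Rightarrow> (real \<Rightarrow> real \<Rightarrow> real^2) \<Rightarrow> (real \<Rightarrow> real \<Rightarrow> real^2) \<Rightarrow> bool" where
  "C1_L2_derivative L y y' \<longleftrightarrow>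
     (\<forall>t\<ge>0. y t \<in> L2_space L \<and> y' t \<in> L2_space L \<and>
        ((\<lambda>s. L2_norm L (\<lambda>x. (y s x - y t x) /\<^sub>R (s - t) - y' t x)) \<longlongrightarrow> 0) (at t within {0..}) \<and>
        ((\<lambda>s. L2_norm L (\<lambda>x. y' s x - y' t x)) \<longlongrightarrow> 0) (at t within {0..}))"

(* Smooth functions with compact support in the open interval (0, L). *)
definition test_function :: "real \<Rightarrow> (real \<Rightarrow> real) \<Rightarrow> bool" where
  "test_function L \<phi> \<longleftrightarrow>
     (\<forall>n x. (deriv ^^ n) \<phi> differentiable (at x)) \<and> closure {x. \<phi> x \<noteq> 0} \<subseteq> {0<..<L}"

section \<open>Steady states\<close>

definition friction :: "real \<Rightarrow> real \<Rightarrow> real \<Rightarrow> real \<Rightarrow> real" where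
  "friction \<kappa> \<mu> h v = \<kappa> * v / (1 + \<kappa> * h / (3 * \<mu>))"

(* The two equations are the viscous Saint-Venant equations with H_t = V_t = 0. *)
definition steady_state ::
    "real \<Rightarrow> real \<Rightarrow> real \<Rightarrow> real \<Rightarrow> real \<Rightarrow> real \<Rightarrow> (real \<Rightarrow> real) \<Rightarrow> (real \<Rightarrow> real) \<Rightarrow> bool" where
  "steady_state L g \<kappa> \<mu> H0 V0 H V \<longleftrightarrow>
     C2_on L H \<and> C2_on L V \<and>
     (\<forall>x\<in>{0..L}.
        0 < H x \<and> 0 < V x \<and>
        ddx L (\<lambda>z. H z * V z) x = 0 \<and>
        V x * ddx L V x + g * ddx L H x + friction \<kappa> \<mu> (H x) (V x) / H x
          - 4 * \<mu> * ddx L (\<lambda>z. H z * ddx L V z) x / H x = 0 \<and>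
        g * H x > (V x)\<^sup>2) \<and>
     H 0 = H0 \<and> V 0 = V0 \<and> ddx L V 0 = 0"

section \<open>The linearized system\<close>

definition mat2 :: "real \<Rightarrow> real \<Rightarrow> real \<Rightarrow> real \<Rightarrow> real^2^2" where
  "mat2 a b c d = vector [vector [a, b], vector [c, d]]"

definition A_mat :: "real \<Rightarrow> real^2^2" where
  "A_mat \<mu> = mat2 0 0 0 (- 4 * \<mu>)"

definition B_mat ::
    "real \<Rightarrow> real \<Rightarrow> real \<Rightarrow> (real \<Rightarrow> real) \<Rightarrow> (real \<Rightarrow> real) \<Rightarrow> real \<Rightarrow> real^2^2" where
  "B_mat L g \<mu> H V x = mat2
     (V x)                                  (H x)
     (g - 4 * \<mu> * ddx L V x / H x)          (V x - 4 * \<mu> * ddx L H x / H x)"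

definition C_mat ::
    "real \<Rightarrow> real \<Rightarrow> real \<Rightarrow> (real \<Rightarrow> real) \<Rightarrow> (real \<Rightarrow> real) \<Rightarrow> real \<Rightarrow> real^2^2" where
  "C_mat L \<kappa> \<mu> H V x = (let f = friction \<kappa> \<mu> (H x) (V x) in mat2
     (ddx L V x)
     (ddx L H x)
     ((4 * \<mu> * ddx L H x * ddx L V x - f) / (H x)\<^sup>2 - f\<^sup>2 / (3 * \<mu> * H x * V x))
     (ddx L V x + f / (H x * V x)))"

(* F = -(A y_xx + B y_x + C y) in the sense of distributions on (0, L): both sides are tested
   with phi, and the x-derivatives of y are moved onto phi A and phi B. *)
definition operator_value ::
    "real \<Rightarrow> real \<Rightarrow> real \<Rightarrow> real \<Rightarrow> (real \<Rightarrow> real) \<Rightarrow> (real \<Rightarrow> real) \<Rightarrow>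
     (real \<Rightarrow> real^2) \<Rightarrow> (real \<Rightarrow> real^2) \<Rightarrow> bool" where
  "operator_value L g \<kappa> \<mu> H V y F \<longleftrightarrow>
     (\<forall>\<phi>. test_function L \<phi> \<longrightarrow>
        (\<integral>x. \<phi> x *\<^sub>R F x \<partial>interval_measure_on L) =
        - (\<integral>x. (deriv (deriv \<phi>) x *\<^sub>R A_mat \<mu>) *v y x
               - ddx L (\<lambda>z. \<phi> z *\<^sub>R B_mat L g \<mu> H V z) x *v y x
               + (\<phi> x *\<^sub>R C_mat L \<kappa> \<mu> H V x) *v y x \<partial>interval_measure_on L))"

(* Point values are those of the continuous representative h of the first component and of the
   C^1 representative v of the second one.  They are unique, and they exist as soon as y and
   A y_xx + B y_x + C y are in L^2, since then y is in H^1 x H^2. *)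
definition boundary_conditions ::
    "real \<Rightarrow> real \<Rightarrow> real \<Rightarrow> real \<Rightarrow> real \<Rightarrow> (real \<Rightarrow> real^2) \<Rightarrow> bool" where
  "boundary_conditions L \<mu> b0 b1 c1 y \<longleftrightarrow>
     (\<exists>h v. continuous_on {0..L} h \<and> C1_on L v \<and>
        (AE x in interval_measure_on L. y x $ 1 = h x \<and> y x $ 2 = v x) \<and>
        v 0 = - b0 * h 0 \<and> ddx L v 0 = 0 \<and> v L = b1 * h L + \<mu> * c1 * ddx L v L)"

definition operator_domain ::
    "real \<Rightarrow> real \<Rightarrow> real \<Rightarrow> real \<Rightarrow> (real \<Rightarrow> real) \<Rightarrow> (real \<Rightarrow> real) \<Rightarrow>
     real \<Rightarrow> real \<Rightarrow> real \<Rightarrow> (real \<Rightarrow> real^2) set" where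
  "operator_domain L g \<kappa> \<mu> H V b0 b1 c1 =
     {y \<in> L2_space L. (\<exists>F\<in>L2_space L. operator_value L g \<kappa> \<mu> H V y F) \<and>
                      boundary_conditions L \<mu> b0 b1 c1 y}"

definition linearized_solution ::
    "real \<Rightarrow> real \<Rightarrow> real \<Rightarrow> real \<Rightarrow> (real \<Rightarrow> real) \<Rightarrow> (real \<Rightarrow> real) \<Rightarrow>
     real \<Rightarrow> real \<Rightarrow> real \<Rightarrow> (real \<Rightarrow> real \<Rightarrow> real^2) \<Rightarrow> bool" where
  "linearized_solution L g \<kappa> \<mu> H V b0 b1 c1 y \<longleftrightarrow>
     (\<exists>y'. C1_L2_derivative L y y' \<and>
        (\<forall>t\<ge>0. y t \<in> operator_domain L g \<kappa> \<mu> H V b0 b1 c1 \<and>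
               operator_value L g \<kappa> \<mu> H V (y t) (y' t)))"

section \<open>The Lyapunov functional and the feedback bounds\<close>

definition q1_tilde ::
    "real \<Rightarrow> real \<Rightarrow> real \<Rightarrow> (real \<Rightarrow> real) \<Rightarrow> (real \<Rightarrow> real) \<Rightarrow> real \<Rightarrow> real" where
  "q1_tilde L g \<mu> H V x = g - 4 * (1 + \<mu>) * ddx L V x / H x"

definition q2_tilde :: "(real \<Rightarrow> real) \<Rightarrow> real \<Rightarrow> real" where
  "q2_tilde H x = H x"

definition Q_mat ::
    "real \<Rightarrow> real \<Rightarrow> real \<Rightarrow> (real \<Rightarrow> real) \<Rightarrow> (real \<Rightarrow> real) \<Rightarrow> real \<Rightarrow> real^2^2" where
  "Q_mat L g \<mu> H V x = mat2
     (g + \<mu> * q1_tilde L g \<mu> H V x)    0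
     0                                 (H x + \<mu> * q2_tilde H x)"

definition W_fun ::
    "real \<Rightarrow> real \<Rightarrow> real \<Rightarrow> (real \<Rightarrow> real) \<Rightarrow> (real \<Rightarrow> real) \<Rightarrow> (real \<Rightarrow> real^2) \<Rightarrow> real" where
  "W_fun L g \<mu> H V y = (\<integral>x. y x \<bullet> (Q_mat L g \<mu> H V x *v y x) \<partial>interval_measure_on L)"

(* In the three bounds s = 1 gives the upper bound (superscript +) and s = -1 the lower one;
   h and v are the values of the steady state at the relevant endpoint. *)
definition b0_bound :: "real \<Rightarrow> real \<Rightarrow> real \<Rightarrow> real \<Rightarrow> real" where
  "b0_bound s g h v = g * (1 / v + s * sqrt (1 / v\<^sup>2 - 1 / (g * h)))"

definition b1_bound :: "real \<Rightarrow> real \<Rightarrow> real \<Rightarrow> real \<Rightarrow> real" where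
  "b1_bound s g h v = g * (- 1 / v + s * sqrt (1 / v\<^sup>2 - 1 / (g * h)))"

definition c1_bound :: "real \<Rightarrow> real \<Rightarrow> real \<Rightarrow> real \<Rightarrow> real \<Rightarrow> real" where
  "c1_bound s g b1 h v =
     4 * (- v - b1 * h + s * sqrt (v * (h * v * b1\<^sup>2 / g + 2 * h * b1 + v))) / (g * h - v\<^sup>2)"

end

theory Submission
  imports Defs "HOL-Computational_Algebra.Polynomial"
begin

text \<open>
  Write \<open>p = g - 4 \<mu> V' / H\<close>.  Then \<open>W(y) = (1 + \<mu>) \<integral> p h\<^sup>2 + H v\<^sup>2\<close>, and with these weights the mixed
  terms \<open>h v\<^sub>x\<close> and \<open>v h\<^sub>x\<close> form a total derivative.  Integration by parts leaves the viscous term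
  \<open>- 4 \<mu> \<integral> H v\<^sub>x\<^sup>2\<close>, boundary terms, and an interior quadratic form in \<open>(h, v)\<close> of size \<open>\<mu>\<close>.

  The steady state satisfies \<open>0 \<le> V' \<le> \<mu> S\<close>, where \<open>S\<close> is close to \<open>3 V\<^sub>0\<^sup>2 / (H\<^sub>0\<^sup>2 (g H\<^sub>0 - V\<^sub>0\<^sup>2))\<close> for
  small \<open>\<mu>\<close>.  After division by \<open>\<mu>\<close>, the negativity of the interior form becomes in the limit a linear
  inequality in \<open>s = V' / \<mu>\<close>, which has to be checked at \<open>s = 0\<close> and \<open>s = S\<close> only; at \<open>s = S\<close> it is
  \<open>g H\<^sub>0 < (2 + sqrt 2) V\<^sub>0\<^sup>2\<close>.

  The boundary forms are negative under the conditions on \<open>b0\<close> and \<open>c1\<close>, up to replacing \<open>p(L)\<close> by \<open>g\<close>.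
  This replacement costs \<open>O(\<mu>\<^sup>2) v(L)\<^sup>2\<close>, which is absorbed by the interior dissipation of order \<open>\<mu>\<close>
  through the trace inequality.
\<close>

section \<open>Integration on the interval\<close>

text \<open>The weights have a structural origin: up to the factor 1 + \<mu> they are the
  off-diagonal entries of \<open>B_mat\<close>, p from the lower left corner and H from the upper
  right one, so that Q B has the same entry p H in both corners. This symmetry is what turns the
  mixed first-order terms into a derivative. The obstacle is regularity. A state in the operator
  domain comes with a continuous h and a C^1 function v, while the equations hold only in the sense
  of distributions, so neither h_x nor v_xx is given. Testing nevertheless shows that the mass flux
  V h + H v and the momentum flux - 4 \<mu> v_x + p h + r v, with r the lower right entry of
  \<open>B_mat\<close>, are absolutely continuous. All integrations by parts are therefore carried
  out on primitives of integrable functions. The margin of the interior form, the outlet error and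
  the viscous term are compared by their orders in \<mu>, so their constants have to be chosen
  before \<mu>.\<close>

lemma continuous_on_interval_bound:
  fixes f :: "real \<Rightarrow> real"
  assumes "continuous_on {a..b} f"
  obtains B where "B > 0" "\<And>x. x \<in> {a..b} \<Longrightarrow> \<bar>f x\<bar> \<le> B"
proof -
  have "bounded (f ` {a..b})"
    using assms compact_Icc compact_continuous_image compact_imp_bounded by blast
  then obtain B where "B > 0" "\<forall>y\<in>f ` {a..b}. norm y \<le> B"
    using bounded_pos by blast
  then show thesis using that by auto
qed

lemma space_interval_measure [simp]: "space (interval_measure_on L) = {0<..<L}"
  by (simp add: space_restrict_space)

lemma AE_interval_measure_in: "AE x in interval_measure_on L. x \<in> {0<..<L}"
  by (rule AE_I2) simp

lemma finite_measure_interval: "finite_measure (interval_measure_on L)"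
  by (rule finite_measure_lebesgue_on) simp

lemma continuous_on_measurable_interval:
  fixes f :: "real \<Rightarrow> 'a::topological_space"
  assumes "continuous_on {0..L} f"
  shows "f \<in> borel_measurable (interval_measure_on L)"
proof (rule continuous_imp_measurable_on_sets_lebesgue)
  show "continuous_on {0<..<L} f" using assms continuous_on_subset greaterThanLessThan_subseteq_atLeastAtMost_iff
    by blast
qed simp

lemma integrable_bounded_interval:
  fixes f :: "real \<Rightarrow> 'a::{banach, second_countable_topology}"
  assumes "f \<in> borel_measurable (interval_measure_on L)"
    and "\<And>x. x \<in> {0<..<L} \<Longrightarrow> norm (f x) \<le> B"
  shows "integrable (interval_measure_on L) f"
proof -
  interpret finite_measure "interval_measure_on L" by (rule finite_measure_interval)
  show ?thesis
    by (rule integrable_const_bound[where B = B]) (use assms in auto)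
qed

lemma integrable_continuous_interval:
  fixes f :: "real \<Rightarrow> real"
  assumes "continuous_on {0..L} f"
  shows "integrable (interval_measure_on L) f"
proof -
  obtain B where "\<And>x. x \<in> {0..L} \<Longrightarrow> \<bar>f x\<bar> \<le> B"
    using continuous_on_interval_bound[OF assms] by blast
  then show ?thesis
    by (intro integrable_bounded_interval[where B = B] continuous_on_measurable_interval assms) auto
qed

lemma integrable_continuous_mult:
  fixes u f :: "real \<Rightarrow> real"
  assumes "continuous_on {0..L} u" "integrable (interval_measure_on L) f"
  shows "integrable (interval_measure_on L) (\<lambda>x. u x * f x)"
proof -
  obtain B where B: "B > 0" "\<And>x. x \<in> {0..L} \<Longrightarrow> \<bar>u x\<bar> \<le> B"
    using continuous_on_interval_bound[OF assms(1)] by blast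
  have [measurable]: "u \<in> borel_measurable (interval_measure_on L)"
    by (rule continuous_on_measurable_interval[OF assms(1)])
  have [measurable]: "f \<in> borel_measurable (interval_measure_on L)"
    using assms(2) by auto
  show ?thesis
  proof (rule Bochner_Integration.integrable_bound[of _ "\<lambda>x. B * f x"])
    show "AE x in interval_measure_on L. norm (u x * f x) \<le> norm (B * f x)"
      using AE_interval_measure_in
    proof eventually_elim
      case (elim x)
      then have "\<bar>u x\<bar> \<le> \<bar>B\<bar>" using B(1) B(2)[of x] by simp
      then show ?case by (simp add: abs_mult mult_right_mono)
    qed
  qed (use assms(2) in auto)
qed

lemma integrable_square_mult:
  fixes f g :: "real \<Rightarrow> real"
  assumes "f \<in> borel_measurable M" "g \<in> borel_measurable M"
    and "integrable M (\<lambda>x. (f x)\<^sup>2)" "integrable M (\<lambda>x. (g x)\<^sup>2)"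
  shows "integrable M (\<lambda>x. f x * g x)"
proof (rule Bochner_Integration.integrable_bound[of _ "\<lambda>x. (f x)\<^sup>2 + (g x)\<^sup>2"])
  show "AE x in M. norm (f x * g x) \<le> norm ((f x)\<^sup>2 + (g x)\<^sup>2)"
  proof (rule AE_I2)
    fix x
    have "2 * \<bar>f x * g x\<bar> \<le> (f x)\<^sup>2 + (g x)\<^sup>2"
      using sum_squares_bound[of "\<bar>f x\<bar>" "\<bar>g x\<bar>"] by (simp add: abs_mult)
    then show "norm (f x * g x) \<le> norm ((f x)\<^sup>2 + (g x)\<^sup>2)" by simp
  qed
qed (use assms in auto)

text \<open>Absolute continuity of \<open>u\<close>, with almost everywhere derivative \<open>a\<close>.\<close>

definition primitive_on :: "real \<Rightarrow> (real \<Rightarrow> real) \<Rightarrow> (real \<Rightarrow> real) \<Rightarrow> bool" where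
  "primitive_on L u a \<longleftrightarrow> integrable (interval_measure_on L) a \<and>
     (\<forall>x\<in>{0..L}. u x = u 0 + (\<integral>t. indicator {..x} t * a t \<partial>interval_measure_on L))"

lemma primitive_on_integrable: "primitive_on L u a \<Longrightarrow> integrable (interval_measure_on L) a"
  by (simp add: primitive_on_def)

lemma primitive_on_eq:
  "primitive_on L u a \<Longrightarrow> x \<in> {0..L} \<Longrightarrow>
    u x = u 0 + (\<integral>t. indicator {..x} t * a t \<partial>interval_measure_on L)"
  unfolding primitive_on_def by blast

lemma primitive_onI:
  assumes "integrable (interval_measure_on L) a"
    and "\<And>x. x \<in> {0..L} \<Longrightarrow> u x = u 0 + (\<integral>t. indicator {..x} t * a t \<partial>interval_measure_on L)"
  shows "primitive_on L u a"
  unfolding primitive_on_def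
proof
  show "\<forall>x\<in>{0..L}. u x = u 0 + (\<integral>t. indicator {..x} t * a t \<partial>interval_measure_on L)"
    by (rule ballI) (rule assms(2))
qed (rule assms(1))

lemma integrable_indicator_atMost:
  fixes a :: "real \<Rightarrow> real"
  assumes "integrable (interval_measure_on L) a"
  shows "integrable (interval_measure_on L) (\<lambda>t. indicator {..x} t * a t)"
proof (rule Bochner_Integration.integrable_bound[OF assms])
  have [measurable]: "a \<in> borel_measurable (interval_measure_on L)" using assms by auto
  have "(\<lambda>t. t) \<in> borel_measurable (interval_measure_on L)"
    by (rule continuous_on_measurable_interval) auto
  then have [measurable]: "(\<lambda>t. indicator {..x} t :: real) \<in> borel_measurable (interval_measure_on L)"
    by (rule measurable_compose) simp
  show "(\<lambda>t. indicator {..x} t * a t) \<in> borel_measurable (interval_measure_on L)" by measurable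
  show "AE t in interval_measure_on L. norm (indicator {..x} t * a t) \<le> norm (a t)"
    by (auto split: split_indicator)
qed

lemma primitive_on_end:
  assumes "primitive_on L u a" "L \<ge> 0"
  shows "u L - u 0 = (\<integral>t. a t \<partial>interval_measure_on L)"
proof -
  have "(\<integral>t. indicator {..L} t * a t \<partial>interval_measure_on L) = (\<integral>t. a t \<partial>interval_measure_on L)"
    by (rule Bochner_Integration.integral_cong) auto
  then show ?thesis using primitive_on_eq[OF assms(1), of L] assms(2) by simp
qed

lemma primitive_on_cong:
  assumes "primitive_on L u a" "integrable (interval_measure_on L) b"
    and "AE x in interval_measure_on L. a x = b x" and "\<And>x. x \<in> {0..L} \<Longrightarrow> u x = w x" and "L \<ge> 0"
  shows "primitive_on L w b"
proof (rule primitive_onI[OF assms(2)])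
  fix x assume x: "x \<in> {0..L}"
  have "(\<integral>t. indicator {..x} t * a t \<partial>interval_measure_on L) = (\<integral>t. indicator {..x} t * b t \<partial>interval_measure_on L)"
  proof (rule integral_cong_AE)
    show "AE t in interval_measure_on L. indicator {..x} t * a t = indicator {..x} t * b t"
      using assms(3) by eventually_elim simp
  qed (intro borel_measurable_integrable integrable_indicator_atMost
      primitive_on_integrable[OF assms(1)] assms(2))+
  moreover have "u x = u 0 + (\<integral>t. indicator {..x} t * a t \<partial>interval_measure_on L)"
    by (rule primitive_on_eq[OF assms(1) x])
  ultimately show "w x = w 0 + (\<integral>t. indicator {..x} t * b t \<partial>interval_measure_on L)"
    using assms(4)[of x] assms(4)[of 0] x assms(5) by simp
qed

lemma primitive_on_add:
  assumes "primitive_on L u a" "primitive_on L w b"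
  shows "primitive_on L (\<lambda>x. u x + w x) (\<lambda>x. a x + b x)"
proof (rule primitive_onI)
  note ia = primitive_on_integrable[OF assms(1)] and ib = primitive_on_integrable[OF assms(2)]
  show "integrable (interval_measure_on L) (\<lambda>x. a x + b x)" using ia ib by simp
  show "u x + w x = u 0 + w 0 + (\<integral>t. indicator {..x} t * (a t + b t) \<partial>interval_measure_on L)"
    if "x \<in> {0..L}" for x
    using primitive_on_eq[OF assms(1) that] primitive_on_eq[OF assms(2) that]
      integrable_indicator_atMost[OF ia, of x] integrable_indicator_atMost[OF ib, of x]
    by (simp add: distrib_left)
qed

lemma primitive_on_cmult:
  assumes "primitive_on L u a"
  shows "primitive_on L (\<lambda>x. c * u x) (\<lambda>x. c * a x)"
proof (rule primitive_onI)
  show "integrable (interval_measure_on L) (\<lambda>x. c * a x)"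
    using primitive_on_integrable[OF assms] by simp
  show "c * u x = c * u 0 + (\<integral>t. indicator {..x} t * (c * a t) \<partial>interval_measure_on L)"
    if "x \<in> {0..L}" for x
    using primitive_on_eq[OF assms that] by (simp add: mult.left_commute[of _ c] distrib_left)
qed

text \<open>Integration by parts is Fubini on the square, split along its diagonal.\<close>

lemma primitive_on_mult:
  assumes u: "primitive_on L u a" and w: "primitive_on L w b"
    and cu: "continuous_on {0..L} u" and cw: "continuous_on {0..L} w"
  shows "primitive_on L (\<lambda>x. u x * w x) (\<lambda>x. a x * w x + u x * b x)"
proof -
  let ?M = "interval_measure_on L"
  interpret finite_measure ?M by (rule finite_measure_interval)
  interpret P: pair_sigma_finite ?M ?M ..
  have a: "integrable ?M a" and b: "integrable ?M b"
    using u w by (auto intro: primitive_on_integrable)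
  have [measurable]: "a \<in> borel_measurable ?M" "b \<in> borel_measurable ?M" using a b by auto
  have id: "(\<lambda>x. x) \<in> borel_measurable ?M"
    by (rule continuous_on_measurable_interval) auto
  have aw: "integrable ?M (\<lambda>x. a x * w x)" and ub: "integrable ?M (\<lambda>x. u x * b x)"
    using integrable_continuous_mult[OF cw a] integrable_continuous_mult[OF cu b]
    by (auto simp: mult.commute)
  have "u x * w x = u 0 * w 0 + (\<integral>t. indicator {..x} t * (a t * w t + u t * b t) \<partial>?M)"
    if x: "x \<in> {0..L}" for x
  proof -
    \<comment> \<open>Both factors are cut off at x, so the square is [0, x]^2 and the inner
      integral over a triangle is an increment of \<open>w\<close> or of \<open>u\<close>.\<close>
    let ?a = "\<lambda>t. indicator {..x} t * a t" and ?b = "\<lambda>t. indicator {..x} t * b t"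
    have ia: "integrable ?M ?a" and ib: "integrable ?M ?b"
      using integrable_indicator_atMost a b by auto
    have [measurable]: "?a \<in> borel_measurable ?M" "?b \<in> borel_measurable ?M" using ia ib by auto
    have ab: "integrable (?M \<Otimes>\<^sub>M ?M) (\<lambda>(t,s). ?a t * ?b s)"
    proof (rule P.Fubini_integrable)
      have "(\<integral>s. norm (?a t * ?b s) \<partial>?M) = (\<integral>s. \<bar>?b s\<bar> \<partial>?M) * \<bar>?a t\<bar>" for t
        using integrable_abs[OF ib] by (simp add: abs_mult mult.commute)
      then show "integrable ?M (\<lambda>t. \<integral>s. norm (case (t, s) of (t, s) \<Rightarrow> ?a t * ?b s) \<partial>?M)"
        using integrable_mult_right[OF integrable_abs[OF ia]] by simp
    qed (use ib in auto)
    have [measurable]: "fst \<in> borel_measurable (?M \<Otimes>\<^sub>M ?M)" "snd \<in> borel_measurable (?M \<Otimes>\<^sub>M ?M)"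
      using measurable_compose[OF measurable_fst id] measurable_compose[OF measurable_snd id] by auto
    have "(\<lambda>z. if snd z \<le> fst z then 1 else 0 :: real) \<in> borel_measurable (?M \<Otimes>\<^sub>M ?M)"
      "(\<lambda>z. if fst z \<le> snd z then 1 else 0 :: real) \<in> borel_measurable (?M \<Otimes>\<^sub>M ?M)"
      by measurable
    then have M1: "(\<lambda>z. indicator {..fst z} (snd z) :: real) \<in> borel_measurable (?M \<Otimes>\<^sub>M ?M)"
      and M2: "(\<lambda>z. indicator {..snd z} (fst z) :: real) \<in> borel_measurable (?M \<Otimes>\<^sub>M ?M)"
      by (simp_all add: indicator_def of_bool_def)
    have I1: "integrable (?M \<Otimes>\<^sub>M ?M) (\<lambda>(t,s). indicator {..t} s * (?a t * ?b s))"
      by (rule Bochner_Integration.integrable_bound[OF ab])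
        (use borel_measurable_times[OF M1 borel_measurable_integrable[OF ab]] in
          \<open>auto split: split_indicator simp: split_beta\<close>)
    have I2: "integrable (?M \<Otimes>\<^sub>M ?M) (\<lambda>(t,s). indicator {..s} t * (?a t * ?b s))"
      by (rule Bochner_Integration.integrable_bound[OF ab])
        (use borel_measurable_times[OF M2 borel_measurable_integrable[OF ab]] in
          \<open>auto split: split_indicator simp: split_beta\<close>)
    have "(\<integral>t. ?a t \<partial>?M) * (\<integral>s. ?b s \<partial>?M) = (\<integral>t. (\<integral>s. ?a t * ?b s \<partial>?M) \<partial>?M)"
      using ia ib by simp
    also have "\<dots> = integral\<^sup>L (?M \<Otimes>\<^sub>M ?M) (\<lambda>(t,s). ?a t * ?b s)"
      using P.integral_fst[OF ab] by simp
    also have "\<dots> = integral\<^sup>L (?M \<Otimes>\<^sub>M ?M)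
        (\<lambda>z. (case z of (t,s) \<Rightarrow> indicator {..t} s * (?a t * ?b s)) + (case z of (t,s) \<Rightarrow> indicator {..s} t * (?a t * ?b s)))"
    proof (rule integral_cong_AE)
      show "(\<lambda>(t,s). ?a t * ?b s) \<in> borel_measurable (?M \<Otimes>\<^sub>M ?M)" using ab by auto
      show "(\<lambda>z. (case z of (t,s) \<Rightarrow> indicator {..t} s * (?a t * ?b s)) + (case z of (t,s) \<Rightarrow> indicator {..s} t * (?a t * ?b s)))
        \<in> borel_measurable (?M \<Otimes>\<^sub>M ?M)" using I1 I2 by (intro borel_measurable_add) auto
      \<comment> \<open>The two closed triangles overlap on the diagonal, so their indicators sum to
        1 only off it. Each slice of the diagonal is a single point, hence the overlap is
        null.\<close>
      have "AE z in ?M \<Otimes>\<^sub>M ?M. fst z \<noteq> snd z"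
      proof (rule P.AE_pair_measure)
        show "{z \<in> space (?M \<Otimes>\<^sub>M ?M). fst z \<noteq> snd z} \<in> sets (?M \<Otimes>\<^sub>M ?M)" by measurable
        have "AE s in ?M. t \<noteq> s" for t
        proof -
          have "AE s in lebesgue. s \<notin> {t}"
            by (rule AE_not_in) (simp add: negligible_iff_null_sets[symmetric])
          then show ?thesis by (subst AE_restrict_space_iff) (auto elim: eventually_mono)
        qed
        then show "AE t in ?M. AE s in ?M. fst (t, s) \<noteq> snd (t, s)" by simp
      qed
      then show "AE z in ?M \<Otimes>\<^sub>M ?M. (case z of (t,s) \<Rightarrow> ?a t * ?b s) =
        (case z of (t,s) \<Rightarrow> indicator {..t} s * (?a t * ?b s)) + (case z of (t,s) \<Rightarrow> indicator {..s} t * (?a t * ?b s))"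
        by eventually_elim (auto split: split_indicator)
    qed
    also have "\<dots> = (\<integral>t. (\<integral>s. indicator {..t} s * (?a t * ?b s) \<partial>?M) \<partial>?M)
        + (\<integral>s. (\<integral>t. indicator {..s} t * (?a t * ?b s) \<partial>?M) \<partial>?M)"
      using I1 I2 P.integral_fst[OF I1] P.integral_snd[OF I2] by simp
    also have "(\<integral>t. (\<integral>s. indicator {..t} s * (?a t * ?b s) \<partial>?M) \<partial>?M) =
        (\<integral>t. ?a t * (w t - w 0) \<partial>?M)"
    proof (rule Bochner_Integration.integral_cong)
      fix t assume t: "t \<in> space ?M"
      have "(\<integral>s. indicator {..t} s * (?a t * ?b s) \<partial>?M) = (\<integral>s. ?a t * (indicator {..t} s * b s) \<partial>?M)"
        by (rule Bochner_Integration.integral_cong) (auto split: split_indicator)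
      also have "\<dots> = ?a t * (w t - w 0)" using primitive_on_eq[OF w, of t] t by simp
      finally show "(\<integral>s. indicator {..t} s * (?a t * ?b s) \<partial>?M) = ?a t * (w t - w 0)" .
    qed simp
    also have "(\<integral>s. (\<integral>t. indicator {..s} t * (?a t * ?b s) \<partial>?M) \<partial>?M) =
        (\<integral>s. ?b s * (u s - u 0) \<partial>?M)"
    proof (rule Bochner_Integration.integral_cong)
      fix s assume s: "s \<in> space ?M"
      have "(\<integral>t. indicator {..s} t * (?a t * ?b s) \<partial>?M) = (\<integral>t. ?b s * (indicator {..s} t * a t) \<partial>?M)"
        by (rule Bochner_Integration.integral_cong) (auto split: split_indicator)
      also have "\<dots> = ?b s * (u s - u 0)" using primitive_on_eq[OF u, of s] s by simp
      finally show "(\<integral>t. indicator {..s} t * (?a t * ?b s) \<partial>?M) = ?b s * (u s - u 0)" .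
    qed simp
    finally have E: "(\<integral>t. ?a t \<partial>?M) * (\<integral>s. ?b s \<partial>?M) =
        (\<integral>t. ?a t * (w t - w 0) \<partial>?M) + (\<integral>s. ?b s * (u s - u 0) \<partial>?M)" .
    have iaw: "integrable ?M (\<lambda>t. indicator {..x} t * (a t * w t))"
      and iub: "integrable ?M (\<lambda>t. indicator {..x} t * (u t * b t))"
      using aw ub integrable_indicator_atMost by auto
    have "(\<integral>t. ?a t * (w t - w 0) \<partial>?M) = (\<integral>t. indicator {..x} t * (a t * w t) - w 0 * ?a t \<partial>?M)"
      by (rule Bochner_Integration.integral_cong) (auto simp: algebra_simps)
    also have "\<dots> = (\<integral>t. indicator {..x} t * (a t * w t) \<partial>?M) - w 0 * (\<integral>t. ?a t \<partial>?M)"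
      using iaw ia by simp
    finally have E1: "(\<integral>t. ?a t * (w t - w 0) \<partial>?M) = \<dots>" .
    have "(\<integral>t. ?b t * (u t - u 0) \<partial>?M) = (\<integral>t. indicator {..x} t * (u t * b t) - u 0 * ?b t \<partial>?M)"
      by (rule Bochner_Integration.integral_cong) (auto simp: algebra_simps)
    also have "\<dots> = (\<integral>t. indicator {..x} t * (u t * b t) \<partial>?M) - u 0 * (\<integral>t. ?b t \<partial>?M)"
      using iub ib by simp
    finally have E2: "(\<integral>t. ?b t * (u t - u 0) \<partial>?M) = \<dots>" .
    have U: "u x = u 0 + (\<integral>t. ?a t \<partial>?M)" and W: "w x = w 0 + (\<integral>t. ?b t \<partial>?M)"
      using primitive_on_eq[OF u x] primitive_on_eq[OF w x] .
    have "(\<integral>t. indicator {..x} t * (a t * w t + u t * b t) \<partial>?M) =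
        (\<integral>t. indicator {..x} t * (a t * w t) \<partial>?M) + (\<integral>t. indicator {..x} t * (u t * b t) \<partial>?M)"
      using iaw iub by (simp add: distrib_left)
    then show ?thesis using E E1 E2 unfolding U W by (simp add: algebra_simps)
  qed
  moreover have "integrable ?M (\<lambda>x. a x * w x + u x * b x)" using aw ub by simp
  ultimately show ?thesis by (rule primitive_onI[rotated])
qed

section \<open>Continuously differentiable functions as primitives\<close>

lemma C1_on_DERIV:
  assumes "C1_on L f" "x \<in> {0..L}" "L > 0"
  shows "(f has_real_derivative ddx L f x) (at x within {0..L})"
proof -
  obtain D where "(f has_real_derivative D) (at x within {0..L})"
    using assms unfolding C1_on_def real_differentiable_def by blast
  moreover from this have "ddx L f x = D"
    using assms by (auto simp: ddx_def has_real_derivative_iff_has_vector_derivative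
        intro!: vector_derivative_within_cbox[of 0 L, simplified])
  ultimately show ?thesis by simp
qed

lemma C1_on_continuous:
  assumes "C1_on L f"
  shows "continuous_on {0..L} f" "continuous_on {0..L} (ddx L f)"
  using assms by (auto simp: C1_on_def continuous_on_eq_continuous_within
      intro: differentiable_imp_continuous_within)

text \<open>The fundamental theorem of calculus gives a gauge integral over [0, x]. Extension by
  zero makes it an integral over [0, L], and dropping the two endpoints makes it a Lebesgue integral
  over the open interval.\<close>

lemma primitive_on_DERIV:
  assumes D: "\<And>x. x \<in> {0..L} \<Longrightarrow> (f has_real_derivative f' x) (at x within {0..L})"
    and c: "continuous_on {0..L} f'"
  shows "primitive_on L f f'"
proof (rule primitive_onI[OF integrable_continuous_interval[OF c]])
  fix x assume x: "x \<in> {0..L}"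
  have "(f' has_integral (f x - f 0)) {0..x}"
  proof (rule fundamental_theorem_of_calculus)
    show "(f has_vector_derivative f' y) (at y within {0..x})" if "y \<in> {0..x}" for y
    proof (rule has_vector_derivative_within_subset)
      show "(f has_vector_derivative f' y) (at y within {0..L})"
        using D[of y] that x by (simp add: has_real_derivative_iff_has_vector_derivative)
    qed (use x in auto)
  qed (use x in auto)
  moreover have "{..x} \<inter> {0..L} = {0..x}" using x by auto
  ultimately have "((\<lambda>t. if t \<in> {..x} then f' t else 0) has_integral (f x - f 0)) {0..L}"
    unfolding has_integral_restrict_Int by metis
  moreover have "(\<lambda>t. if t \<in> {..x} then f' t else 0) = (\<lambda>t. indicator {..x} t * f' t)"
    by (intro ext) (simp add: indicator_def)
  ultimately have "((\<lambda>t. indicator {..x} t * f' t) has_integral (f x - f 0)) {0..L}"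
    by simp
  then have "integral {0..L} (\<lambda>t. indicator {..x} t * f' t) = f x - f 0"
    by (rule integral_unique)
  moreover have "(\<integral>t. indicator {..x} t * f' t \<partial>interval_measure_on L) =
      integral {0<..<L} (\<lambda>t. indicator {..x} t * f' t)"
    by (rule lebesgue_integral_eq_integral)
      (intro integrable_indicator_atMost integrable_continuous_interval c, simp)
  ultimately show "f x = f 0 + (\<integral>t. indicator {..x} t * f' t \<partial>interval_measure_on L)"
    unfolding integral_open_interval_real by linarith
qed

section \<open>Test functions and the lemma of du Bois-Reymond\<close>

lemma tendsto_poly_mult_exp_neg:
  fixes p :: "real poly"
  shows "((\<lambda>x. poly p x * exp (- x)) \<longlongrightarrow> 0) at_top"
proof -
  have "((\<lambda>x. \<Sum>i\<le>degree p. coeff p i * (x ^ i / exp x)) \<longlongrightarrow> (\<Sum>i\<le>degree p. coeff p i * 0)) at_top"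
    by (intro tendsto_sum tendsto_mult tendsto_const tendsto_power_div_exp_0)
  then show ?thesis
    by (simp add: poly_altdef sum_distrib_right exp_minus divide_inverse mult.assoc)
qed

text \<open>The classical flat function exp (- 1 / x), with a polynomial in 1 / x as a factor so
  that the family contains its own derivatives.\<close>

definition flat_exp :: "real poly \<Rightarrow> real \<Rightarrow> real" where
  "flat_exp p x = (if x > 0 then poly p (1 / x) * exp (- (1 / x)) else 0)"

text \<open>In the variable u = 1 / x, differentiation by x is - u^2 times differentiation by u,
  which sends p(u) exp (- u) to u^2 (p - p')(u) exp (- u). The polynomial \<open>[:0, 0, 1:]\<close>
  is u^2.\<close>

lemma flat_exp_DERIV:
  "(flat_exp p has_real_derivative flat_exp ([:0, 0, 1:] * (p - pderiv p)) x) (at x)"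
proof -
  consider "x > 0" | "x < 0" | "x = 0" by linarith
  then show ?thesis
  proof cases
    case 1
    have "((\<lambda>x. poly p (1 / x) * exp (- (1 / x))) has_real_derivative
        flat_exp ([:0, 0, 1:] * (p - pderiv p)) x) (at x)"
      using 1 by (auto simp: flat_exp_def field_simps power2_eq_square intro!: derivative_eq_intros)
    moreover have ev: "\<forall>\<^sub>F y in nhds x. flat_exp p y = poly p (1 / y) * exp (- (1 / y))"
      using eventually_gt_at_top 1 by (auto simp: flat_exp_def eventually_nhds intro!: exI[of _ "{0<..}"])
    ultimately show ?thesis using DERIV_cong_ev[OF refl ev refl] by metis
  next
    case 2
    have ev: "\<forall>\<^sub>F y in nhds x. flat_exp p y = 0"
      using 2 by (auto simp: flat_exp_def eventually_nhds intro!: exI[of _ "{..<0}"])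
    moreover have "((\<lambda>y. 0 :: real) has_real_derivative flat_exp ([:0, 0, 1:] * (p - pderiv p)) x) (at x)"
      using 2 by (simp add: flat_exp_def)
    ultimately show ?thesis using DERIV_cong_ev[OF refl ev refl] by metis
  next
    case 3
    \<comment> \<open>At the origin the difference quotient is 0 from the left and u p(u) exp (- u)
      with u = 1 / y tending to infinity from the right.\<close>
    have "((\<lambda>y. flat_exp p y / y) \<longlongrightarrow> 0) (at 0)"
    proof (rule filterlim_split_at)
      have "\<forall>\<^sub>F y in at_left 0. flat_exp p y / y = (0::real)"
        by (auto simp: eventually_at_filter flat_exp_def)
      then show "((\<lambda>y. flat_exp p y / y) \<longlongrightarrow> 0) (at_left 0)"
        by (rule tendsto_eventually)
      have "((\<lambda>y. poly ([:0, 1:] * p) (inverse y) * exp (- inverse y)) \<longlongrightarrow> 0) (at_right 0)"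
        using filterlim_compose[OF tendsto_poly_mult_exp_neg filterlim_inverse_at_top_right] .
      moreover have "\<forall>\<^sub>F y in at_right 0. poly ([:0, 1:] * p) (inverse y) * exp (- inverse y) = flat_exp p y / y"
        by (auto simp: eventually_at_filter flat_exp_def field_simps)
      ultimately show "((\<lambda>y. flat_exp p y / y) \<longlongrightarrow> 0) (at_right 0)"
        by (rule Lim_transform_eventually)
    qed
    then show ?thesis
      using 3 by (simp add: has_field_derivative_iff flat_exp_def)
  qed
qed

text \<open>Every member has a derivative in the same set, so all members are smooth.\<close>

inductive_set flat_algebra :: "(real \<Rightarrow> real) set" where
  flat: "(\<lambda>x. flat_exp p (s * x + c)) \<in> flat_algebra"
| const: "(\<lambda>x. c) \<in> flat_algebra"
| add: "f \<in> flat_algebra \<Longrightarrow> g \<in> flat_algebra \<Longrightarrow> (\<lambda>x. f x + g x) \<in> flat_algebra"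
| mult: "f \<in> flat_algebra \<Longrightarrow> g \<in> flat_algebra \<Longrightarrow> (\<lambda>x. f x * g x) \<in> flat_algebra"

lemma flat_algebra_DERIV:
  "f \<in> flat_algebra \<Longrightarrow> \<exists>f'\<in>flat_algebra. \<forall>x. (f has_real_derivative f' x) (at x)"
proof (induction rule: flat_algebra.induct)
  case (flat p s c)
  let ?q = "[:0, 0, 1:] * (p - pderiv p)"
  have "((\<lambda>x. flat_exp p (s * x + c)) has_real_derivative flat_exp ?q (s * x + c) * s) (at x)" for x
    by (rule DERIV_chain2[OF flat_exp_DERIV]) (auto intro!: derivative_eq_intros)
  moreover have "(\<lambda>x. flat_exp ?q (s * x + c) * s) \<in> flat_algebra"
    by (intro flat_algebra.intros)
  ultimately show ?case
    by (intro bexI[of _ "\<lambda>x. flat_exp ?q (s * x + c) * s"] allI)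
next
  case (const c)
  show ?case by (rule bexI[of _ "\<lambda>x. 0"]) (auto intro: flat_algebra.intros)
next
  case (add f g)
  then obtain f' g' where "f' \<in> flat_algebra" "g' \<in> flat_algebra"
    "\<forall>x. (f has_real_derivative f' x) (at x)" "\<forall>x. (g has_real_derivative g' x) (at x)" by blast
  then show ?case
    by (intro bexI[of _ "\<lambda>x. f' x + g' x"]) (auto intro!: derivative_intros flat_algebra.intros)
next
  case (mult f g)
  then obtain f' g' where *: "f' \<in> flat_algebra" "g' \<in> flat_algebra"
    "\<forall>x. (f has_real_derivative f' x) (at x)" "\<forall>x. (g has_real_derivative g' x) (at x)" by blast
  show ?case
  proof (rule bexI[of _ "\<lambda>x. f' x * g x + f x * g' x"])
    show "\<forall>x. ((\<lambda>x. f x * g x) has_real_derivative f' x * g x + f x * g' x) (at x)"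
      using * by (auto intro!: derivative_eq_intros)
    show "(\<lambda>x. f' x * g x + f x * g' x) \<in> flat_algebra"
      using * mult.hyps by (intro flat_algebra.intros)
  qed
qed

lemma flat_algebra_deriv: "f \<in> flat_algebra \<Longrightarrow> deriv f \<in> flat_algebra"
proof -
  assume "f \<in> flat_algebra"
  then obtain f' where "f' \<in> flat_algebra" "\<forall>x. (f has_real_derivative f' x) (at x)"
    using flat_algebra_DERIV by blast
  moreover from this have "deriv f = f'" by (auto intro: DERIV_imp_deriv)
  ultimately show ?thesis by simp
qed

lemma flat_algebra_deriv_iter: "f \<in> flat_algebra \<Longrightarrow> (deriv ^^ n) f \<in> flat_algebra"
  by (induction n) (auto intro: flat_algebra_deriv)

lemma flat_algebra_differentiable: "f \<in> flat_algebra \<Longrightarrow> f differentiable (at x)"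
  using flat_algebra_DERIV real_differentiable_def by blast

text \<open>A flat function starting at lo times a reflected one ending at hi; both factors are
  positive exactly on their open half-lines.\<close>

lemma bump_exists:
  fixes lo hi :: real
  assumes "lo < hi"
  obtains b where "b \<in> flat_algebra" "\<And>x. b x \<ge> 0" "\<And>x. b x \<noteq> 0 \<longleftrightarrow> x \<in> {lo<..<hi}"
proof
  let ?b = "\<lambda>x. flat_exp 1 (1 * x + (- lo)) * flat_exp 1 ((-1) * x + hi)"
  show "?b \<in> flat_algebra" by (intro flat_algebra.intros)
  show "?b x \<ge> 0" for x by (simp add: flat_exp_def)
  show "?b x \<noteq> 0 \<longleftrightarrow> x \<in> {lo<..<hi}" for x by (auto simp: flat_exp_def)
qed

lemma test_function_DERIV:
  assumes "test_function L \<phi>"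
  shows "((deriv ^^ n) \<phi> has_real_derivative (deriv ^^ Suc n) \<phi> x) (at x)"
  using assms by (simp add: test_function_def real_differentiable_def DERIV_deriv_iff_real_differentiable)

lemma test_function_continuous:
  assumes "test_function L \<phi>"
  shows "continuous_on A ((deriv ^^ n) \<phi>)"
  using test_function_DERIV[OF assms] by (meson DERIV_isCont continuous_at_imp_continuous_on)

text \<open>The complement of the support is open, so a derivative that vanishes on it is locally
  zero there, and so is the next one. This removes the boundary terms whenever a derivative is moved
  off a test function.\<close>

lemma test_function_eq_0:
  assumes "test_function L \<phi>" "x \<notin> {0<..<L}"
  shows "(deriv ^^ n) \<phi> x = 0"
proof -
  have x: "x \<in> - closure {x. \<phi> x \<noteq> 0}" using assms by (auto simp: test_function_def)
  have "\<forall>y\<in>- closure {x. \<phi> x \<noteq> 0}. (deriv ^^ n) \<phi> y = 0"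
  proof (induction n)
    case 0
    then show ?case using closure_subset[of "{x. \<phi> x \<noteq> 0}"] by auto
  next
    case (Suc n)
    show ?case
    proof
      fix y assume y: "y \<in> - closure {x. \<phi> x \<noteq> 0}"
      have "\<forall>\<^sub>F z in nhds y. (deriv ^^ n) \<phi> z = 0"
        using Suc y by (auto simp: eventually_nhds intro!: exI[of _ "- closure {x. \<phi> x \<noteq> 0}"])
      then have "((deriv ^^ n) \<phi> has_real_derivative 0) (at y)"
        by (simp cong: DERIV_cong_ev)
      then show "(deriv ^^ Suc n) \<phi> y = 0" by (simp add: DERIV_imp_deriv)
    qed
  qed
  then show ?thesis using x by blast
qed

text \<open>An antiderivative that vanishes to the left of the support of \<psi> is constant to its
  right, and the constant is the integral of \<psi>. Mean zero therefore makes \<psi> the derivative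
  of a test function, which is the form in which test functions enter a first-order weak
  equation.\<close>

lemma test_function_antiderivative:
  assumes \<psi>: "\<psi> \<in> flat_algebra" and supp: "\<And>x. \<psi> x \<noteq> 0 \<Longrightarrow> x \<in> {lo..hi}"
    and lo: "0 < lo" and lh: "lo \<le> hi" and hi: "hi < L"
    and int: "(\<integral>x. \<psi> x \<partial>interval_measure_on L) = 0"
  obtains \<phi> where "test_function L \<phi>" "deriv \<phi> = \<psi>"
proof -
  have cont: "isCont \<psi> x" for x
    using \<psi> flat_algebra_differentiable differentiable_imp_continuous_within by blast
  have "\<exists>F. \<forall>x::real. - \<infinity> < ereal x \<longrightarrow> ereal x < \<infinity> \<longrightarrow> (F has_vector_derivative \<psi> x) (at x)"
    by (rule einterval_antiderivative) (auto simp: cont)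
  then obtain F where F: "\<And>x. (F has_real_derivative \<psi> x) (at x)"
    by (auto simp: has_real_derivative_iff_has_vector_derivative)
  define \<phi> where "\<phi> x = F x - F 0" for x
  have D: "(\<phi> has_real_derivative \<psi> x) (at x)" for x
    unfolding \<phi>_def using F[of x] by (auto intro!: derivative_eq_intros)
  have "primitive_on L \<phi> \<psi>"
    by (rule primitive_on_DERIV) (use D cont in \<open>auto intro: has_field_derivative_at_within continuous_at_imp_continuous_on\<close>)
  then have "\<phi> L = 0" using primitive_on_end[of L \<phi> \<psi>] int lo lh hi by (simp add: \<phi>_def)
  have const: "\<phi> x = \<phi> y" if z: "\<And>z. z \<in> {x<..<y} \<Longrightarrow> \<psi> z = 0" and xy: "x < y" for x y
  proof (rule ccontr)
    assume "\<phi> x \<noteq> \<phi> y"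
    obtain z where "x < z" "z < y" "\<phi> y - \<phi> x = (y - x) * \<psi> z"
      using MVT2[of x y \<phi> \<psi>] D xy by auto
    then show False using z[of z] \<open>\<phi> x \<noteq> \<phi> y\<close> by simp
  qed
  have "\<phi> x = 0" if x: "x \<notin> {lo..hi}" for x
  proof -
    consider "x < 0" | "x = 0" | "0 < x" "x < lo" | "hi < x" "x < L" | "x = L" | "x > L"
      using x unfolding atLeastAtMost_iff by linarith
    then show ?thesis
    proof cases
      case 1
      have "\<phi> x = \<phi> 0" by (rule const) (use 1 supp lo in force)+
      then show ?thesis by (simp add: \<phi>_def)
    next
      case 3
      have "\<phi> 0 = \<phi> x" by (rule const) (use 3 supp in force)+
      then show ?thesis by (simp add: \<phi>_def)
    next
      case 4
      have "\<phi> x = \<phi> L" by (rule const) (use 4 supp in force)+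
      then show ?thesis using \<open>\<phi> L = 0\<close> by simp
    next
      case 6
      have "\<phi> L = \<phi> x" by (rule const) (use 6 supp hi in force)+
      then show ?thesis using \<open>\<phi> L = 0\<close> by simp
    qed (use \<open>\<phi> L = 0\<close> in \<open>auto simp: \<phi>_def\<close>)
  qed
  then have "closure {x. \<phi> x \<noteq> 0} \<subseteq> {lo..hi}"
    by (intro closure_minimal) (blast, simp)
  then have "closure {x. \<phi> x \<noteq> 0} \<subseteq> {0<..<L}" using lo hi by fastforce
  moreover have d: "deriv \<phi> = \<psi>" using D by (auto intro: DERIV_imp_deriv)
  moreover have "(deriv ^^ n) \<phi> differentiable (at x)" for n x
  proof (cases n)
    case 0
    then show ?thesis using D real_differentiable_def by auto
  next
    case (Suc m)
    then have "(deriv ^^ n) \<phi> = (deriv ^^ m) \<psi>" by (simp add: funpow_swap1 d)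
    then show ?thesis using flat_algebra_differentiable flat_algebra_deriv_iter \<psi> by metis
  qed
  ultimately show thesis using that by (auto simp: test_function_def)
qed

text \<open>A vanishing integral of a nonnegative function would make it zero almost everywhere, and
  the nonempty interval on which it is positive would be a null set.\<close>

lemma integral_pos_interval:
  fixes b :: "real \<Rightarrow> real"
  assumes "continuous_on {0..L} b" "\<And>x. b x \<ge> 0" "\<And>x. b x \<noteq> 0 \<longleftrightarrow> x \<in> {lo<..<hi}"
    and "0 < lo" "lo < hi" "hi < L"
  shows "0 < (\<integral>x. b x \<partial>interval_measure_on L)"
proof -
  have i: "integrable (interval_measure_on L) b" by (rule integrable_continuous_interval[OF assms(1)])
  have "(\<integral>x. b x \<partial>interval_measure_on L) \<noteq> 0"
  proof
    assume "(\<integral>x. b x \<partial>interval_measure_on L) = 0"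
    then have "AE x in interval_measure_on L. b x = 0"
      using integral_nonneg_eq_0_iff_AE[OF i] assms(2) by simp
    then have "AE x in interval_measure_on L. x \<notin> {lo<..<hi}"
      by eventually_elim (use assms(3) in blast)
    then have "AE x in lebesgue. x \<in> {0<..<L} \<longrightarrow> x \<notin> {lo<..<hi}"
      by (subst (asm) AE_restrict_space_iff) auto
    then have "AE x in lebesgue. x \<notin> {lo<..<hi}"
      by eventually_elim (use assms in auto)
    then have "{lo<..<hi} \<in> null_sets lebesgue"
      by (subst AE_iff_null_sets) auto
    then have "emeasure lebesgue {lo<..<hi} = 0" by auto
    then show False using assms(5) by simp
  qed
  moreover have "0 \<le> (\<integral>x. b x \<partial>interval_measure_on L)" by (rule integral_nonneg_AE) (simp add: assms(2))
  ultimately show ?thesis by simp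
qed

text \<open>Continuity is dominated convergence with bound \<bar>F\<bar>: if u n tends to x, the
  indicators of {..u n} converge to that of {..x} at every t except t = x.\<close>

lemma primitive_on_indefinite:
  assumes "integrable (interval_measure_on L) F"
  defines "U \<equiv> \<lambda>x. \<integral>t. indicator {..x} t * F t \<partial>interval_measure_on L"
  shows "primitive_on L U F" "U 0 = 0" "continuous_on {0..L} U"
proof -
  have "U 0 = (\<integral>t. 0 \<partial>interval_measure_on L)"
    unfolding U_def by (rule Bochner_Integration.integral_cong) auto
  then show U0: "U 0 = 0" by simp
  show "primitive_on L U F"
  proof (rule primitive_onI[OF assms(1)])
    show "U x = U 0 + (\<integral>t. indicator {..x} t * F t \<partial>interval_measure_on L)" for x
      unfolding U0 by (simp add: U_def)
  qed
  show "continuous_on {0..L} U"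
  proof (rule continuous_on_sequentiallyI)
    fix u :: "nat \<Rightarrow> real" and x assume u: "u \<longlonglongrightarrow> x"
    have [measurable]: "F \<in> borel_measurable (interval_measure_on L)" using assms(1) by auto
    show "(\<lambda>n. U (u n)) \<longlonglongrightarrow> U x"
      unfolding U_def
    proof (rule integral_dominated_convergence[where w = "\<lambda>t. \<bar>F t\<bar>"])
      have "AE t in lebesgue. t \<notin> {x}"
        by (rule AE_not_in) (simp add: negligible_iff_null_sets[symmetric])
      then have "AE t in interval_measure_on L. t \<noteq> x"
        by (subst AE_restrict_space_iff) (auto elim: eventually_mono)
      then show "AE t in interval_measure_on L.
          (\<lambda>n. indicator {..u n} t * F t) \<longlonglongrightarrow> indicator {..x} t * F t"
      proof eventually_elim
        case (elim t)
        have "\<forall>\<^sub>F n in sequentially. (t \<le> u n) = (t \<le> x)"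
        proof (cases "t < x")
          case True
          then show ?thesis using order_tendstoD(1)[OF u True] by (auto elim: eventually_mono)
        next
          case False
          then have "x < t" using elim by simp
          then show ?thesis using order_tendstoD(2)[OF u, of t] by (auto elim: eventually_mono)
        qed
        then show ?case
          by (intro tendsto_eventually) (auto elim!: eventually_mono simp: indicator_def)
      qed
      show "(\<lambda>t. indicator {..x} t * F t) \<in> borel_measurable (interval_measure_on L)"
        "(\<lambda>t. indicator {..u n} t * F t) \<in> borel_measurable (interval_measure_on L)" for n
        by (intro borel_measurable_integrable integrable_indicator_atMost assms(1))+
      show "integrable (interval_measure_on L) (\<lambda>t. \<bar>F t\<bar>)" using assms(1) by simp
      show "AE t in interval_measure_on L. norm (indicator {..u n} t * F t) \<le> \<bar>F t\<bar>" for n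
        by (auto split: split_indicator)
    qed
  qed
qed

text \<open>Testing against the difference of two normalised bumps shows that the averages of K
  around x and around y agree. If K x were larger than K y, narrow bumps would keep these averages
  apart.\<close>

lemma weak_derivative_zero_le:
  fixes K :: "real \<Rightarrow> real"
  assumes K: "continuous_on {0..L} K"
    and weak: "\<And>\<phi>. test_function L \<phi> \<Longrightarrow> (\<integral>x. deriv \<phi> x * K x \<partial>interval_measure_on L) = 0"
    and xy: "x \<in> {0<..<L}" "y \<in> {0<..<L}"
  shows "K x \<le> K y"
proof (rule ccontr)
  let ?M = "interval_measure_on L"
  assume "\<not> K x \<le> K y"
  \<comment> \<open>m is the midpoint of the two values and \<eta> a quarter of their gap, so that m
    + \<eta> = K x - \<eta> and m - \<eta> = K y + \<eta>.\<close>
  define m \<eta> where "m = (K x + K y) / 2" and "\<eta> = (K x - K y) / 4"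
  have \<eta>: "\<eta> > 0" using \<open>\<not> K x \<le> K y\<close> by (simp add: \<eta>_def)
  have near: "\<exists>lo hi. 0 < lo \<and> lo < hi \<and> hi < L \<and> (\<forall>t\<in>{lo..hi}. \<bar>K t - K z\<bar> < \<eta>)"
    if z: "z \<in> {0<..<L}" for z
  proof -
    obtain d where d: "d > 0" "\<And>t. t \<in> {0..L} \<Longrightarrow> \<bar>t - z\<bar> < d \<Longrightarrow> \<bar>K t - K z\<bar> < \<eta>"
      using K z \<eta> unfolding continuous_on_iff dist_real_def by (metis greaterThanLessThan_iff atLeastAtMost_iff less_imp_le)
    define e where "e = min (d / 2) (min (z / 2) ((L - z) / 2))"
    have e: "e > 0" "e < d" "e < z" "e < L - z" using d(1) z by (auto simp: e_def min_def)
    then show ?thesis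
      by (intro exI[of _ "z - e"] exI[of _ "z + e"]) (auto intro!: d(2))
  qed
  obtain l1 h1 where 1: "0 < l1" "l1 < h1" "h1 < L" "\<forall>t\<in>{l1..h1}. \<bar>K t - K x\<bar> < \<eta>"
    using near[OF xy(1)] by blast
  obtain l2 h2 where 2: "0 < l2" "l2 < h2" "h2 < L" "\<forall>t\<in>{l2..h2}. \<bar>K t - K y\<bar> < \<eta>"
    using near[OF xy(2)] by blast
  obtain b1 where b1: "b1 \<in> flat_algebra" "\<And>t. b1 t \<ge> 0" "\<And>t. b1 t \<noteq> 0 \<longleftrightarrow> t \<in> {l1<..<h1}"
    using bump_exists[OF 1(2)] by blast
  obtain b2 where b2: "b2 \<in> flat_algebra" "\<And>t. b2 t \<ge> 0" "\<And>t. b2 t \<noteq> 0 \<longleftrightarrow> t \<in> {l2<..<h2}"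
    using bump_exists[OF 2(2)] by blast
  have cont: "continuous_on {0..L} b" if "b \<in> flat_algebra" for b
    using flat_algebra_differentiable[OF that]
    by (simp add: continuous_at_imp_continuous_on differentiable_imp_continuous_within)
  note c1 = cont[OF b1(1)] and c2 = cont[OF b2(1)]
  define I1 I2 where "I1 = (\<integral>t. b1 t \<partial>?M)" and "I2 = (\<integral>t. b2 t \<partial>?M)"
  have I1: "I1 > 0" unfolding I1_def by (rule integral_pos_interval[OF c1 b1(2,3) 1(1-3)])
  have I2: "I2 > 0" unfolding I2_def by (rule integral_pos_interval[OF c2 b2(2,3) 2(1-3)])
  have i1: "integrable ?M b1" "integrable ?M (\<lambda>t. b1 t * K t)"
    and i2: "integrable ?M b2" "integrable ?M (\<lambda>t. b2 t * K t)"
    using K c1 c2 by (auto intro!: integrable_continuous_interval continuous_intros)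
  \<comment> \<open>Each bump is divided by its integral, hence \<psi> has mean zero and is the
    derivative of a test function.\<close>
  define \<psi> where "\<psi> t = (1 / I1) * b1 t + (- 1 / I2) * b2 t" for t
  have "\<psi> \<in> flat_algebra" unfolding \<psi>_def by (intro flat_algebra.intros b1(1) b2(1))
  moreover have "(\<integral>t. \<psi> t \<partial>?M) = 0"
    unfolding \<psi>_def using i1 i2 I1 I2 by (simp add: I1_def[symmetric] I2_def[symmetric])
  moreover have "t \<in> {min l1 l2..max h1 h2}" if "\<psi> t \<noteq> 0" for t
    using that b1(3)[of t] b2(3)[of t] by (auto simp: \<psi>_def)
  ultimately obtain \<phi> where \<phi>: "test_function L \<phi>" "deriv \<phi> = \<psi>"
    using test_function_antiderivative[of \<psi> "min l1 l2" "max h1 h2" L] 1(1-3) 2(1-3) by (auto simp: less_max_iff_disj min_le_iff_disj le_max_iff_disj)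
  have "0 = (\<integral>t. \<psi> t * K t \<partial>?M)" using weak[OF \<phi>(1)] \<phi>(2) by simp
  also have "\<dots> = (\<integral>t. (1 / I1) * (b1 t * K t) + (- 1 / I2) * (b2 t * K t) \<partial>?M)"
    by (rule Bochner_Integration.integral_cong) (auto simp: \<psi>_def algebra_simps)
  also have "\<dots> = (1 / I1) * (\<integral>t. b1 t * K t \<partial>?M) + (- 1 / I2) * (\<integral>t. b2 t * K t \<partial>?M)"
    using i1 i2 by simp
  finally have eq: "(\<integral>t. b1 t * K t \<partial>?M) / I1 = (\<integral>t. b2 t * K t \<partial>?M) / I2" by simp
  have "(m + \<eta>) * I1 = (\<integral>t. b1 t * (m + \<eta>) \<partial>?M)" by (simp add: I1_def)
  also have "\<dots> \<le> (\<integral>t. b1 t * K t \<partial>?M)"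
  proof (rule integral_mono_AE)
    show "AE t in ?M. b1 t * (m + \<eta>) \<le> b1 t * K t"
    proof (rule AE_I2)
      fix t show "b1 t * (m + \<eta>) \<le> b1 t * K t"
      proof (cases "t \<in> {l1<..<h1}")
        case True
        then have "\<bar>K t - K x\<bar> < \<eta>" using 1(4) by auto
        then have "- (K t - K x) < \<eta>" by (simp add: abs_less_iff)
        then have "m + \<eta> \<le> K t" by (simp add: m_def \<eta>_def field_simps)
        then show ?thesis using b1(2) by (rule mult_left_mono)
      next
        case False
        then have "b1 t = 0" using b1(3)[of t] by blast
        then show ?thesis by simp
      qed
    qed
  qed (intro integrable_mult_left i1)+
  finally have A: "m + \<eta> \<le> (\<integral>t. b1 t * K t \<partial>?M) / I1" by (simp only: pos_le_divide_eq[OF I1])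
  have "(\<integral>t. b2 t * K t \<partial>?M) \<le> (\<integral>t. b2 t * (m - \<eta>) \<partial>?M)"
  proof (rule integral_mono_AE)
    show "AE t in ?M. b2 t * K t \<le> b2 t * (m - \<eta>)"
    proof (rule AE_I2)
      fix t show "b2 t * K t \<le> b2 t * (m - \<eta>)"
      proof (cases "t \<in> {l2<..<h2}")
        case True
        then have "\<bar>K t - K y\<bar> < \<eta>" using 2(4) by auto
        then have "K t - K y < \<eta>" by (simp add: abs_less_iff)
        then have "K t \<le> m - \<eta>" by (simp add: m_def \<eta>_def field_simps)
        then show ?thesis using b2(2) by (rule mult_left_mono)
      next
        case False
        then have "b2 t = 0" using b2(3)[of t] by blast
        then show ?thesis by simp
      qed
    qed
  qed (intro integrable_mult_left i2)+
  also have "\<dots> = (m - \<eta>) * I2" by (simp add: I2_def)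
  finally have "(\<integral>t. b2 t * K t \<partial>?M) / I2 \<le> m - \<eta>" by (simp only: pos_divide_le_eq[OF I2])
  then show False using A eq \<eta> by simp
qed

text \<open>Exchanging the two points turns the inequality into equality inside the interval;
  continuity carries it to the endpoints.\<close>

lemma weak_derivative_zero_constant:
  fixes K :: "real \<Rightarrow> real"
  assumes K: "continuous_on {0..L} K" and L: "L > 0"
    and weak: "\<And>\<phi>. test_function L \<phi> \<Longrightarrow> (\<integral>x. deriv \<phi> x * K x \<partial>interval_measure_on L) = 0"
    and x: "x \<in> {0..L}"
  shows "K x = K 0"
proof -
  define c where "c = K (L / 2)"
  have c: "K y = c" if "y \<in> {0<..<L}" for y
    unfolding c_def using weak_derivative_zero_le[OF K weak, of y "L/2"] weak_derivative_zero_le[OF K weak, of "L/2" y] that L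
    by auto
  have "K y = c" if y: "y \<in> {0..L}" for y
  proof (rule continuous_constant_on_closure[of "{0<..<L}" K c])
    show "continuous_on (closure {0<..<L}) K" using K L by simp
    show "y \<in> closure {0<..<L}" using y L by simp
  qed (use c in auto)
  then show ?thesis using x L by auto
qed

text \<open>The weak identity says that G has distributional derivative - F. Adding an indefinite
  integral U of F produces a continuous function with weak derivative zero, so G + U is
  constant.\<close>

lemma du_bois_reymond:
  assumes L: "L > 0" and G: "continuous_on {0..L} G" and F: "integrable (interval_measure_on L) F"
    and weak: "\<And>\<phi>. test_function L \<phi> \<Longrightarrow>
      (\<integral>x. \<phi> x * F x \<partial>interval_measure_on L) = (\<integral>x. deriv \<phi> x * G x \<partial>interval_measure_on L)"
  shows "primitive_on L G (\<lambda>x. - F x)"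
proof -
  let ?M = "interval_measure_on L"
  define U where "U = (\<lambda>x. \<integral>t. indicator {..x} t * F t \<partial>?M)"
  note U = primitive_on_indefinite[OF F, folded U_def]
  have const: "G x + U x = G 0 + U 0" if x: "x \<in> {0..L}" for x
  proof (rule weak_derivative_zero_constant[of L "\<lambda>x. G x + U x"])
    show "continuous_on {0..L} (\<lambda>x. G x + U x)" using G U(3) by (rule continuous_on_add)
    fix \<phi> assume \<phi>: "test_function L \<phi>"
    have c: "continuous_on {0..L} \<phi>" "continuous_on {0..L} (deriv \<phi>)"
      using test_function_continuous[OF \<phi>, of _ 0] test_function_continuous[OF \<phi>, of _ 1] by auto
    have "primitive_on L \<phi> (deriv \<phi>)"
      by (rule primitive_on_DERIV)
        (use test_function_DERIV[OF \<phi>, of 0] c in \<open>auto intro: has_field_derivative_at_within\<close>)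
    from primitive_on_end[OF primitive_on_mult[OF this U(1) c(1) U(3)]]
    have "(\<integral>x. deriv \<phi> x * U x + \<phi> x * F x \<partial>?M) = 0"
      using test_function_eq_0[OF \<phi>, of _ 0] L by simp
    moreover have i: "integrable ?M (\<lambda>x. deriv \<phi> x * U x)" "integrable ?M (\<lambda>x. deriv \<phi> x * G x)"
      "integrable ?M (\<lambda>x. \<phi> x * F x)"
      by (intro integrable_continuous_interval continuous_intros c G U(3),
          intro integrable_continuous_interval continuous_intros c G U(3),
          rule integrable_continuous_mult[OF c(1) F])
    ultimately show "(\<integral>x. deriv \<phi> x * (G x + U x) \<partial>?M) = 0"
      using weak[OF \<phi>] by (simp add: distrib_left)
  qed (use L x in auto)
  have eq: "G x = G 0 - U x" if "x \<in> {0..L}" for x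
    using const[OF that] U(2) by (simp add: U_def)
  show ?thesis
  proof (rule primitive_onI)
    show "integrable ?M (\<lambda>x. - F x)" using F by simp
    show "G x = G 0 + (\<integral>t. indicator {..x} t * - F t \<partial>?M)" if "x \<in> {0..L}" for x
      using eq[OF that] by (simp add: U_def)
  qed
qed

section \<open>The steady state\<close>

text \<open>If w exceeded M at x, compactness would give a last point before x with w \<le> M.
  Beyond it w > M, hence w' \<le> 0, and the mean value theorem forbids any increase up to
  x.\<close>

lemma barrier_le:
  fixes w w' :: "real \<Rightarrow> real"
  assumes D: "\<And>x. x \<in> {0..b} \<Longrightarrow> (w has_real_derivative w' x) (at x within {0..b})"
    and w0: "w 0 \<le> M" and dec: "\<And>x. x \<in> {0..b} \<Longrightarrow> w x > M \<Longrightarrow> w' x \<le> 0"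
    and x: "x \<in> {0..b}"
  shows "w x \<le> M"
proof (rule ccontr)
  assume nle: "\<not> w x \<le> M"
  have cont: "continuous_on {0..x} w"
    by (rule DERIV_continuous_on[of _ w w'], rule DERIV_subset[OF D]) (use x in auto)
  have "{t \<in> {0..x}. w t \<le> M} = {0..x} \<inter> w -` {..M}" by auto
  then have "closed {t \<in> {0..x}. w t \<le> M}"
    using continuous_closed_preimage[OF cont closed_atLeastAtMost closed_atMost] by metis
  then have "compact ({0..x} \<inter> {t \<in> {0..x}. w t \<le> M})"
    by (rule compact_Int_closed[OF compact_Icc])
  moreover have "{0..x} \<inter> {t \<in> {0..x}. w t \<le> M} = {t \<in> {0..x}. w t \<le> M}" by auto
  ultimately have "compact {t \<in> {0..x}. w t \<le> M}" by simp
  moreover have "{t \<in> {0..x}. w t \<le> M} \<noteq> {}" using x w0 by auto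
  ultimately obtain x0 where x0: "x0 \<in> {t \<in> {0..x}. w t \<le> M}" "\<And>t. t \<in> {t \<in> {0..x}. w t \<le> M} \<Longrightarrow> t \<le> x0"
    using compact_attains_sup[of "{t \<in> {0..x}. w t \<le> M}"] by blast
  have lt: "x0 < x" using x0(1) nle by (cases "x0 = x") auto
  have "\<exists>z\<in>{x0<..<x}. w x - w x0 = (\<lambda>y. w' z * y) (x - x0)"
  proof (rule mvt_simple[OF lt])
    fix z assume z: "x0 \<le> z" "z \<le> x"
    have "(w has_real_derivative w' z) (at z within {x0..x})"
      by (rule DERIV_subset[OF D]) (use x x0(1) z in auto)
    then show "(w has_derivative (\<lambda>y. w' z * y)) (at z within {x0..x})"
      by (simp add: has_field_derivative_def)
  qed
  then obtain z where z: "x0 < z" "z < x" "w x - w x0 = w' z * (x - x0)" by auto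
  have "w z > M" using x0(2)[of z] z x0(1) by force
  then have "w' z \<le> 0" using dec z x x0(1) by auto
  then have "w x - w x0 \<le> 0" using z lt by (simp add: mult_nonpos_nonneg)
  then show False using nle x0(1) by auto
qed

lemma growth_le:
  fixes w w' :: "real \<Rightarrow> real"
  assumes D: "\<And>x. x \<in> {0..b} \<Longrightarrow> (w has_real_derivative w' x) (at x within {0..b})"
    and bd: "\<And>x. x \<in> {0..b} \<Longrightarrow> w' x \<le> M" and xy: "0 \<le> x" "x \<le> y" "y \<le> b"
  shows "w y - w x \<le> M * (y - x)"
proof (cases "x = y")
  case False
  then have lt: "x < y" using xy by simp
  have "\<exists>z\<in>{x<..<y}. w y - w x = (\<lambda>u. w' z * u) (y - x)"
  proof (rule mvt_simple[OF lt])
    fix z assume z: "x \<le> z" "z \<le> y"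
    have "(w has_real_derivative w' z) (at z within {x..y})"
      by (rule DERIV_subset[OF D]) (use xy z in auto)
    then show "(w has_derivative (\<lambda>u. w' z * u)) (at z within {x..y})"
      by (simp add: has_field_derivative_def)
  qed
  then obtain z where "z \<in> {x<..<y}" "w y - w x = w' z * (y - x)" by blast
  then show ?thesis using bd[of z] xy lt by (auto intro!: mult_right_mono)
qed simp

text \<open>
  The bound on \<open>V' / \<mu>\<close> as long as \<open>V \<le> W\<close>: the flux \<open>w = H V'\<close> satisfies \<open>4 \<mu> w' = f - (g H - V\<^sup>2) w / V\<close>
  with \<open>f \<le> 3 \<mu> V / H\<close>, hence cannot exceed \<open>3 \<mu> V\<^sup>2 / (H (g H - V\<^sup>2))\<close>, and \<open>H = q / V\<close> with \<open>q = H\<^sub>0 V\<^sub>0\<close>.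
\<close>

definition slope_bound :: "real \<Rightarrow> real \<Rightarrow> real \<Rightarrow> real" where
  "slope_bound g q W = 3 * W\<^sup>2 / ((q / W)\<^sup>2 * (g * (q / W) - W\<^sup>2))"

locale steady =
  fixes L g \<kappa> \<mu> H0 V0 :: real and H V :: "real \<Rightarrow> real"
  assumes L: "L > 0" and g: "g > 0" and \<kappa>: "\<kappa> > 0" and \<mu>: "\<mu> > 0" and H0: "H0 > 0" and V0: "V0 > 0"
    and steady_state: "steady_state L g \<kappa> \<mu> H0 V0 H V"
begin

abbreviation "H' \<equiv> ddx L H"
abbreviation "V' \<equiv> ddx L V"
abbreviation "H'' \<equiv> ddx L H'"
abbreviation "V'' \<equiv> ddx L V'"

lemma init: "H 0 = H0" "V 0 = V0" "V' 0 = 0"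
  using steady_state by (auto simp: steady_state_def)

lemma C1: "C1_on L H" "C1_on L V" "C1_on L H'" "C1_on L V'"
  using steady_state by (auto simp: steady_state_def C2_on_def)

lemmas cont = C1[THEN C1_on_continuous(1)] C1(3,4)[THEN C1_on_continuous(2)]

lemma D:
  assumes "x \<in> {0..L}"
  shows "(H has_real_derivative H' x) (at x within {0..L})"
    and "(V has_real_derivative V' x) (at x within {0..L})"
    and "(H' has_real_derivative H'' x) (at x within {0..L})"
    and "(V' has_real_derivative V'' x) (at x within {0..L})"
  using C1_on_DERIV C1 assms L by auto

lemma pos: "x \<in> {0..L} \<Longrightarrow> H x > 0" "x \<in> {0..L} \<Longrightarrow> V x > 0"
  "x \<in> {0..L} \<Longrightarrow> g * H x > (V x)\<^sup>2"
  using steady_state by (auto simp: steady_state_def)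

lemma ddx_eq: "(f has_real_derivative d) (at x within {0..L}) \<Longrightarrow> x \<in> {0..L} \<Longrightarrow> ddx L f x = d"
  using L by (auto simp: ddx_def has_real_derivative_iff_has_vector_derivative
      intro!: vector_derivative_within_cbox[of 0 L, simplified])

lemma mass_deriv:
  assumes "x \<in> {0..L}" shows "H' x * V x + H x * V' x = 0"
proof -
  have "((\<lambda>z. H z * V z) has_real_derivative H' x * V x + H x * V' x) (at x within {0..L})"
    using D[OF assms] by (auto intro!: derivative_eq_intros)
  then have "ddx L (\<lambda>z. H z * V z) x = H' x * V x + H x * V' x" using ddx_eq assms by blast
  then show ?thesis using assms steady_state by (auto simp: steady_state_def)
qed

lemma mass: "x \<in> {0..L} \<Longrightarrow> H x * V x = H0 * V0"
proof -
  assume x: "x \<in> {0..L}"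
  have D0: "((\<lambda>z. H z * V z) has_real_derivative 0) (at z within {0..L})" if "z \<in> {0..L}" for z
    using D[OF that] mass_deriv[OF that] by (auto intro!: derivative_eq_intros simp: mult.commute)
  have D1: "((\<lambda>z. - (H z * V z)) has_real_derivative 0) (at z within {0..L})" if "z \<in> {0..L}" for z
    using DERIV_minus[OF D0[OF that]] by simp
  show ?thesis
    using growth_le[OF D0, of 0 0 x] growth_le[OF D1, of 0 0 x] x init by auto
qed

text \<open>Mass conservation gives H' = - H V' / V. Eliminating H' turns the momentum balance into
  a scalar relaxation equation for the flux w = H V', forced by friction and damped because g H >
  V^2.\<close>

lemma momentum:
  assumes x: "x \<in> {0..L}"
  shows "4 * \<mu> * (H' x * V' x + H x * V'' x) =
    friction \<kappa> \<mu> (H x) (V x) - (g * H x - (V x)\<^sup>2) * (H x * V' x) / V x"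
proof -
  have "((\<lambda>z. H z * V' z) has_real_derivative H' x * V' x + H x * V'' x) (at x within {0..L})"
    using D[OF x] by (auto intro!: derivative_eq_intros)
  then have "ddx L (\<lambda>z. H z * V' z) x = H' x * V' x + H x * V'' x" using ddx_eq x by blast
  then have eq: "V x * V' x + g * H' x + friction \<kappa> \<mu> (H x) (V x) / H x
      - 4 * \<mu> * (H' x * V' x + H x * V'' x) / H x = 0"
    using steady_state x by (auto simp: steady_state_def)
  have H': "H' x = - (H x * V' x / V x)" using mass_deriv[OF x] pos[OF x] by (simp add: field_simps)
  from eq have "H x * (V x * V' x + g * H' x) + friction \<kappa> \<mu> (H x) (V x) = 4 * \<mu> * (H' x * V' x + H x * V'' x)"
    using pos[OF x] by (simp add: divide_simps) (simp add: algebra_simps)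
  moreover have "H x * (V x * V' x + g * H' x) = - ((g * H x - (V x)\<^sup>2) * (H x * V' x) / V x)"
    unfolding H' using pos[OF x] by (simp add: field_simps power2_eq_square)
  ultimately show ?thesis by linarith
qed

text \<open>Omitting the summand 1 in the denominator of the friction gives the upper bound. It
  makes the friction of order \<mu>, whatever the size of \<kappa>.\<close>

lemma friction_bounds:
  assumes x: "x \<in> {0..L}"
  shows "friction \<kappa> \<mu> (H x) (V x) > 0" "friction \<kappa> \<mu> (H x) (V x) \<le> 3 * \<mu> * V x / H x"
proof -
  have d: "1 + \<kappa> * H x / (3 * \<mu>) > 0" using pos[OF x] \<kappa> \<mu> by (simp add: add_pos_pos)
  show "friction \<kappa> \<mu> (H x) (V x) > 0" using d pos[OF x] \<kappa> by (simp add: friction_def)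
  show "friction \<kappa> \<mu> (H x) (V x) \<le> 3 * \<mu> * V x / H x"
    unfolding friction_def using d pos[OF x] \<kappa> \<mu>
    by (simp add: divide_le_eq) (simp add: field_simps)
qed

lemma flux_DERIV:
  assumes "x \<in> {0..L}"
  shows "((\<lambda>z. H z * V' z) has_real_derivative H' x * V' x + H x * V'' x) (at x within {0..L})"
  using D[OF assms] by (auto intro!: derivative_eq_intros)

text \<open>Zero is a barrier for the flux: wherever H V' < 0, damping and friction both push it
  upwards, and it starts at 0.\<close>

lemma V'_nonneg:
  assumes x: "x \<in> {0..L}" shows "V' x \<ge> 0"
proof -
  have "- (H x * V' x) \<le> 0"
  proof (rule barrier_le[where b = L and w = "\<lambda>z. - (H z * V' z)" and w' = "\<lambda>z. - (H' z * V' z + H z * V'' z)"])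
    fix z assume z: "z \<in> {0..L}"
    show "((\<lambda>z. - (H z * V' z)) has_real_derivative - (H' z * V' z + H z * V'' z)) (at z within {0..L})"
      by (rule DERIV_minus[OF flux_DERIV[OF z]])
    assume "0 < - (H z * V' z)"
    then have "(g * H z - (V z)\<^sup>2) * (H z * V' z) / V z \<le> 0"
      using pos[OF z] by (intro divide_nonpos_pos mult_nonneg_nonpos[of _ "H z * V' z"]) auto
    then have "0 \<le> 4 * \<mu> * (H' z * V' z + H z * V'' z)"
      unfolding momentum[OF z] using friction_bounds[OF z] by simp
    then show "- (H' z * V' z + H z * V'' z) \<le> 0" using \<mu> by (simp add: zero_le_mult_iff)
  qed (use x init in auto)
  then show ?thesis using pos[OF x] by (simp add: zero_le_mult_iff)
qed

lemma V_mono: "0 \<le> x \<Longrightarrow> x \<le> y \<Longrightarrow> y \<le> L \<Longrightarrow> V x \<le> V y"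
proof -
  assume *: "0 \<le> x" "x \<le> y" "y \<le> L"
  have "- V y - - V x \<le> 0 * (y - x)"
    by (rule growth_le[where b = L and w' = "\<lambda>z. - V' z"])
      (use * D V'_nonneg in \<open>auto intro: DERIV_minus\<close>)
  then show ?thesis by simp
qed

lemma V_ge: "x \<in> {0..L} \<Longrightarrow> V0 \<le> V x"
  using V_mono[of 0 x] init by auto

text \<open>While V \<le> W, mass conservation bounds H below by h = q / W and the damping factor g
  H - V^2 below by a > 0. Above the level M damping outweighs friction, so the flux cannot cross M.
  Working on [0, b] instead of [0, L] leaves room for a continuation argument in b.\<close>

lemma V'_le:
  assumes W: "W > 0" "g * (H0 * V0 / W) > W\<^sup>2" and b: "b \<in> {0..L}" and VW: "\<And>x. x \<in> {0..b} \<Longrightarrow> V x \<le> W"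
    and x: "x \<in> {0..b}"
  shows "V' x \<le> \<mu> * slope_bound g (H0 * V0) W"
proof -
  define h a where "h = H0 * V0 / W" and "a = g * h - W\<^sup>2"
  have h: "h > 0" and a: "a > 0" using W H0 V0 by (auto simp: h_def a_def)
  have bounds: "h \<le> H z \<and> a \<le> g * H z - (V z)\<^sup>2 \<and> V z \<le> W" if "z \<in> {0..b}" for z
  proof -
    have z: "z \<in> {0..L}" using that b by auto
    have "H z = H0 * V0 / V z" using mass[OF z] pos[OF z] by (simp add: field_simps)
    then have "h \<le> H z" unfolding h_def using VW[OF that] pos[OF z] H0 V0 W
      by (simp add: divide_left_mono)
    moreover from this have "g * h \<le> g * H z" using g by simp
    moreover have "(V z)\<^sup>2 \<le> W\<^sup>2" using VW[OF that] pos[OF z] by (intro power_mono) auto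
    ultimately show ?thesis using VW[OF that] by (auto simp: a_def)
  qed
  \<comment> \<open>M balances the two bounds: a M / W equals 3 \<mu> W / h, the largest possible
    friction.\<close>
  define M where "M = 3 * \<mu> * W\<^sup>2 / (h * a)"
  have M: "M > 0" using h a W \<mu> by (simp add: M_def)
  have "H x * V' x \<le> M"
  proof (rule barrier_le[where b = b and w = "\<lambda>z. H z * V' z" and w' = "\<lambda>z. H' z * V' z + H z * V'' z"])
    fix z assume zb: "z \<in> {0..b}"
    then have z: "z \<in> {0..L}" using b by auto
    show "((\<lambda>z. H z * V' z) has_real_derivative H' z * V' z + H z * V'' z) (at z within {0..b})"
      by (rule DERIV_subset[OF flux_DERIV[OF z]]) (use b in auto)
    assume gt: "M < H z * V' z"
    have "3 * \<mu> * V z / H z \<le> 3 * \<mu> * W / h"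
      using bounds[OF zb] pos[OF z] h \<mu> by (intro frac_le mult_left_mono) auto
    also have "\<dots> = a * M / W" using a h W by (simp add: M_def power2_eq_square)
    also have "\<dots> \<le> (g * H z - (V z)\<^sup>2) * (H z * V' z) / V z"
      using bounds[OF zb] pos[OF z] gt a M W by (intro frac_le mult_mono) auto
    finally have "4 * \<mu> * (H' z * V' z + H z * V'' z) \<le> 0"
      unfolding momentum[OF z] using friction_bounds[OF z] by simp
    then show "H' z * V' z + H z * V'' z \<le> 0" using \<mu> by (simp add: mult_le_0_iff)
  qed (use x init M in auto)
  moreover have "h * V' x \<le> H x * V' x"
    using bounds[OF x] V'_nonneg[of x] x b by (intro mult_right_mono) auto
  ultimately have "V' x \<le> M / h" using h by (simp add: field_simps)
  also have "\<dots> = \<mu> * slope_bound g (H0 * V0) W"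
    unfolding M_def slope_bound_def h_def[symmetric] a_def[symmetric] by (simp add: power2_eq_square mult_ac)
  finally show ?thesis .
qed

text \<open>A bootstrap. If V exceeded W, it would equal W at some b and, being monotone, stay below
  W on [0, b]. There the slope bound holds, and it allows a growth of at most \<mu> times the slope
  times L, which is less than W - V0.\<close>

lemma V_bounds:
  assumes W: "W > V0" "g * (H0 * V0 / W) > W\<^sup>2" and small: "\<mu> * slope_bound g (H0 * V0) W * L < W - V0" and x: "x \<in> {0..L}"
  shows "V x \<le> W" "V' x \<le> \<mu> * slope_bound g (H0 * V0) W"
proof -
  have "slope_bound g (H0 * V0) W > 0" unfolding slope_bound_def using W H0 V0 by (intro divide_pos_pos mult_pos_pos) auto
  have le: "V x \<le> W" if x: "x \<in> {0..L}" for x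
  proof (rule ccontr)
    assume "\<not> V x \<le> W"
    then obtain b where b: "0 \<le> b" "b \<le> x" "V b = W"
      using IVT'[of V 0 W x] init W x continuous_on_subset[OF cont(2), of "{0..x}"] by auto
    have "V' z \<le> \<mu> * slope_bound g (H0 * V0) W" if "z \<in> {0..b}" for z
      by (rule V'_le[of W b]) (use W V0 b x that V_mono[of _ b] in auto)
    then have "V b - V 0 \<le> \<mu> * slope_bound g (H0 * V0) W * (b - 0)"
      by (intro growth_le[where b = b and w' = V'] DERIV_subset[OF D(2)]) (use b x in auto)
    also have "\<dots> \<le> \<mu> * slope_bound g (H0 * V0) W * L" using \<mu> \<open>slope_bound g (H0 * V0) W > 0\<close> b x by simp
    finally show False using b init small by simp
  qed
  show "V x \<le> W" by (rule le[OF x])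
  show "V' x \<le> \<mu> * slope_bound g (H0 * V0) W" by (rule V'_le[of W L]) (use W V0 L le x in auto)
qed

end

section \<open>The interior quadratic form\<close>

text \<open>
  With \<open>H = q / V\<close>, \<open>V' = \<mu> s\<close> and \<open>V''\<close> eliminated by the momentum equation, \<open>fric_coef\<close>, \<open>p_slope\<close> and
  \<open>c21_coef\<close> are \<open>f\<close>, \<open>p'\<close> and the entry \<open>C\<^sub>2\<^sub>1\<close> divided by \<open>\<mu>\<close>.  The interior form is
  \<open>- \<mu> (form_hh h\<^sup>2 - form_hv h v + form_vv v\<^sup>2)\<close>, see \<open>interior_form_eq\<close> below.
\<close>

definition fric_coef :: "real \<Rightarrow> real \<Rightarrow> real \<Rightarrow> real \<Rightarrow> real" where
  "fric_coef \<kappa> q \<mu> V = 3 * \<kappa> * V / (3 * \<mu> + \<kappa> * (q / V))"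

definition p_slope :: "real \<Rightarrow> real \<Rightarrow> real \<Rightarrow> real \<Rightarrow> real \<Rightarrow> real \<Rightarrow> real" where
  "p_slope g \<kappa> q \<mu> V s =
     (g * (q / V) - V\<^sup>2) * s / (q / V * V) - fric_coef \<kappa> q \<mu> V / (q / V)\<^sup>2 - 8 * \<mu>\<^sup>2 * s\<^sup>2 / (q / V * V)"

definition c21_coef :: "real \<Rightarrow> real \<Rightarrow> real \<Rightarrow> real \<Rightarrow> real \<Rightarrow> real" where
  "c21_coef \<kappa> q \<mu> V s =
     (- 4 * \<mu>\<^sup>2 * (q / V) * s\<^sup>2 / V - fric_coef \<kappa> q \<mu> V) / (q / V)\<^sup>2
       - (fric_coef \<kappa> q \<mu> V)\<^sup>2 / (3 * (q / V) * V)"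

definition form_hh :: "real \<Rightarrow> real \<Rightarrow> real \<Rightarrow> real \<Rightarrow> real \<Rightarrow> real \<Rightarrow> real" where
  "form_hh g \<kappa> q \<mu> V s = ((g - 4 * \<mu>\<^sup>2 * s / (q / V)) * s - p_slope g \<kappa> q \<mu> V s * V) / 2"

definition form_hv :: "real \<Rightarrow> real \<Rightarrow> real \<Rightarrow> real \<Rightarrow> real \<Rightarrow> real \<Rightarrow> real" where
  "form_hv g \<kappa> q \<mu> V s = q / V * (p_slope g \<kappa> q \<mu> V s - c21_coef \<kappa> q \<mu> V s)"

definition form_vv :: "real \<Rightarrow> real \<Rightarrow> real \<Rightarrow> real \<Rightarrow> real \<Rightarrow> real" where
  "form_vv \<kappa> q \<mu> V s = q / V * s + fric_coef \<kappa> q \<mu> V / V"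

text \<open>The tube lemma. It lets the form be examined separately at each limiting slope s and
  still yields one neighbourhood valid for all s in a compact interval.\<close>

lemma eventually_uniform_compact:
  fixes x0 :: "'a::topological_space" and K :: "'b::topological_space set"
  assumes "compact K" "\<And>s. s \<in> K \<Longrightarrow> \<forall>\<^sub>F t in nhds (x0, s). P (fst t) (snd t)"
  shows "\<forall>\<^sub>F x in nhds x0. \<forall>s\<in>K. P x s"
proof -
  let ?W = "\<Union>{S. open S \<and> (\<forall>t\<in>S. P (fst t) (snd t))}"
  have "\<exists>X0. x0 \<in> X0 \<and> open X0 \<and> X0 \<times> K \<subseteq> ?W"
  proof (rule Elementary_Topology.tube_lemma[OF assms(1)])
    show "open ?W" by auto
    show "{x0} \<times> K \<subseteq> ?W" using assms(2) by (force simp: eventually_nhds)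
  qed
  then obtain X0 where "x0 \<in> X0" "open X0" "X0 \<times> K \<subseteq> ?W" by blast
  then show ?thesis unfolding eventually_nhds by (intro exI[of _ X0]) force
qed

text \<open>Completing the square in h after subtracting c from both diagonal coefficients;
  multiplication by 4 (a - c) avoids a division.\<close>

lemma quadratic_form_ge:
  fixes a b d c h v :: real
  assumes "a > c" "b\<^sup>2 \<le> 4 * (a - c) * (d - c)"
  shows "c * (h\<^sup>2 + v\<^sup>2) \<le> a * h\<^sup>2 - b * (h * v) + d * v\<^sup>2"
proof -
  have "0 \<le> (2 * (a - c) * h - b * v)\<^sup>2 + (4 * (a - c) * (d - c) - b\<^sup>2) * v\<^sup>2"
    using assms by simp
  also have "\<dots> = 4 * (a - c) * ((a - c) * h\<^sup>2 - b * (h * v) + (d - c) * v\<^sup>2)"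
    by (simp add: power2_eq_square algebra_simps)
  finally have "0 \<le> (a - c) * h\<^sup>2 - b * (h * v) + (d - c) * v\<^sup>2"
    using assms(1) by (simp add: zero_le_mult_iff)
  then show ?thesis by (simp add: algebra_simps)
qed

text \<open>After division by \<mu> the coefficients extend continuously to \<mu> = 0. There the
  rescaled friction is 3 V0 / H0, in which \<kappa> cancels. The filter is arbitrary so that \<mu>,
  V and s can vary jointly.\<close>

lemma form_limits:
  fixes x0 :: "'b" and F
  assumes "q > 0" "V0 > 0" "\<kappa> > 0"
    and m: "(m \<longlongrightarrow> 0) F" and v: "(v \<longlongrightarrow> V0) F" and s: "(s \<longlongrightarrow> s0) F"
  defines "H0 \<equiv> q / V0"
  shows "((\<lambda>t. form_hh g \<kappa> q (m t) (v t) (s t)) \<longlongrightarrow> (3 * V0\<^sup>2 / H0 ^ 3 + s0 * V0\<^sup>2 / H0) / 2) F"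
    and "((\<lambda>t. form_hv g \<kappa> q (m t) (v t) (s t)) \<longlongrightarrow> 3 * V0 / H0\<^sup>2 + (g * H0 - V0\<^sup>2) * s0 / V0) F"
    and "((\<lambda>t. form_vv \<kappa> q (m t) (v t) (s t)) \<longlongrightarrow> H0 * s0 + 3 / H0) F"
proof -
  have H0: "H0 > 0" using assms(1,2) by (simp add: H0_def)
  have h: "((\<lambda>t. q / v t) \<longlongrightarrow> H0) F"
    unfolding H0_def using assms by (intro tendsto_intros) auto
  have "((\<lambda>t. fric_coef \<kappa> q (m t) (v t)) \<longlongrightarrow> 3 * \<kappa> * V0 / (3 * 0 + \<kappa> * H0)) F"
    unfolding fric_coef_def using assms H0 by (intro tendsto_intros h) auto
  then have f: "((\<lambda>t. fric_coef \<kappa> q (m t) (v t)) \<longlongrightarrow> 3 * V0 / H0) F"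
    using assms(1-3) by (simp del: times_divide_eq_right)
  have "((\<lambda>t. p_slope g \<kappa> q (m t) (v t) (s t)) \<longlongrightarrow>
      (g * H0 - V0\<^sup>2) * s0 / (H0 * V0) - 3 * V0 / H0 / H0\<^sup>2 - 8 * 0\<^sup>2 * s0\<^sup>2 / (H0 * V0)) F"
    unfolding p_slope_def using assms H0 by (intro tendsto_intros h f) auto
  then have p: "((\<lambda>t. p_slope g \<kappa> q (m t) (v t) (s t)) \<longlongrightarrow>
      (g * H0 - V0\<^sup>2) * s0 / (H0 * V0) - 3 * V0 / H0 ^ 3) F"
    by (simp add: power3_eq_cube power2_eq_square mult.assoc)
  have "((\<lambda>t. c21_coef \<kappa> q (m t) (v t) (s t)) \<longlongrightarrow>
      (- 4 * 0\<^sup>2 * H0 * s0\<^sup>2 / V0 - 3 * V0 / H0) / H0\<^sup>2 - (3 * V0 / H0)\<^sup>2 / (3 * H0 * V0)) F"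
    unfolding c21_coef_def using assms H0 by (intro tendsto_intros h f) auto
  moreover have "(- 4 * 0\<^sup>2 * H0 * s0\<^sup>2 / V0 - 3 * V0 / H0) / H0\<^sup>2 - (3 * V0 / H0)\<^sup>2 / (3 * H0 * V0) = - 6 * V0 / H0 ^ 3"
    using H0 assms(2) by (simp add: power3_eq_cube power2_eq_square field_simps)
  ultimately have c: "((\<lambda>t. c21_coef \<kappa> q (m t) (v t) (s t)) \<longlongrightarrow> - 6 * V0 / H0 ^ 3) F" by (simp only:)
  have "((\<lambda>t. form_hh g \<kappa> q (m t) (v t) (s t)) \<longlongrightarrow>
     ((g - 4 * 0\<^sup>2 * s0 / H0) * s0 - ((g * H0 - V0\<^sup>2) * s0 / (H0 * V0) - 3 * V0 / H0 ^ 3) * V0) / 2) F"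
    unfolding form_hh_def using assms H0 by (intro tendsto_intros h p) auto
  moreover have "((g - 4 * 0\<^sup>2 * s0 / H0) * s0 - ((g * H0 - V0\<^sup>2) * s0 / (H0 * V0) - 3 * V0 / H0 ^ 3) * V0) / 2
     = (3 * V0\<^sup>2 / H0 ^ 3 + s0 * V0\<^sup>2 / H0) / 2"
    using H0 assms(2) by (simp add: power3_eq_cube power2_eq_square field_simps)
  ultimately show "((\<lambda>t. form_hh g \<kappa> q (m t) (v t) (s t)) \<longlongrightarrow> (3 * V0\<^sup>2 / H0 ^ 3 + s0 * V0\<^sup>2 / H0) / 2) F" by (simp only:)
  have "((\<lambda>t. form_hv g \<kappa> q (m t) (v t) (s t)) \<longlongrightarrow>
     H0 * ((g * H0 - V0\<^sup>2) * s0 / (H0 * V0) - 3 * V0 / H0 ^ 3 - - 6 * V0 / H0 ^ 3)) F"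
    unfolding form_hv_def using assms H0 by (intro tendsto_intros h p c)
  moreover have "H0 * ((g * H0 - V0\<^sup>2) * s0 / (H0 * V0) - 3 * V0 / H0 ^ 3 - - 6 * V0 / H0 ^ 3)
     = 3 * V0 / H0\<^sup>2 + (g * H0 - V0\<^sup>2) * s0 / V0"
    using H0 assms(2) by (simp add: power3_eq_cube power2_eq_square field_simps)
  ultimately show "((\<lambda>t. form_hv g \<kappa> q (m t) (v t) (s t)) \<longlongrightarrow> 3 * V0 / H0\<^sup>2 + (g * H0 - V0\<^sup>2) * s0 / V0) F" by (simp only:)
  have "((\<lambda>t. form_vv \<kappa> q (m t) (v t) (s t)) \<longlongrightarrow> H0 * s0 + 3 * V0 / H0 / V0) F"
    unfolding form_vv_def using assms H0 by (intro tendsto_intros h f) auto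
  then show "((\<lambda>t. form_vv \<kappa> q (m t) (v t) (s t)) \<longlongrightarrow> H0 * s0 + 3 / H0) F"
    using assms(2) by simp
qed

text \<open>Both limiting diagonal coefficients are multiples of s + 3 / H^2, so four times their
  product is the perfect square 2 V^2 (s + 3 / H^2)^2. The mixed coefficient is nonnegative, and
  comparing square roots leaves a condition that is affine in s.\<close>

lemma form_discriminant:
  fixes g H V s :: real
  assumes pos: "H > 0" "V > 0" and s: "s \<ge> 0"
    and lin: "sqrt 2 * V * (s + 3 / H\<^sup>2) > 3 * V / H\<^sup>2 + (g * H - V\<^sup>2) * s / V"
    and sub: "g * H > V\<^sup>2"
  shows "(3 * V / H\<^sup>2 + (g * H - V\<^sup>2) * s / V)\<^sup>2 <
    4 * ((3 * V\<^sup>2 / H ^ 3 + s * V\<^sup>2 / H) / 2) * (H * s + 3 / H)"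
proof -
  have "(3 * V / H\<^sup>2 + (g * H - V\<^sup>2) * s / V)\<^sup>2 < (sqrt 2 * V * (s + 3 / H\<^sup>2))\<^sup>2"
    using assms by (intro power_strict_mono[OF lin]) (auto intro!: add_nonneg_nonneg)
  also have "\<dots> = 4 * ((3 * V\<^sup>2 / H ^ 3 + s * V\<^sup>2 / H) / 2) * (H * s + 3 / H)"
    using pos by (simp add: power_mult_distrib power2_eq_square power3_eq_cube field_simps)
  finally show ?thesis .
qed

text \<open>With a = g H - V^2, both sides at s = S are multiples of 3 V / (H^2 a), and the claim
  reduces to (2 - sqrt 2) a < sqrt 2 V^2. Since sqrt 2 / (2 - sqrt 2) = 1 + sqrt 2, this is the
  assumed bound on g H.\<close>

lemma form_threshold:
  fixes g H V :: real
  assumes pos: "H > 0" "V > 0" and sub: "g * H > V\<^sup>2" and thr: "g * H < (2 + sqrt 2) * V\<^sup>2"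
  defines "S \<equiv> 3 * V\<^sup>2 / (H\<^sup>2 * (g * H - V\<^sup>2))"
  shows "sqrt 2 * V * (S + 3 / H\<^sup>2) > 3 * V / H\<^sup>2 + (g * H - V\<^sup>2) * S / V"
proof -
  define a where "a = g * H - V\<^sup>2"
  have a: "a > 0" "a < (1 + sqrt 2) * V\<^sup>2" using sub thr by (auto simp: a_def algebra_simps)
  have "(2 - sqrt 2) * a < (2 - sqrt 2) * ((1 + sqrt 2) * V\<^sup>2)"
    using a sqrt2_less_2 by (intro mult_strict_left_mono) auto
  also have "\<dots> = sqrt 2 * V\<^sup>2" by (simp add: algebra_simps)
  finally have "2 * a < sqrt 2 * (V\<^sup>2 + a)" by (simp add: algebra_simps)
  then have "2 * a * (3 * V / (H\<^sup>2 * a)) < sqrt 2 * (V\<^sup>2 + a) * (3 * V / (H\<^sup>2 * a))"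
    using a pos by (intro mult_strict_right_mono) auto
  moreover have "2 * a * (3 * V / (H\<^sup>2 * a)) = 3 * V / H\<^sup>2 + a * S / V"
    using a pos unfolding S_def a_def[symmetric] by (simp add: field_simps power2_eq_square)
  moreover have "sqrt 2 * (V\<^sup>2 + a) * (3 * V / (H\<^sup>2 * a)) = sqrt 2 * V * (S + 3 / H\<^sup>2)"
    using a pos unfolding S_def a_def[symmetric] by (simp add: field_simps power2_eq_square)
  ultimately show ?thesis by (simp add: a_def)
qed

text \<open>Strict positivity at \<mu> = 0 and V = V0 for every slope in a compact interval survives
  small changes of \<mu> and V. W is taken so close to V0 that the slopes permitted by W remain
  inside that interval.\<close>

lemma form_uniform:
  fixes g \<kappa> H0 V0 :: real
  assumes pos: "g > 0" "\<kappa> > 0" "H0 > 0" "V0 > 0" and sub: "g * H0 > V0\<^sup>2" and thr: "g * H0 < (2 + sqrt 2) * V0\<^sup>2"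
  defines "q \<equiv> H0 * V0"
  obtains c W m where "c > 0" "W > V0" "m > 0" "g * (q / W) > W\<^sup>2"
    "\<And>\<mu> V s h v. 0 < \<mu> \<Longrightarrow> \<mu> < m \<Longrightarrow> V0 \<le> V \<Longrightarrow> V \<le> W \<Longrightarrow> 0 \<le> s \<Longrightarrow> s \<le> slope_bound g q W \<Longrightarrow>
       c * (h\<^sup>2 + v\<^sup>2) \<le> form_hh g \<kappa> q \<mu> V s * h\<^sup>2 - form_hv g \<kappa> q \<mu> V s * (h * v) + form_vv \<kappa> q \<mu> V s * v\<^sup>2"
proof -
  have q: "q > 0" "q / V0 = H0" using pos by (auto simp: q_def)
  define lin where "lin s = sqrt 2 * V0 * (s + 3 / H0\<^sup>2) - (3 * V0 / H0\<^sup>2 + (g * H0 - V0\<^sup>2) * s / V0)" for s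
  define S0 where "S0 = slope_bound g q V0"
  have S0: "S0 = 3 * V0\<^sup>2 / (H0\<^sup>2 * (g * H0 - V0\<^sup>2))" by (simp add: S0_def slope_bound_def q)
  have S0_pos: "S0 > 0" unfolding S0 using pos sub by simp
  \<comment> \<open>The slope bound for W > V0 need not stay below S0, so the inequality is first
    extended to some S beyond S0.\<close>
  have "(lin \<longlongrightarrow> lin S0) (at_right S0)"
    unfolding lin_def by (intro tendsto_intros) (use pos in auto)
  moreover have "lin S0 > 0" using form_threshold[OF pos(3,4) sub thr] by (simp add: lin_def S0)
  ultimately have "\<forall>\<^sub>F S in at_right S0. lin S > 0" by (rule order_tendstoD(1))
  moreover have "\<forall>\<^sub>F S in at_right S0. S > S0" by (rule eventually_at_right_less)
  ultimately have "\<forall>\<^sub>F S in at_right S0. lin S > 0 \<and> S > S0" by eventually_elim simp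
  then obtain S where S: "lin S > 0" "S > S0"
    using eventually_happens trivial_limit_at_right_real by blast
  have lin0: "lin 0 > 0" using pos by (simp add: lin_def divide_strict_right_mono)
  have lin: "lin s > 0" if "s \<in> {0..S}" for s
  proof -
    \<comment> \<open>\<open>lin\<close> is affine, hence its value at s is a convex combination of
      the two endpoint values.\<close>
    have "S * lin s = (S - s) * lin 0 + s * lin S" by (simp add: lin_def algebra_simps add_divide_distrib diff_divide_distrib)
    also have "\<dots> > 0"
    proof (cases "s = S")
      case False
      then show ?thesis using that S lin0 S0_pos by (intro add_pos_nonneg mult_pos_pos mult_nonneg_nonneg) auto
    qed (use S S0_pos in auto)
    finally show ?thesis using S S0_pos by (simp add: zero_less_mult_iff)
  qed
  \<comment> \<open>The middle coordinate of z is the margin to be subtracted from the diagonal.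
    Treated as a variable near 0, it is obtained from the same neighbourhood as the bounds on \<mu>
    and V.\<close>
  let ?P = "\<lambda>z s. fst (snd z) < form_hh g \<kappa> q (fst z) (snd (snd z)) s \<and>
     (form_hv g \<kappa> q (fst z) (snd (snd z)) s)\<^sup>2 <
       4 * (form_hh g \<kappa> q (fst z) (snd (snd z)) s - fst (snd z)) * (form_vv \<kappa> q (fst z) (snd (snd z)) s - fst (snd z))"
  have "\<forall>\<^sub>F z in nhds (0, 0, V0). \<forall>s\<in>{0..S}. ?P z s"
  proof (rule eventually_uniform_compact)
    fix s assume s: "s \<in> {0..S}"
    let ?F = "nhds ((0::real, 0::real, V0), s)"
    have id: "((\<lambda>t. t) \<longlongrightarrow> ((0, 0, V0), s)) ?F" by (rule filterlim_ident)
    have lm: "((\<lambda>t. fst (fst t)) \<longlongrightarrow> 0) ?F" and lc: "((\<lambda>t. fst (snd (fst t))) \<longlongrightarrow> 0) ?F"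
      and lv: "((\<lambda>t. snd (snd (fst t))) \<longlongrightarrow> V0) ?F" and ls: "((\<lambda>t. snd t) \<longlongrightarrow> s) ?F"
      by (auto intro!: tendsto_eq_intros id)
    note lims = form_limits[OF q(1) pos(4,2) lm lv ls, unfolded q(2)]
    have hh: "(3 * V0\<^sup>2 / H0 ^ 3 + s * V0\<^sup>2 / H0) / 2 > 0"
      using pos s by (intro divide_pos_pos add_pos_nonneg) auto
    have disc: "0 < 4 * ((3 * V0\<^sup>2 / H0 ^ 3 + s * V0\<^sup>2 / H0) / 2 - 0) * (H0 * s + 3 / H0 - 0) -
        (3 * V0 / H0\<^sup>2 + (g * H0 - V0\<^sup>2) * s / V0)\<^sup>2"
      using form_discriminant[OF pos(3,4) _ _ sub, of s] lin[OF s] s by (simp add: lin_def)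
    have "\<forall>\<^sub>F t in ?F. 0 < form_hh g \<kappa> q (fst (fst t)) (snd (snd (fst t))) (snd t) - fst (snd (fst t))"
      by (rule order_tendstoD(1)[OF tendsto_diff[OF lims(1) lc]]) (use hh in simp)
    moreover have "\<forall>\<^sub>F t in ?F. 0 < 4 * (form_hh g \<kappa> q (fst (fst t)) (snd (snd (fst t))) (snd t) - fst (snd (fst t))) *
        (form_vv \<kappa> q (fst (fst t)) (snd (snd (fst t))) (snd t) - fst (snd (fst t))) -
        (form_hv g \<kappa> q (fst (fst t)) (snd (snd (fst t))) (snd t))\<^sup>2"
      by (rule order_tendstoD(1)[OF _ disc]) (intro tendsto_intros lims lc)
    ultimately show "\<forall>\<^sub>F t in ?F. ?P (fst t) (snd t)"
      by eventually_elim simp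
  qed auto
  then obtain e where e: "e > 0" "\<And>z s. dist z (0, 0, V0) < e \<Longrightarrow> s \<in> {0..S} \<Longrightarrow> ?P z s"
    unfolding eventually_nhds_metric by blast
  have "(slope_bound g q \<longlongrightarrow> S0) (at_right V0)"
    unfolding slope_bound_def S0_def using pos q sub by (intro tendsto_intros) auto
  then have "\<forall>\<^sub>F W in at_right V0. slope_bound g q W < S" by (rule order_tendstoD(2)) (rule S)
  moreover have "\<forall>\<^sub>F W in at_right V0. 0 < g * (q / W) - W\<^sup>2"
  proof (rule order_tendstoD(1))
    show "((\<lambda>W. g * (q / W) - W\<^sup>2) \<longlongrightarrow> g * (q / V0) - V0\<^sup>2) (at_right V0)"
      using pos by (intro tendsto_intros) auto
    show "0 < g * (q / V0) - V0\<^sup>2" using sub q by simp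
  qed
  moreover have "\<forall>\<^sub>F W in at_right V0. W < V0 + e / 4"
    by (rule order_tendstoD(2)[OF tendsto_ident_at]) (use e in simp)
  moreover have "\<forall>\<^sub>F W in at_right V0. V0 < W" by (rule eventually_at_right_less)
  ultimately have "\<forall>\<^sub>F W in at_right V0. slope_bound g q W < S \<and> 0 < g * (q / W) - W\<^sup>2 \<and> W < V0 + e / 4 \<and> V0 < W"
    by eventually_elim simp
  then obtain W where W: "slope_bound g q W < S" "0 < g * (q / W) - W\<^sup>2" "W < V0 + e / 4" "V0 < W"
    using eventually_happens trivial_limit_at_right_real by blast
  show thesis
  \<comment> \<open>Each of the three coordinates of (\<mu>, e / 4, V) is within e / 4 of the base
    point, which keeps the product distance below e.\<close>
  proof (rule that[of "e / 4" W "e / 4"])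
    fix \<mu> V s h v :: real
    assume *: "0 < \<mu>" "\<mu> < e / 4" "V0 \<le> V" "V \<le> W" "0 \<le> s" "s \<le> slope_bound g q W"
    have "dist (\<mu>, e / 4, V) (0, 0, V0) \<le> dist \<mu> 0 + (dist (e / 4) 0 + dist V V0)"
      unfolding dist_Pair_Pair by (intro order.trans[OF sqrt_sum_squares_le_sum] add_mono order.refl) auto
    also have "\<dots> < e" using * W e by (simp add: dist_real_def)
    finally have "?P (\<mu>, e / 4, V) s" using * W by (intro e(2)) auto
    then show "e / 4 * (h\<^sup>2 + v\<^sup>2) \<le> form_hh g \<kappa> q \<mu> V s * h\<^sup>2 - form_hv g \<kappa> q \<mu> V s * (h * v) + form_vv \<kappa> q \<mu> V s * v\<^sup>2"
      by (intro quadratic_form_ge) auto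
  qed (use e W in auto)
qed

section \<open>The energy identity\<close>

lemma norm_vec2_sq: "(norm (u :: real^2))\<^sup>2 = (u $ 1)\<^sup>2 + (u $ 2)\<^sup>2"
  by (simp add: norm_vec_def L2_set_def sum_2 sum_nonneg)

lemma mat2_mult_vec:
  "(mat2 a b c d *v u) $ 1 = a * u $ 1 + b * u $ 2"
  "(mat2 a b c d *v u) $ 2 = c * u $ 1 + d * u $ 2"
  by (simp_all add: mat2_def matrix_vector_mult_def sum_2)

lemma scaleR_mat2: "k *\<^sub>R mat2 a b c d = mat2 (k * a) (k * b) (k * c) (k * d)"
  by (simp add: mat2_def vec_eq_iff forall_2)

lemma mat2_has_vector_derivative:
  assumes "(a has_real_derivative a') F" "(b has_real_derivative b') F"
    "(c has_real_derivative c') F" "(d has_real_derivative d') F"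
  shows "((\<lambda>x. mat2 (a x) (b x) (c x) (d x)) has_vector_derivative mat2 a' b' c' d') F"
proof -
  have eq: "mat2 a b c d = a *\<^sub>R mat2 1 0 0 0 + b *\<^sub>R mat2 0 1 0 0 + c *\<^sub>R mat2 0 0 1 0 + d *\<^sub>R mat2 0 0 0 1"
    for a b c d
    by (simp add: mat2_def vec_eq_iff forall_2)
  have sc: "((\<lambda>x. k x *\<^sub>R E) has_vector_derivative k' *\<^sub>R E) F"
    if "(k has_real_derivative k') F" for k k' and E :: "real^2^2"
    using bounded_linear.has_vector_derivative[OF bounded_linear_scaleR_left, of k k' F E] that
    by (simp add: has_real_derivative_iff_has_vector_derivative)
  show ?thesis
    unfolding eq[of "a _"] eq[of a'] by (intro has_vector_derivative_add sc assms)
qed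

lemma ddx_mat2:
  assumes "(a has_real_derivative a') (at x within {0..L})" "(b has_real_derivative b') (at x within {0..L})"
    "(c has_real_derivative c') (at x within {0..L})" "(d has_real_derivative d') (at x within {0..L})"
    and "x \<in> {0..L}" "L > 0"
  shows "ddx L (\<lambda>x. mat2 (a x) (b x) (c x) (d x)) x = mat2 a' b' c' d'"
  unfolding ddx_def
  using mat2_has_vector_derivative[OF assms(1-4)] assms(5,6)
  by (intro vector_derivative_within_cbox[of 0 L, simplified]) auto

lemma measurable_vec_nth:
  fixes u :: "'a \<Rightarrow> real^2"
  assumes "u \<in> borel_measurable M"
  shows "(\<lambda>x. u x $ i) \<in> borel_measurable M"
  by (rule borel_measurable_continuous_on[OF _ assms]) (intro continuous_intros)

lemma L2_space_components:
  assumes "u \<in> L2_space L"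
  shows "(\<lambda>x. u x $ i) \<in> borel_measurable (interval_measure_on L)"
    and "integrable (interval_measure_on L) (\<lambda>x. (u x $ i)\<^sup>2)"
    and "integrable (interval_measure_on L) (\<lambda>x. u x $ i)"
proof -
  have m: "u \<in> borel_measurable (interval_measure_on L)"
    and n: "integrable (interval_measure_on L) (\<lambda>x. (norm (u x))\<^sup>2)"
    using assms by (auto simp: L2_space_def)
  interpret finite_measure "interval_measure_on L" by (rule finite_measure_interval)
  show mi[measurable]: "(\<lambda>x. u x $ i) \<in> borel_measurable (interval_measure_on L)"
    by (rule measurable_vec_nth[OF m])
  show sq: "integrable (interval_measure_on L) (\<lambda>x. (u x $ i)\<^sup>2)"
  proof (rule Bochner_Integration.integrable_bound[OF n])
    have "(u x $ i)\<^sup>2 \<le> (norm (u x))\<^sup>2" for x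
      using component_le_norm_cart[of "u x" i] by (metis abs_ge_zero power2_abs power_mono)
    then show "AE x in interval_measure_on L. norm ((u x $ i)\<^sup>2) \<le> norm ((norm (u x))\<^sup>2)" by simp
  qed measurable
  have "integrable (interval_measure_on L) (\<lambda>x. u x $ i * 1)"
    by (rule integrable_square_mult[OF mi _ sq]) auto
  then show "integrable (interval_measure_on L) (\<lambda>x. u x $ i)" by simp
qed

lemma integral_vec2:
  fixes f :: "'a \<Rightarrow> real^2"
  assumes "integrable M (\<lambda>x. f x $ 1)" "integrable M (\<lambda>x. f x $ 2)"
  shows "(\<integral>x. f x \<partial>M) $ i = (\<integral>x. f x $ i \<partial>M)"
proof -
  have eq: "u = u $ 1 *\<^sub>R axis 1 1 + u $ 2 *\<^sub>R axis 2 1" for u :: "real^2"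
    by (simp add: vec_eq_iff forall_2 axis_def)
  have "integrable M (\<lambda>x. f x $ 1 *\<^sub>R axis 1 1 + f x $ 2 *\<^sub>R (axis 2 1 :: real^2))"
    using assms by auto
  then have "integrable M f" by (simp add: eq[symmetric])
  then show ?thesis
    using integral_bounded_linear[OF bounded_linear_vec_nth, of M f i] by simp
qed

lemma test_function_DERIV_within:
  assumes "test_function L \<phi>"
  shows "(((deriv ^^ n) \<phi>) has_real_derivative (deriv ^^ Suc n) \<phi> x) (at x within S)"
  by (rule has_field_derivative_at_within[OF test_function_DERIV[OF assms]])

text \<open>The two hypotheses are \<open>H r = H V - 4 \<mu> H'\<close> and its derivative, where \<open>H V\<close> is constant.\<close>

lemma energy_density:
  fixes H H1 H2 V V1 r r1 p p1 h dh v v1 F2 c21 c22 \<mu> :: real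
  assumes "H * r = H * V - 4 * \<mu> * H1" "H * r1 + H1 * r = - 4 * \<mu> * H2"
  shows "p * h * (- (V * dh) - V1 * h - H1 * v - H * v1) + H * v * F2 =
    (- 1) * ((H1 * v + v1 * H) * (- 4 * \<mu> * v1 + p * h + r * v) + (H * v) * (- (F2 - p1 * h - r1 * v + c21 * h + c22 * v)))
     + (- 1 / 2) * ((p1 * V + V1 * p) * (h * h) + (p * V) * (dh * h + h * dh))
     + (- 4 * \<mu> * H2 * (v * v) + (H * V / 2 - 4 * \<mu> * H1) * (2 * v * v1))
     + ((p1 * V - p * V1) / 2 * h\<^sup>2 + H * (p1 - c21) * (h * v) - H * c22 * v\<^sup>2 - 4 * \<mu> * H * v1\<^sup>2)"
    (is "?l = ?r")
proof -
  \<comment> \<open>All remaining terms cancel identically; the defects in v v1 and v^2 are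
    precisely the two hypotheses.\<close>
  have "?l - ?r = (H * r - (H * V - 4 * \<mu> * H1)) * (v * v1) + (H * r1 + H1 * r - (- 4 * \<mu> * H2)) * v\<^sup>2"
    by (simp add: field_simps power2_eq_square)
  also have "\<dots> = 0" unfolding assms by simp
  finally show ?thesis by simp
qed

section \<open>From the distributional equations to absolutely continuous fluxes\<close>

context steady begin

text \<open>\<open>p\<close>, \<open>r\<close> form the second row of \<open>B_mat\<close> and
  \<open>c21\<close>, \<open>c22\<close> that of \<open>C_mat\<close>. The first rows get no names:
  that of C is the derivative of that of B, so the mass equation is a pure divergence.\<close>

definition "p x = g - 4 * \<mu> * V' x / H x"
definition "p' x = - 4 * \<mu> * (V'' x * H x - V' x * H' x) / (H x)\<^sup>2"
definition "r x = V x - 4 * \<mu> * H' x / H x"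
definition "r' x = V' x - 4 * \<mu> * (H'' x * H x - H' x * H' x) / (H x)\<^sup>2"
definition "c21 x = (4 * \<mu> * H' x * V' x - friction \<kappa> \<mu> (H x) (V x)) / (H x)\<^sup>2
    - (friction \<kappa> \<mu> (H x) (V x))\<^sup>2 / (3 * \<mu> * H x * V x)"
definition "c22 x = V' x + friction \<kappa> \<mu> (H x) (V x) / (H x * V x)"

lemma p_r_DERIV:
  assumes "x \<in> {0..L}"
  shows "(p has_real_derivative p' x) (at x within {0..L})"
    and "(r has_real_derivative r' x) (at x within {0..L})"
proof -
  have q: "((\<lambda>x. k x / H x) has_real_derivative (k' * H x - k x * H' x) / (H x)\<^sup>2) (at x within {0..L})"
    if "(k has_real_derivative k') (at x within {0..L})" for k k'
    using DERIV_divide[OF that D(1)[OF assms]] pos(1)[OF assms] by (simp add: power2_eq_square)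
  show "(p has_real_derivative p' x) (at x within {0..L})"
    using DERIV_diff[OF DERIV_const[of g] DERIV_cmult[OF q[OF D(4)[OF assms]], of "4 * \<mu>"]]
    by (simp add: p_def[abs_def] p'_def)
  show "(r has_real_derivative r' x) (at x within {0..L})"
    using DERIV_diff[OF D(2)[OF assms] DERIV_cmult[OF q[OF D(3)[OF assms]], of "4 * \<mu>"]]
    by (simp add: r_def[abs_def] r'_def)
qed

lemma nz: "x \<in> {0..L} \<Longrightarrow> H x \<noteq> 0" "x \<in> {0..L} \<Longrightarrow> V x \<noteq> 0"
  using pos(1,2) by force+

lemma cont_coef:
  "continuous_on {0..L} p" "continuous_on {0..L} p'" "continuous_on {0..L} r" "continuous_on {0..L} r'"
  "continuous_on {0..L} c21" "continuous_on {0..L} c22"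
proof -
  have fr: "continuous_on {0..L} (\<lambda>x. friction \<kappa> \<mu> (H x) (V x))"
  proof -
    have "1 + \<kappa> * H x / (3 * \<mu>) \<noteq> 0" if "x \<in> {0..L}" for x
      using pos(1)[OF that] \<kappa> \<mu> by (metis add_pos_pos divide_pos_pos less_numeral_extra(1,3) mult_pos_pos zero_less_numeral)
    then show ?thesis unfolding friction_def using cont \<mu> by (intro continuous_intros) auto
  qed
  show "continuous_on {0..L} p" "continuous_on {0..L} p'" "continuous_on {0..L} r" "continuous_on {0..L} r'"
    unfolding p_def[abs_def] p'_def[abs_def] r_def[abs_def] r'_def[abs_def]
    by (intro continuous_intros cont; use nz in force)+
  show "continuous_on {0..L} c21" "continuous_on {0..L} c22"
    unfolding c21_def[abs_def] c22_def[abs_def]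
    by (intro continuous_intros cont fr; use nz \<mu> in force)+
qed

text \<open>In the first component the derivative of B cancels C and only V h + H v survives against
  \<phi>'. In the second component the derivatives \<open>p'\<close> and \<open>r'\<close> of the
  coefficients remain as zeroth-order terms.\<close>

lemma weak_equations:
  assumes y: "y \<in> L2_space L" and F: "F \<in> L2_space L" and op: "operator_value L g \<kappa> \<mu> H V y F"
    and h: "continuous_on {0..L} h" and v: "continuous_on {0..L} v"
    and ae: "AE x in interval_measure_on L. y x $ 1 = h x \<and> y x $ 2 = v x"
    and \<phi>: "test_function L \<phi>"
  shows "(\<integral>x. \<phi> x * F x $ 1 \<partial>interval_measure_on L) =
      (\<integral>x. deriv \<phi> x * (V x * h x + H x * v x) \<partial>interval_measure_on L)"
    and "(\<integral>x. \<phi> x * F x $ 2 \<partial>interval_measure_on L) =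
      (\<integral>x. 4 * \<mu> * (deriv (deriv \<phi>) x * v x) + deriv \<phi> x * (p x * h x + r x * v x)
         + \<phi> x * (p' x * h x + r' x * v x - c21 x * h x - c22 x * v x) \<partial>interval_measure_on L)"
proof -
  let ?M = "interval_measure_on L"
  note T = test_function_continuous[OF \<phi>]
  have c: "continuous_on {0..L} \<phi>" "continuous_on {0..L} (deriv \<phi>)" "continuous_on {0..L} (deriv (deriv \<phi>))"
    using T[of _ 0] T[of _ 1] T[of _ 2] by (auto simp: numeral_2_eq_2)
  let ?R = "\<lambda>x. (deriv (deriv \<phi>) x *\<^sub>R A_mat \<mu>) *v y x
               - ddx L (\<lambda>z. \<phi> z *\<^sub>R B_mat L g \<mu> H V z) x *v y x
               + (\<phi> x *\<^sub>R C_mat L \<kappa> \<mu> H V x) *v y x"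
  let ?R1 = "\<lambda>x. - (deriv \<phi> x * (V x * h x + H x * v x))"
  let ?R2 = "\<lambda>x. - (4 * \<mu> * (deriv (deriv \<phi>) x * v x) + deriv \<phi> x * (p x * h x + r x * v x)
         + \<phi> x * (p' x * h x + r' x * v x - c21 x * h x - c22 x * v x))"
  have B: "ddx L (\<lambda>z. \<phi> z *\<^sub>R B_mat L g \<mu> H V z) x =
      mat2 (deriv \<phi> x * V x + \<phi> x * V' x) (deriv \<phi> x * H x + \<phi> x * H' x)
        (deriv \<phi> x * p x + \<phi> x * p' x) (deriv \<phi> x * r x + \<phi> x * r' x)" if x: "x \<in> {0..L}" for x
  proof -
    have D\<phi>: "(\<phi> has_real_derivative deriv \<phi> x) (at x within {0..L})"
      using test_function_DERIV_within[OF \<phi>, of 0] by simp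
    have eq: "(\<lambda>z. \<phi> z *\<^sub>R B_mat L g \<mu> H V z) =
        (\<lambda>z. mat2 (\<phi> z * V z) (\<phi> z * H z) (\<phi> z * p z) (\<phi> z * r z))"
      by (simp add: B_mat_def scaleR_mat2 p_def r_def)
    have pr: "((\<lambda>z. \<phi> z * k z) has_real_derivative deriv \<phi> x * k x + \<phi> x * k') (at x within {0..L})"
      if "(k has_real_derivative k') (at x within {0..L})" for k k'
      using DERIV_mult[OF D\<phi> that] by (simp add: algebra_simps)
    show ?thesis
      unfolding eq by (rule ddx_mat2[OF pr[OF D(2)] pr[OF D(1)] pr[OF p_r_DERIV(1)] pr[OF p_r_DERIV(2)]])
        (use x L in auto)
  qed
  have R1: "?R x $ 1 = - (deriv \<phi> x * V x * y x $ 1 + deriv \<phi> x * H x * y x $ 2)"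
    and R2: "?R x $ 2 = - (4 * \<mu> * deriv (deriv \<phi>) x * y x $ 2 + deriv \<phi> x * p x * y x $ 1 + deriv \<phi> x * r x * y x $ 2
        + (\<phi> x * (p' x - c21 x)) * y x $ 1 + (\<phi> x * (r' x - c22 x)) * y x $ 2)"
    if "x \<in> {0..L}" for x
    unfolding B[OF that] A_mat_def C_mat_def Let_def scaleR_mat2 vector_add_component vector_minus_component
      mat2_mult_vec
    by (simp_all add: c21_def c22_def algebra_simps)
  have R: "AE x in ?M. ?R x $ 1 = ?R1 x \<and> ?R x $ 2 = ?R2 x"
    using ae AE_interval_measure_in
  proof eventually_elim
    case (elim x)
    then have x: "x \<in> {0..L}" by auto
    show ?case
      unfolding R1[OF x] R2[OF x] conjunct1[OF elim(1)] conjunct2[OF elim(1)]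
      by (simp add: algebra_simps)
  qed
  have iy: "integrable ?M (\<lambda>x. k x * y x $ i)" if "continuous_on {0..L} k" for k i
    by (rule integrable_continuous_mult[OF that L2_space_components(3)[OF y]])
  have iF: "integrable ?M (\<lambda>x. (\<phi> x *\<^sub>R F x) $ i)" for i
    using integrable_continuous_mult[OF c(1) L2_space_components(3)[OF F]] by simp
  have j1: "integrable ?M ?R1" and j2: "integrable ?M ?R2"
    by (intro integrable_continuous_interval continuous_intros c h v cont cont_coef)+
  have i1: "integrable ?M (\<lambda>x. ?R x $ 1)"
  proof (rule Bochner_Integration.integrable_cong[THEN iffD2, OF refl])
    show "?R x $ 1 = - (deriv \<phi> x * V x * y x $ 1 + deriv \<phi> x * H x * y x $ 2)" if "x \<in> space ?M" for x
      by (rule R1) (use that in auto)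
    show "integrable ?M (\<lambda>x. - (deriv \<phi> x * V x * y x $ 1 + deriv \<phi> x * H x * y x $ 2))"
      by (intro Bochner_Integration.integrable_minus Bochner_Integration.integrable_add iy continuous_intros c cont)
  qed
  have i2: "integrable ?M (\<lambda>x. ?R x $ 2)"
  proof (rule Bochner_Integration.integrable_cong[THEN iffD2, OF refl])
    show "?R x $ 2 = - (4 * \<mu> * deriv (deriv \<phi>) x * y x $ 2 + deriv \<phi> x * p x * y x $ 1 + deriv \<phi> x * r x * y x $ 2
        + (\<phi> x * (p' x - c21 x)) * y x $ 1 + (\<phi> x * (r' x - c22 x)) * y x $ 2)" if "x \<in> space ?M" for x
      by (rule R2) (use that in auto)
    show "integrable ?M (\<lambda>x. - (4 * \<mu> * deriv (deriv \<phi>) x * y x $ 2 + deriv \<phi> x * p x * y x $ 1 + deriv \<phi> x * r x * y x $ 2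
        + (\<phi> x * (p' x - c21 x)) * y x $ 1 + (\<phi> x * (r' x - c22 x)) * y x $ 2))"
      by (intro Bochner_Integration.integrable_minus Bochner_Integration.integrable_add iy continuous_intros c cont cont_coef)
  qed
  have vec: "(\<integral>x. \<phi> x *\<^sub>R F x \<partial>?M) = - (\<integral>x. ?R x \<partial>?M)"
    using op \<phi> by (simp add: operator_value_def)
  have eq: "(\<integral>x. (\<phi> x *\<^sub>R F x) $ i \<partial>?M) = - (\<integral>x. ?R x $ i \<partial>?M)" for i
    using arg_cong[OF vec, of "\<lambda>u. u $ i"]
    unfolding vector_uminus_component integral_vec2[OF iF iF] integral_vec2[OF i1 i2] .
  have mR: "(\<lambda>x. ?R x $ 1) \<in> borel_measurable ?M" "(\<lambda>x. ?R x $ 2) \<in> borel_measurable ?M"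
    using i1 i2 by (auto dest: borel_measurable_integrable)
  have "(\<integral>x. ?R x $ 1 \<partial>?M) = (\<integral>x. ?R1 x \<partial>?M)"
    by (rule integral_cong_AE[OF mR(1) borel_measurable_integrable[OF j1]]) (use R in eventually_elim, simp)
  then show "(\<integral>x. \<phi> x * F x $ 1 \<partial>?M) = (\<integral>x. deriv \<phi> x * (V x * h x + H x * v x) \<partial>?M)"
    using eq[of 1] by simp
  have A: "(\<integral>x. ?R x $ 2 \<partial>?M) = (\<integral>x. ?R2 x \<partial>?M)"
    by (rule integral_cong_AE[OF mR(2) borel_measurable_integrable[OF j2]]) (use R in eventually_elim, simp)
  show "(\<integral>x. \<phi> x * F x $ 2 \<partial>?M) =
      (\<integral>x. 4 * \<mu> * (deriv (deriv \<phi>) x * v x) + deriv \<phi> x * (p x * h x + r x * v x)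
         + \<phi> x * (p' x * h x + r' x * v x - c21 x * h x - c22 x * v x) \<partial>?M)"
    using eq[of 2] unfolding A integral_minus vector_scaleR_component real_scaleR_def minus_minus .
qed

text \<open>The mass equation is already of the form required by the lemma of du Bois-Reymond. In
  the momentum equation one derivative of \<phi> is first moved back onto v, which is possible
  because v is C^1; the viscous term then belongs to a first-order flux, and v is never
  differentiated twice.\<close>

lemma operator_primitives:
  assumes y: "y \<in> L2_space L" and F: "F \<in> L2_space L" and op: "operator_value L g \<kappa> \<mu> H V y F"
    and h: "continuous_on {0..L} h" and v: "C1_on L v"
    and ae: "AE x in interval_measure_on L. y x $ 1 = h x \<and> y x $ 2 = v x"
  shows "primitive_on L (\<lambda>x. V x * h x + H x * v x) (\<lambda>x. - F x $ 1)"
    and "primitive_on L (\<lambda>x. - 4 * \<mu> * ddx L v x + p x * h x + r x * v x)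
      (\<lambda>x. - (F x $ 2 - p' x * h x - r' x * v x + c21 x * h x + c22 x * v x))"
proof -
  let ?M = "interval_measure_on L"
  note cv = C1_on_continuous[OF v]
  note weak = weak_equations[OF y F op h cv(1) ae]
  note iF = L2_space_components(3)[OF F]
  show "primitive_on L (\<lambda>x. V x * h x + H x * v x) (\<lambda>x. - F x $ 1)"
    by (rule du_bois_reymond[OF L _ iF weak(1)]) (intro continuous_intros cont h cv)
  have low: "integrable ?M (\<lambda>x. p' x * h x + r' x * v x - c21 x * h x - c22 x * v x)"
    by (intro integrable_continuous_interval continuous_intros cont_coef h cv)
  let ?E = "\<lambda>x. F x $ 2 - p' x * h x - r' x * v x + c21 x * h x + c22 x * v x"
  have E: "?E = (\<lambda>x. F x $ 2 - (p' x * h x + r' x * v x - c21 x * h x - c22 x * v x))"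
    by (simp add: algebra_simps)
  have iE: "integrable ?M ?E"
    unfolding E by (rule Bochner_Integration.integrable_diff[OF iF low])
  show "primitive_on L (\<lambda>x. - 4 * \<mu> * ddx L v x + p x * h x + r x * v x) (\<lambda>x. - ?E x)"
  proof (rule du_bois_reymond[OF L _ iE])
    show "continuous_on {0..L} (\<lambda>x. - 4 * \<mu> * ddx L v x + p x * h x + r x * v x)"
      by (intro continuous_intros cont_coef h cv)
    fix \<phi> assume \<phi>: "test_function L \<phi>"
    have c: "continuous_on {0..L} \<phi>" "continuous_on {0..L} (deriv \<phi>)" "continuous_on {0..L} (deriv (deriv \<phi>))"
      using test_function_continuous[OF \<phi>, of _ 0] test_function_continuous[OF \<phi>, of _ 1]
        test_function_continuous[OF \<phi>, of _ 2] by (auto simp: numeral_2_eq_2)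
    have "primitive_on L (deriv \<phi>) (deriv (deriv \<phi>))"
      by (rule primitive_on_DERIV[OF _ c(3)]) (use test_function_DERIV_within[OF \<phi>, of 1] in simp)
    moreover have "primitive_on L v (ddx L v)"
      by (rule primitive_on_DERIV[OF C1_on_DERIV[OF v _ L] cv(2)])
    ultimately have "primitive_on L (\<lambda>x. deriv \<phi> x * v x) (\<lambda>x. deriv (deriv \<phi>) x * v x + deriv \<phi> x * ddx L v x)"
      by (rule primitive_on_mult[OF _ _ c(2) cv(1)])
    then have zero: "(\<integral>x. deriv (deriv \<phi>) x * v x + deriv \<phi> x * ddx L v x \<partial>?M) = 0"
      using primitive_on_end[of L "\<lambda>x. deriv \<phi> x * v x"] test_function_eq_0[OF \<phi>, of 0 1]
        test_function_eq_0[OF \<phi>, of L 1] L by simp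
    have i: "integrable ?M (\<lambda>x. deriv (deriv \<phi>) x * v x)" "integrable ?M (\<lambda>x. deriv \<phi> x * ddx L v x)"
      "integrable ?M (\<lambda>x. deriv \<phi> x * (p x * h x + r x * v x))"
      "integrable ?M (\<lambda>x. \<phi> x * (p' x * h x + r' x * v x - c21 x * h x - c22 x * v x))"
      by (intro integrable_continuous_interval continuous_intros c cv h cont_coef)+
    have iG: "integrable ?M (\<lambda>x. \<phi> x * F x $ 2)" by (rule integrable_continuous_mult[OF c(1) iF])
    have "(\<integral>x. \<phi> x * ?E x \<partial>?M) = (\<integral>x. \<phi> x * F x $ 2
        - \<phi> x * (p' x * h x + r' x * v x - c21 x * h x - c22 x * v x) \<partial>?M)"
      by (rule Bochner_Integration.integral_cong[OF refl]) (simp add: algebra_simps)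
    also have "\<dots> = (\<integral>x. \<phi> x * F x $ 2 \<partial>?M)
        - (\<integral>x. \<phi> x * (p' x * h x + r' x * v x - c21 x * h x - c22 x * v x) \<partial>?M)"
      by (rule Bochner_Integration.integral_diff[OF iG i(4)])
    also have "\<dots> = 4 * \<mu> * (\<integral>x. deriv (deriv \<phi>) x * v x \<partial>?M) + (\<integral>x. deriv \<phi> x * (p x * h x + r x * v x) \<partial>?M)"
      unfolding weak(2)[OF \<phi>] using i by simp
    also have "\<dots> = - 4 * \<mu> * (\<integral>x. deriv \<phi> x * ddx L v x \<partial>?M) + (\<integral>x. deriv \<phi> x * (p x * h x + r x * v x) \<partial>?M)"
      using zero i(1,2) by (simp add: add_eq_0_iff)
    also have "\<dots> = (\<integral>x. - 4 * \<mu> * (deriv \<phi> x * ddx L v x) + deriv \<phi> x * (p x * h x + r x * v x) \<partial>?M)"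
      using i by simp
    also have "\<dots> = (\<integral>x. deriv \<phi> x * (- 4 * \<mu> * ddx L v x + p x * h x + r x * v x) \<partial>?M)"
      by (rule Bochner_Integration.integral_cong) (auto simp: algebra_simps)
    finally show "(\<integral>x. \<phi> x * ?E x \<partial>?M) = (\<integral>x. deriv \<phi> x * (- 4 * \<mu> * ddx L v x + p x * h x + r x * v x) \<partial>?M)" .
  qed
qed

definition boundary_form :: "(real \<Rightarrow> real) \<Rightarrow> (real \<Rightarrow> real) \<Rightarrow> real \<Rightarrow> real" where
  "boundary_form h v x = 4 * \<mu> * H x * v x * ddx L v x - p x * H x * h x * v x
     - p x * V x * (h x)\<^sup>2 / 2 - H x * V x * (v x)\<^sup>2 / 2"

definition interior_form :: "(real \<Rightarrow> real) \<Rightarrow> (real \<Rightarrow> real) \<Rightarrow> real \<Rightarrow> real" where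
  "interior_form h v x = (p' x * V x - p x * V' x) / 2 * (h x)\<^sup>2 + H x * (p' x - c21 x) * (h x * v x)
     - H x * c22 x * (v x)\<^sup>2 - 4 * \<mu> * H x * (ddx L v x)\<^sup>2"

text \<open>The left-hand integrand is rewritten as the derivative of three products of primitives
  plus \<open>interior_form\<close>. The products are H v times the momentum flux, p V h^2, and a
  multiple of v^2 that corrects the transport term.\<close>

lemma energy_identity:
  assumes y: "y \<in> L2_space L" and F: "F \<in> L2_space L" and op: "operator_value L g \<kappa> \<mu> H V y F"
    and h: "continuous_on {0..L} h" and v: "C1_on L v"
    and ae: "AE x in interval_measure_on L. y x $ 1 = h x \<and> y x $ 2 = v x"
  shows "(\<integral>x. p x * h x * F x $ 1 + H x * v x * F x $ 2 \<partial>interval_measure_on L) =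
    boundary_form h v L - boundary_form h v 0 + (\<integral>x. interior_form h v x \<partial>interval_measure_on L)"
proof -
  let ?M = "interval_measure_on L"
  let ?v' = "ddx L v"
  note cv = C1_on_continuous[OF v]
  note prim = operator_primitives[OF assms]
  note iF = L2_space_components(3)[OF F]
  \<comment> \<open>The mass equation solved for h_x. It is legitimate because V h + H v is
    absolutely continuous, H v is C^1 and V has no zero, so h is itself a primitive.\<close>
  let ?dh = "\<lambda>x. (- F x $ 1 - V' x * h x - H' x * v x - H x * ?v' x) / V x"
  have ph: "primitive_on L h ?dh"
  proof (rule primitive_on_cong)
    have 1: "primitive_on L (\<lambda>x. H x * v x) (\<lambda>x. H' x * v x + H x * ?v' x)"
      by (rule primitive_on_mult[OF primitive_on_DERIV[OF D(1) cont(3)] primitive_on_DERIV[OF C1_on_DERIV[OF v _ L] cv(2)] cont(1) cv(1)])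
    have 2: "primitive_on L (\<lambda>x. V x * h x + H x * v x + (- 1) * (H x * v x)) (\<lambda>x. - F x $ 1 + (- 1) * (H' x * v x + H x * ?v' x))"
      by (rule primitive_on_add[OF prim(1) primitive_on_cmult[OF 1]])
    have 3: "primitive_on L (\<lambda>x. inverse (V x)) (\<lambda>x. - (V' x * inverse ((V x)\<^sup>2)))"
    proof (rule primitive_on_DERIV)
      show "((\<lambda>x. inverse (V x)) has_real_derivative - (V' x * inverse ((V x)\<^sup>2))) (at x within {0..L})"
        if "x \<in> {0..L}" for x
        using DERIV_inverse_fun[OF D(2)[OF that] nz(2)[OF that]] by (simp add: power2_eq_square)
      show "continuous_on {0..L} (\<lambda>x. - (V' x * inverse ((V x)\<^sup>2)))"
        by (intro continuous_intros cont; use nz in force)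
    qed
    show "primitive_on L (\<lambda>x. inverse (V x) * (V x * h x + H x * v x + (- 1) * (H x * v x)))
      (\<lambda>x. - (V' x * inverse ((V x)\<^sup>2)) * (V x * h x + H x * v x + (- 1) * (H x * v x))
         + inverse (V x) * (- F x $ 1 + (- 1) * (H' x * v x + H x * ?v' x)))"
      by (rule primitive_on_mult[OF 3 2]) (intro continuous_intros cont cv h; use nz in force)+
    have "integrable ?M (\<lambda>x. inverse (V x) * (- F x $ 1 + - (V' x * h x + H' x * v x + H x * ?v' x)))"
      by (intro integrable_continuous_mult Bochner_Integration.integrable_add Bochner_Integration.integrable_minus iF
          integrable_continuous_interval continuous_intros cont cv h; use nz in force)
    then show "integrable ?M ?dh"
      by (rule Bochner_Integration.integrable_cong[THEN iffD1, OF refl, rotated]) (simp add: divide_inverse algebra_simps)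
    show "AE x in ?M. - (V' x * inverse ((V x)\<^sup>2)) * (V x * h x + H x * v x + (- 1) * (H x * v x))
         + inverse (V x) * (- F x $ 1 + (- 1) * (H' x * v x + H x * ?v' x)) = ?dh x"
      using AE_interval_measure_in
    proof eventually_elim
      case (elim x)
      then show ?case using nz(2)[of x] by (simp add: field_simps power2_eq_square)
    qed
  qed (use nz L in auto)
  let ?E = "\<lambda>x. F x $ 2 - p' x * h x - r' x * v x + c21 x * h x + c22 x * v x"
  let ?G = "\<lambda>x. - 4 * \<mu> * ?v' x + p x * h x + r x * v x"
  have cG: "continuous_on {0..L} ?G" by (intro continuous_intros cont_coef h cv)
  have P1: "primitive_on L (\<lambda>x. (H x * v x) * ?G x) (\<lambda>x. (H' x * v x + ?v' x * H x) * ?G x + (H x * v x) * (- ?E x))"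
  proof (rule primitive_on_mult[OF _ prim(2) _ cG])
    show "primitive_on L (\<lambda>x. H x * v x) (\<lambda>x. H' x * v x + ?v' x * H x)"
      by (rule primitive_on_DERIV[OF DERIV_mult[OF D(1) C1_on_DERIV[OF v _ L]]]) (auto intro!: continuous_intros cont cv)
  qed (intro continuous_intros cont cv)
  have hh: "primitive_on L (\<lambda>x. h x * h x) (\<lambda>x. ?dh x * h x + h x * ?dh x)"
    by (rule primitive_on_mult[OF ph ph h h])
  have P2: "primitive_on L (\<lambda>x. (p x * V x) * (h x * h x))
      (\<lambda>x. (p' x * V x + V' x * p x) * (h x * h x) + (p x * V x) * (?dh x * h x + h x * ?dh x))"
  proof (rule primitive_on_mult[OF _ hh])
    show "primitive_on L (\<lambda>x. p x * V x) (\<lambda>x. p' x * V x + V' x * p x)"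
      by (rule primitive_on_DERIV[OF DERIV_mult[OF p_r_DERIV(1) D(2)]]) (auto intro!: continuous_intros cont cont_coef)
  qed (intro continuous_intros cont cont_coef h)+
  \<comment> \<open>The first product contains H r v^2 = (H V - 4 \<mu> H') v^2. This correction
    removes the part with H' and half of H V, which leaves - H V v^2 / 2 in the boundary form; H V
    is constant and contributes no derivative.\<close>
  have P3: "primitive_on L (\<lambda>x. (H x * V x / 2 - 4 * \<mu> * H' x) * (v x * v x))
      (\<lambda>x. - 4 * \<mu> * H'' x * (v x * v x) + (H x * V x / 2 - 4 * \<mu> * H' x) * (2 * v x * ?v' x))"
  proof (rule primitive_on_DERIV)
    fix x assume x: "x \<in> {0..L}"
    have "((\<lambda>x. (H0 * V0 / 2 - 4 * \<mu> * H' x) * (v x * v x)) has_real_derivative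
        - 4 * \<mu> * H'' x * (v x * v x) + (H0 * V0 / 2 - 4 * \<mu> * H' x) * (2 * v x * ?v' x)) (at x within {0..L})"
      using C1_on_DERIV[OF v x L] D(3)[OF x] by (auto intro!: derivative_eq_intros simp: algebra_simps)
    then show "((\<lambda>x. (H x * V x / 2 - 4 * \<mu> * H' x) * (v x * v x)) has_real_derivative
        - 4 * \<mu> * H'' x * (v x * v x) + (H x * V x / 2 - 4 * \<mu> * H' x) * (2 * v x * ?v' x)) (at x within {0..L})"
      unfolding mass[OF x] by (rule has_field_derivative_transform_within[where d = 1, OF _ _ x]) (use mass in auto)
  qed (intro continuous_intros cont cv, simp)
  let ?P = "\<lambda>x. (- 1) * ((H x * v x) * ?G x) + (- 1 / 2) * ((p x * V x) * (h x * h x))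
      + (H x * V x / 2 - 4 * \<mu> * H' x) * (v x * v x)"
  let ?dP = "\<lambda>x. (- 1) * ((H' x * v x + ?v' x * H x) * ?G x + (H x * v x) * (- ?E x))
     + (- 1 / 2) * ((p' x * V x + V' x * p x) * (h x * h x) + (p x * V x) * (?dh x * h x + h x * ?dh x))
     + (- 4 * \<mu> * H'' x * (v x * v x) + (H x * V x / 2 - 4 * \<mu> * H' x) * (2 * v x * ?v' x))"
  have P: "primitive_on L ?P ?dP"
    by (intro primitive_on_add primitive_on_cmult P1 P2 P3)
  have PB: "?P x = boundary_form h v x" if "x \<in> {0..L}" for x
    using nz[OF that] by (simp add: boundary_form_def r_def field_simps power2_eq_square)
  have "(\<integral>x. p x * h x * F x $ 1 + H x * v x * F x $ 2 \<partial>?M) = (\<integral>x. ?dP x + interior_form h v x \<partial>?M)"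
  proof (rule Bochner_Integration.integral_cong[OF refl])
    fix x assume "x \<in> space ?M"
    then have x: "x \<in> {0..L}" by auto
    define dh where "dh = ?dh x"
    have F1: "F x $ 1 = - (V x * dh) - V' x * h x - H' x * v x - H x * ?v' x"
      using nz[OF x] by (simp add: dh_def)
    have Hr: "H x * r x = H x * V x - 4 * \<mu> * H' x" using nz[OF x] by (simp add: r_def field_simps)
    have Hr': "H x * r' x + H' x * r x = - 4 * \<mu> * H'' x"
    proof -
      have "H x * r' x + H' x * r x = (H' x * V x + H x * V' x) - 4 * \<mu> * H'' x"
        using nz[OF x] by (simp add: r_def r'_def field_simps power2_eq_square)
      then show ?thesis using mass_deriv[OF x] by simp
    qed
    show "p x * h x * F x $ 1 + H x * v x * F x $ 2 = ?dP x + interior_form h v x"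
      by (subst F1, unfold dh_def interior_form_def, rule energy_density[OF Hr Hr'])
  qed
  also have "\<dots> = (\<integral>x. ?dP x \<partial>?M) + (\<integral>x. interior_form h v x \<partial>?M)"
  proof (rule Bochner_Integration.integral_add[OF primitive_on_integrable[OF P]])
    show "integrable ?M (interior_form h v)"
      unfolding interior_form_def[abs_def] by (intro integrable_continuous_interval continuous_intros cont cont_coef h cv) auto
  qed
  also have "(\<integral>x. ?dP x \<partial>?M) = ?P L - ?P 0"
    using primitive_on_end[OF P] L by simp
  finally show ?thesis using PB[of L] PB[of 0] L by simp
qed

end

section \<open>Boundary terms\<close>

text \<open>The polynomial in b equals (H V / 2) ((b - g / V)^2 - g^2 d), and its roots are the two
  values of \<open>b0_bound\<close>.\<close>

lemma inlet_feedback: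
  assumes "g > 0" "H > 0" "V > 0" "b0_bound (-1) g H V < b" "b < b0_bound 1 g H V"
  shows "H * V * b\<^sup>2 / 2 - g * H * b + g * V / 2 < 0"
proof -
  define d where "d = 1 / V\<^sup>2 - 1 / (g * H)"
  have ab: "\<bar>b - g / V\<bar> < g * sqrt d"
    using assms(4,5) unfolding b0_bound_def d_def by (simp add: abs_less_iff algebra_simps)
  \<comment> \<open>The radicand is positive because the admissible interval contains b: a
    nonpositive d would have a nonpositive \<open>sqrt\<close>.\<close>
  then have "0 < g * sqrt d" by (rule le_less_trans[OF abs_ge_zero])
  then have d: "d > 0" using assms(1) by (simp add: zero_less_mult_iff)
  have "(b - g / V)\<^sup>2 < (g * sqrt d)\<^sup>2"
    using power_strict_mono[OF ab, of 2] by simp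
  also have "\<dots> = g\<^sup>2 * d" using d by (simp add: power_mult_distrib)
  finally have "(b - g / V)\<^sup>2 - g\<^sup>2 * d < 0" by simp
  then have "H * V / 2 * ((b - g / V)\<^sup>2 - g\<^sup>2 * d) < 0"
    using assms by (intro mult_pos_neg) auto
  moreover have "H * V / 2 * ((b - g / V)\<^sup>2 - g\<^sup>2 * d) = H * V * b\<^sup>2 / 2 - g * H * b + g * V / 2"
    using assms by (simp add: d_def field_simps power2_eq_square)
  ultimately show ?thesis by simp
qed

text \<open>Completing the square in c: a times the polynomial equals (a c + 4 m)^2 - 16 d, with the
  values of \<open>c1_bound\<close> as roots. At c = 0 the polynomial is nonnegative, which excludes
  that value and allows the boundary condition to be solved for v_x.\<close>

lemma outlet_feedback:
  assumes "g > 0" "H > 0" "V > 0" "g * H > V\<^sup>2" "c1_bound (-1) g b H V < c" "c < c1_bound 1 g b H V"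
  shows "c \<noteq> 0" "(g * H - V\<^sup>2) * c\<^sup>2 + 8 * (V + b * H) * c + 16 * H * b\<^sup>2 / g < 0"
proof -
  define a d m where "a = g * H - V\<^sup>2" and "d = V * (H * V * b\<^sup>2 / g + 2 * H * b + V)" and "m = V + b * H"
  have a: "a > 0" using assms by (simp add: a_def)
  have "4 * (- m - sqrt d) < c * a" "c * a < 4 * (- m + sqrt d)"
    using assms(5,6) a unfolding c1_bound_def a_def[symmetric] d_def[symmetric]
    by (simp_all add: divide_less_eq less_divide_eq m_def algebra_simps)
  then have ab: "\<bar>a * c + 4 * m\<bar> < 4 * sqrt d" by (simp add: abs_less_iff algebra_simps)
  then have "0 < 4 * sqrt d" by (rule le_less_trans[OF abs_ge_zero])
  then have d: "d > 0" by simp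
  have "(a * c + 4 * m)\<^sup>2 < (4 * sqrt d)\<^sup>2"
    using power_strict_mono[OF ab, of 2] by simp
  also have "\<dots> = 16 * d" using d by (simp add: power_mult_distrib)
  finally have "(a * c + 4 * m)\<^sup>2 - 16 * d < 0" by simp
  moreover have "(a * c + 4 * m)\<^sup>2 - 16 * d = a * (a * c\<^sup>2 + 8 * m * c + 16 * H * b\<^sup>2 / g)"
    using assms(1) unfolding a_def d_def m_def by (simp add: field_simps power2_eq_square)
  ultimately have neg: "a * c\<^sup>2 + 8 * m * c + 16 * H * b\<^sup>2 / g < 0"
    using a by (simp add: mult_less_0_iff)
  then show "(g * H - V\<^sup>2) * c\<^sup>2 + 8 * (V + b * H) * c + 16 * H * b\<^sup>2 / g < 0"
    by (simp add: a_def m_def)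
  show "c \<noteq> 0"
  proof
    assume "c = 0"
    then have "16 * H * b\<^sup>2 / g < 0" using neg by simp
    moreover have "16 * H * b\<^sup>2 / g \<ge> 0" using assms by simp
    ultimately show False by simp
  qed
qed

text \<open>
  Here \<open>z = \<mu> v\<^sub>x(L)\<close> and \<open>\<epsilon> = g - p(L)\<close>.  In the variables \<open>(h, v)\<close> instead of \<open>(h, z)\<close> the coefficient of
  \<open>h\<^sup>2\<close> is \<open>- g V / 2\<close>, so the estimate stays uniform even if the feedback conditions degenerate as \<open>\<mu> \<rightarrow> 0\<close>.
\<close>

lemma outlet_form_le:
  fixes g H V b c h v z \<epsilon> :: real
  assumes pos: "g > 0" "H > 0" "V > 0" and c: "c \<noteq> 0"
    and neg: "(g * H - V\<^sup>2) * c\<^sup>2 + 8 * (V + b * H) * c + 16 * H * b\<^sup>2 / g < 0"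
    and bc: "v = b * h + c * z" and eps: "0 \<le> \<epsilon>" "\<epsilon> \<le> g / 4"
  defines "l \<equiv> (4 * H * (b / c) + g * H) / (g * V)"
  shows "4 * H * v * z - (g - \<epsilon>) * H * h * v - (g - \<epsilon>) * V * h\<^sup>2 / 2 - H * V * v\<^sup>2 / 2
    \<le> \<epsilon> * (2 * V * l\<^sup>2 + H\<^sup>2 / (2 * V)) * v\<^sup>2"
proof -
  \<comment> \<open>The shift l removes the product h v once z has been replaced by (v - b h) /
    c.\<close>
  define k where "k = h + l * v"
  define K where "K = 2 * V * l\<^sup>2 + H\<^sup>2 / (2 * V)"
  \<comment> \<open>The coefficient of - v^2 after completing the square. Multiplied by 2 g V c^2 it
    becomes - g H times the outlet polynomial, so \<beta> > 0 is the condition on c.\<close>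
  define \<beta> where "\<beta> = H * V / 2 - 4 * H / c - g * V * l\<^sup>2 / 2"
  have "\<beta> * (2 * g * V * c\<^sup>2) = - (g * H) * ((g * H - V\<^sup>2) * c\<^sup>2 + 8 * (V + b * H) * c + 16 * H * b\<^sup>2 / g)"
    using pos c unfolding \<beta>_def l_def by (simp add: field_simps power2_eq_square)
  also have "\<dots> > 0" using neg pos by (simp add: mult_less_0_iff)
  finally have \<beta>: "\<beta> > 0" by (rule zero_less_mult_pos2) (use pos c in simp)
  have z: "z = (v - b * h) / c" using bc c by simp
  have base: "4 * H * v * z - g * H * h * v - g * V * h\<^sup>2 / 2 - H * V * v\<^sup>2 / 2 = - (g * V / 2) * k\<^sup>2 - \<beta> * v\<^sup>2"
    using pos c unfolding \<beta>_def l_def z k_def by (simp add: field_simps power2_eq_square)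
  have "0 \<le> (V * h - H * v)\<^sup>2 / (2 * V)" using pos by simp
  also have "\<dots> = V * h\<^sup>2 / 2 - H * h * v + H\<^sup>2 * v\<^sup>2 / (2 * V)"
    using pos by (simp add: field_simps power2_eq_square)
  finally have 1: "H * h * v + V * h\<^sup>2 / 2 \<le> V * h\<^sup>2 + H\<^sup>2 * v\<^sup>2 / (2 * V)" by simp
  have "h\<^sup>2 \<le> 2 * k\<^sup>2 + 2 * (l * v)\<^sup>2"
    using sum_squares_bound[of k "- (l * v)"] zero_le_power2[of "k + l * v"]
    by (simp add: k_def power2_eq_square algebra_simps)
  then have "V * h\<^sup>2 \<le> V * (2 * k\<^sup>2 + 2 * (l * v)\<^sup>2)" using pos by (intro mult_left_mono) auto
  with 1 have "H * h * v + V * h\<^sup>2 / 2 \<le> 2 * V * k\<^sup>2 + K * v\<^sup>2"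
    by (simp add: K_def algebra_simps power_mult_distrib)
  then have 2: "\<epsilon> * (H * h * v + V * h\<^sup>2 / 2) \<le> \<epsilon> * (2 * V * k\<^sup>2 + K * v\<^sup>2)"
    using eps by (intro mult_left_mono) auto
  \<comment> \<open>This is the reason for \<epsilon> \<le> g / 4: the error in k^2 is then at most
    g V k^2 / 2, which the main term cancels exactly.\<close>
  have 3: "\<epsilon> * (2 * V * k\<^sup>2) \<le> g / 4 * (2 * V * k\<^sup>2)" using eps pos by (intro mult_right_mono) auto
  have "4 * H * v * z - (g - \<epsilon>) * H * h * v - (g - \<epsilon>) * V * h\<^sup>2 / 2 - H * V * v\<^sup>2 / 2
      = - (g * V / 2) * k\<^sup>2 - \<beta> * v\<^sup>2 + \<epsilon> * (H * h * v + V * h\<^sup>2 / 2)"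
    unfolding base[symmetric] by (simp add: field_simps)
  also have "\<dots> \<le> - (g * V / 2) * k\<^sup>2 - \<beta> * v\<^sup>2 + \<epsilon> * (2 * V * k\<^sup>2 + K * v\<^sup>2)"
    by (rule add_left_mono[OF 2])
  also have "\<dots> = - (g * V / 2) * k\<^sup>2 - \<beta> * v\<^sup>2 + (\<epsilon> * (2 * V * k\<^sup>2) + \<epsilon> * K * v\<^sup>2)"
    by (simp add: distrib_left)
  also have "\<dots> \<le> - (g * V / 2) * k\<^sup>2 - \<beta> * v\<^sup>2 + (g / 4 * (2 * V * k\<^sup>2) + \<epsilon> * K * v\<^sup>2)"
    by (rule add_left_mono[OF add_right_mono[OF 3]])
  also have "\<dots> = \<epsilon> * K * v\<^sup>2 - \<beta> * v\<^sup>2" by simp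
  also have "\<dots> \<le> \<epsilon> * K * v\<^sup>2" using \<beta> by simp
  finally show ?thesis unfolding K_def .
qed

text \<open>Integrating the derivative of x v^2: the weight x vanishes at 0, so only the value at L
  remains, and Young's inequality splits the product v v_x.\<close>

lemma trace_inequality:
  assumes L: "L > 0" and v: "C1_on L v"
  shows "(v L)\<^sup>2 \<le> (1 / L + 1) * (\<integral>x. (v x)\<^sup>2 \<partial>interval_measure_on L) + (\<integral>x. (ddx L v x)\<^sup>2 \<partial>interval_measure_on L)"
proof -
  let ?M = "interval_measure_on L"
  note cv = C1_on_continuous[OF v]
  have i: "integrable ?M (\<lambda>x. (v x)\<^sup>2)" "integrable ?M (\<lambda>x. (ddx L v x)\<^sup>2)"
    "integrable ?M (\<lambda>x. (v x)\<^sup>2 + 2 * x * (v x * ddx L v x))"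
    by (intro integrable_continuous_interval continuous_intros cv)+
  have "primitive_on L (\<lambda>x. x * (v x)\<^sup>2) (\<lambda>x. (v x)\<^sup>2 + 2 * x * (v x * ddx L v x))"
  proof (rule primitive_on_DERIV)
    show "((\<lambda>x. x * (v x)\<^sup>2) has_real_derivative (v x)\<^sup>2 + 2 * x * (v x * ddx L v x)) (at x within {0..L})"
      if "x \<in> {0..L}" for x
      using C1_on_DERIV[OF v that L] by (auto intro!: derivative_eq_intros simp: algebra_simps)
  qed (intro continuous_intros cv)
  from primitive_on_end[OF this] have "L * (v L)\<^sup>2 = (\<integral>x. (v x)\<^sup>2 + 2 * x * (v x * ddx L v x) \<partial>?M)"
    using L by simp
  also have "\<dots> \<le> (\<integral>x. (1 + L) * (v x)\<^sup>2 + L * (ddx L v x)\<^sup>2 \<partial>?M)"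
  proof (rule integral_mono_AE[OF i(3)])
    show "AE x in ?M. (v x)\<^sup>2 + 2 * x * (v x * ddx L v x) \<le> (1 + L) * (v x)\<^sup>2 + L * (ddx L v x)\<^sup>2"
      using AE_interval_measure_in
    proof eventually_elim
      case (elim x)
      have "x * (2 * (v x * ddx L v x)) \<le> x * ((v x)\<^sup>2 + (ddx L v x)\<^sup>2)"
        using elim sum_squares_bound[of "v x" "ddx L v x"] by (intro mult_left_mono) auto
      also have "\<dots> \<le> L * ((v x)\<^sup>2 + (ddx L v x)\<^sup>2)"
        using elim by (intro mult_right_mono) auto
      finally show ?case by (simp add: algebra_simps)
    qed
  qed (use i in simp)
  also have "\<dots> = (1 + L) * (\<integral>x. (v x)\<^sup>2 \<partial>?M) + L * (\<integral>x. (ddx L v x)\<^sup>2 \<partial>?M)"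
    using i by simp
  finally have "(v L)\<^sup>2 \<le> ((1 + L) * (\<integral>x. (v x)\<^sup>2 \<partial>?M) + L * (\<integral>x. (ddx L v x)\<^sup>2 \<partial>?M)) / L"
    using L by (simp add: pos_le_divide_eq mult.commute)
  also have "\<dots> = (1 / L + 1) * (\<integral>x. (v x)\<^sup>2 \<partial>?M) + (\<integral>x. (ddx L v x)\<^sup>2 \<partial>?M)"
    using L by (simp add: add_divide_distrib distrib_right)
  finally show ?thesis .
qed

context steady begin

text \<open>Substituting V' = \<mu> s, H' = - \<mu> H s / V and friction = \<mu> f exhibits a common
  factor \<mu> in the form in (h, v). What remains is the rescaled form, whose positivity is uniform
  in \<mu>.\<close>

lemma interior_form_eq:
  assumes x: "x \<in> {0..L}"
  defines "s \<equiv> V' x / \<mu>" and "q \<equiv> H0 * V0"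
  shows "interior_form h v x = - \<mu> * (form_hh g \<kappa> q \<mu> (V x) s * (h x)\<^sup>2
      - form_hv g \<kappa> q \<mu> (V x) s * (h x * v x) + form_vv \<kappa> q \<mu> (V x) s * (v x)\<^sup>2)
    - 4 * \<mu> * H x * (ddx L v x)\<^sup>2"
proof -
  have HV: "q / V x = H x" using mass[OF x] nz[OF x] by (simp add: q_def field_simps)
  have V': "V' x = \<mu> * s" using \<mu> by (simp add: s_def)
  have H': "H' x = - (\<mu> * H x * s / V x)" using mass_deriv[OF x] nz[OF x] V' by (simp add: field_simps)
  define f where "f = fric_coef \<kappa> q \<mu> (V x)"
  have fr: "friction \<kappa> \<mu> (H x) (V x) = \<mu> * f"
  proof -
    have "3 * \<mu> + \<kappa> * H x > 0" using \<mu> \<kappa> pos(1)[OF x] by (simp add: add_pos_pos)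
    then show ?thesis unfolding f_def fric_coef_def friction_def HV using \<mu>
      by (simp add: field_simps)
  qed
  \<comment> \<open>Every term of the momentum equation carries a factor \<mu>, so V'' is only of
    order one. It enters p' with a further factor \<mu>, which keeps p' of order \<mu>.\<close>
  have HV'': "4 * (H x * V'' x) = f - (g * H x - (V x)\<^sup>2) * H x * s / V x + 4 * \<mu>\<^sup>2 * H x * s\<^sup>2 / V x"
  proof -
    have "4 * \<mu> * (H' x * V' x + H x * V'' x) = \<mu> * (f - (g * H x - (V x)\<^sup>2) * H x * s / V x)"
    proof -
      have "4 * \<mu> * (H' x * V' x + H x * V'' x) = \<mu> * f - (g * H x - (V x)\<^sup>2) * (H x * V' x) / V x"
        using momentum[OF x] fr by simp
      also have "(g * H x - (V x)\<^sup>2) * (H x * V' x) / V x = \<mu> * ((g * H x - (V x)\<^sup>2) * H x * s / V x)"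
        by (simp add: V')
      finally show ?thesis by (simp add: right_diff_distrib)
    qed
    then have "4 * (H' x * V' x + H x * V'' x) = f - (g * H x - (V x)\<^sup>2) * H x * s / V x"
      using \<mu> by simp
    moreover have "4 * (H' x * V' x) = - (4 * \<mu>\<^sup>2 * H x * s\<^sup>2 / V x)"
      unfolding H' V' by (simp add: power2_eq_square)
    ultimately show ?thesis by simp
  qed
  have p': "p' x = \<mu> * p_slope g \<kappa> q \<mu> (V x) s"
  proof -
    have "p' x = - \<mu> * (4 * (H x * V'' x) - 4 * (V' x * H' x)) / (H x)\<^sup>2"
      by (simp add: p'_def algebra_simps)
    also have "\<dots> = \<mu> * p_slope g \<kappa> q \<mu> (V x) s"
      unfolding HV'' p_slope_def HV f_def[symmetric] unfolding H' V'
      using nz[OF x] by (simp add: field_simps power2_eq_square)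
    finally show ?thesis .
  qed
  have c21: "c21 x = \<mu> * c21_coef \<kappa> q \<mu> (V x) s"
    unfolding c21_def c21_coef_def HV f_def[symmetric] fr unfolding H' V'
    using nz[OF x] \<mu> by (simp add: field_simps power2_eq_square)
  have c22: "H x * c22 x = \<mu> * form_vv \<kappa> q \<mu> (V x) s"
    unfolding c22_def form_vv_def HV f_def[symmetric] fr V'
    using nz[OF x] by (simp add: field_simps)
  have hh: "(p' x * V x - p x * V' x) / 2 = - \<mu> * form_hh g \<kappa> q \<mu> (V x) s"
    unfolding form_hh_def HV p' p_def V' by (simp add: field_simps power2_eq_square)
  have hv: "H x * (p' x - c21 x) = \<mu> * form_hv g \<kappa> q \<mu> (V x) s"
    unfolding form_hv_def HV p' c21 by (simp add: algebra_simps)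
  show ?thesis
    unfolding interior_form_def hh hv c22 by (simp add: algebra_simps)
qed

end

section \<open>The Lyapunov functional along solutions\<close>

text \<open>The pointwise bound (a + b)^2 \<le> 2 a^2 + 2 b^2 takes the place of the triangle
  inequality in L2; the factor 2 is harmless for limits.\<close>

lemma L2_space_add:
  assumes "u \<in> L2_space L" "w \<in> L2_space L"
  shows "(\<lambda>x. u x + w x) \<in> L2_space L"
    and "(L2_norm L (\<lambda>x. u x + w x))\<^sup>2 \<le> 2 * (L2_norm L u)\<^sup>2 + 2 * (L2_norm L w)\<^sup>2"
proof -
  let ?M = "interval_measure_on L"
  have [measurable]: "u \<in> borel_measurable ?M" "w \<in> borel_measurable ?M"
    and i: "integrable ?M (\<lambda>x. (norm (u x))\<^sup>2)" "integrable ?M (\<lambda>x. (norm (w x))\<^sup>2)"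
    using assms by (auto simp: L2_space_def)
  have le: "(norm (u x + w x))\<^sup>2 \<le> 2 * (norm (u x))\<^sup>2 + 2 * (norm (w x))\<^sup>2" for x
  proof -
    have "(norm (u x + w x))\<^sup>2 \<le> (norm (u x) + norm (w x))\<^sup>2"
      by (intro power_mono norm_triangle_ineq) auto
    also have "\<dots> \<le> 2 * (norm (u x))\<^sup>2 + 2 * (norm (w x))\<^sup>2"
      using sum_squares_bound[of "norm (u x)" "norm (w x)"] by (simp add: power2_sum)
    finally show ?thesis .
  qed
  have isq: "integrable ?M (\<lambda>x. (norm (u x + w x))\<^sup>2)"
  proof (rule Bochner_Integration.integrable_bound)
    show "integrable ?M (\<lambda>x. 2 * (norm (u x))\<^sup>2 + 2 * (norm (w x))\<^sup>2)" using i by simp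
    show "(\<lambda>x. (norm (u x + w x))\<^sup>2) \<in> borel_measurable ?M" by measurable
    show "AE x in ?M. norm ((norm (u x + w x))\<^sup>2) \<le> norm (2 * (norm (u x))\<^sup>2 + 2 * (norm (w x))\<^sup>2)"
      using le by simp
  qed
  then show "(\<lambda>x. u x + w x) \<in> L2_space L" by (simp add: L2_space_def)
  have "(\<integral>x. (norm (u x + w x))\<^sup>2 \<partial>?M) \<le> (\<integral>x. 2 * (norm (u x))\<^sup>2 + 2 * (norm (w x))\<^sup>2 \<partial>?M)"
    by (rule integral_mono[OF isq]) (use i le in auto)
  then show "(L2_norm L (\<lambda>x. u x + w x))\<^sup>2 \<le> 2 * (L2_norm L u)\<^sup>2 + 2 * (L2_norm L w)\<^sup>2"
    using i by (simp add: L2_norm_def)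
qed

lemma L2_space_scaleR:
  assumes "u \<in> L2_space L"
  shows "(\<lambda>x. c *\<^sub>R u x) \<in> L2_space L"
  using assms by (auto simp: L2_space_def power_mult_distrib)

lemma L2_space_diff:
  assumes "u \<in> L2_space L" "w \<in> L2_space L"
  shows "(\<lambda>x. u x - w x) \<in> L2_space L"
  using L2_space_add(1)[OF assms(1) L2_space_scaleR[OF assms(2), of "-1"]] by simp

lemma L2_norm_sq: "(L2_norm L u)\<^sup>2 = (\<integral>x. (u x $ 1)\<^sup>2 + (u x $ 2)\<^sup>2 \<partial>interval_measure_on L)"
  by (simp add: L2_norm_def norm_vec2_sq)

lemma L2_norm_nonneg: "L2_norm L u \<ge> 0"
  by (simp add: L2_norm_def)

section \<open>The polarised functional and its time derivative\<close>

context steady begin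

definition energy_integrand :: "(real \<Rightarrow> real^2) \<Rightarrow> (real \<Rightarrow> real^2) \<Rightarrow> real \<Rightarrow> real" where
  "energy_integrand u w x = (1 + \<mu>) * (p x * (u x $ 1 * w x $ 1) + H x * (u x $ 2 * w x $ 2))"

definition energy_product :: "(real \<Rightarrow> real^2) \<Rightarrow> (real \<Rightarrow> real^2) \<Rightarrow> real" where
  "energy_product u w = (\<integral>x. energy_integrand u w x \<partial>interval_measure_on L)"

text \<open>The factor 1 + \<mu> inside \<open>q1_tilde\<close> makes g + \<mu>
  \<open>q1_tilde\<close> equal to (1 + \<mu>) p, just as H + \<mu> \<open>q2_tilde\<close> equals
  (1 + \<mu>) H. Both weights thus share one constant factor.\<close>

lemma W_fun_eq: "W_fun L g \<mu> H V y = energy_product y y"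
proof -
  have "y x \<bullet> (Q_mat L g \<mu> H V x *v y x) = energy_integrand y y x" for x
    by (simp add: inner_vec_def sum_2 Q_mat_def mat2_mult_vec energy_integrand_def q1_tilde_def
        q2_tilde_def p_def field_simps)
  then show ?thesis by (simp add: W_fun_def energy_product_def)
qed

lemma integrable_energy_integrand:
  assumes "u \<in> L2_space L" "w \<in> L2_space L"
  shows "integrable (interval_measure_on L) (energy_integrand u w)"
  unfolding energy_integrand_def
  by (intro integrable_mult_right Bochner_Integration.integrable_add integrable_continuous_mult
      integrable_square_mult L2_space_components cont cont_coef assms)

lemma integrable_norm_sq:
  assumes "u \<in> L2_space L"
  shows "integrable (interval_measure_on L) (\<lambda>x. (u x $ 1)\<^sup>2 + (u x $ 2)\<^sup>2)"
  using L2_space_components(2)[OF assms] by simp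

text \<open>Young's inequality under the integral. The free parameter \<delta> serves to make the
  product of a small and a bounded function small, as Cauchy-Schwarz would.\<close>

lemma energy_product_bound:
  obtains C where "C > 0"
    "\<And>u w \<delta>. u \<in> L2_space L \<Longrightarrow> w \<in> L2_space L \<Longrightarrow> \<delta> > 0 \<Longrightarrow>
       \<bar>2 * energy_product u w\<bar> \<le> C * ((L2_norm L u)\<^sup>2 / \<delta> + \<delta> * (L2_norm L w)\<^sup>2)"
proof -
  obtain Cp where Cp: "Cp > 0" "\<And>x. x \<in> {0..L} \<Longrightarrow> \<bar>p x\<bar> \<le> Cp"
    using continuous_on_interval_bound[OF cont_coef(1)] by blast
  obtain CH where CH: "CH > 0" "\<And>x. x \<in> {0..L} \<Longrightarrow> \<bar>H x\<bar> \<le> CH"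
    using continuous_on_interval_bound[OF cont(1)] by blast
  define C where "C = (1 + \<mu>) * max Cp CH"
  have "C > 0" using Cp \<mu> by (simp add: C_def)
  moreover have "\<bar>2 * energy_product u w\<bar> \<le> C * ((L2_norm L u)\<^sup>2 / \<delta> + \<delta> * (L2_norm L w)\<^sup>2)"
    if u: "u \<in> L2_space L" and w: "w \<in> L2_space L" and \<delta>: "\<delta> > 0" for u w \<delta>
  proof -
    let ?M = "interval_measure_on L"
    let ?N = "\<lambda>u x. (u x $ 1)\<^sup>2 + (u x $ 2)\<^sup>2"
    have young: "\<bar>2 * (a * b)\<bar> \<le> a\<^sup>2 / \<delta> + \<delta> * b\<^sup>2" for a b :: real
    proof -
      have "0 \<le> (\<bar>a\<bar> - \<delta> * \<bar>b\<bar>)\<^sup>2 / \<delta>" using \<delta> by simp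
      also have "\<dots> = a\<^sup>2 / \<delta> + \<delta> * b\<^sup>2 - 2 * (\<bar>a\<bar> * \<bar>b\<bar>)"
        using \<delta> by (simp add: power2_diff field_simps power2_eq_square[of \<delta>] power_mult_distrib)
      finally show ?thesis by (simp add: abs_mult)
    qed
    have pw: "\<bar>2 * energy_integrand u w x\<bar> \<le> C * (?N u x / \<delta> + \<delta> * ?N w x)" if x: "x \<in> {0..L}" for x
    proof -
      have "\<bar>2 * energy_integrand u w x\<bar> = (1 + \<mu>) * \<bar>p x * (2 * (u x $ 1 * w x $ 1)) + H x * (2 * (u x $ 2 * w x $ 2))\<bar>"
      proof -
        have "2 * energy_integrand u w x = (1 + \<mu>) * (p x * (2 * (u x $ 1 * w x $ 1)) + H x * (2 * (u x $ 2 * w x $ 2)))"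
          by (simp add: energy_integrand_def algebra_simps)
        then show ?thesis using \<mu> by (simp add: abs_mult)
      qed
      also have "\<dots> \<le> (1 + \<mu>) * (\<bar>p x\<bar> * \<bar>2 * (u x $ 1 * w x $ 1)\<bar> + \<bar>H x\<bar> * \<bar>2 * (u x $ 2 * w x $ 2)\<bar>)"
        using \<mu> by (intro mult_left_mono order.trans[OF abs_triangle_ineq]) (auto simp: abs_mult)
      also have "\<dots> \<le> (1 + \<mu>) * (max Cp CH * ((u x $ 1)\<^sup>2 / \<delta> + \<delta> * (w x $ 1)\<^sup>2) + max Cp CH * ((u x $ 2)\<^sup>2 / \<delta> + \<delta> * (w x $ 2)\<^sup>2))"
        using \<mu> Cp(1) CH(1) Cp(2)[OF x] CH(2)[OF x]
        by (intro mult_left_mono add_mono mult_mono young) (auto intro: le_max_iff_disj[THEN iffD2])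
      also have "\<dots> = C * (?N u x / \<delta> + \<delta> * ?N w x)"
        by (simp add: C_def algebra_simps add_divide_distrib)
      finally show ?thesis .
    qed
    have i: "integrable ?M (\<lambda>x. 2 * energy_integrand u w x)"
      using integrable_energy_integrand[OF u w] by simp
    have iN: "integrable ?M (\<lambda>x. C * (?N u x / \<delta> + \<delta> * ?N w x))"
      using L2_space_components(2)[OF u] L2_space_components(2)[OF w]
      by (intro integrable_mult_right Bochner_Integration.integrable_add integrable_divide) auto
    have "\<bar>2 * energy_product u w\<bar> = \<bar>\<integral>x. 2 * energy_integrand u w x \<partial>?M\<bar>"
      by (simp add: energy_product_def)
    also have "\<dots> \<le> (\<integral>x. \<bar>2 * energy_integrand u w x\<bar> \<partial>?M)" by (rule integral_abs_bound)
    also have "\<dots> \<le> (\<integral>x. C * (?N u x / \<delta> + \<delta> * ?N w x) \<partial>?M)"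
    proof (rule integral_mono[OF integrable_abs[OF i] iN])
      fix x assume "x \<in> space ?M"
      then have "x \<in> {0..L}" by auto
      then show "\<bar>2 * energy_integrand u w x\<bar> \<le> C * (?N u x / \<delta> + \<delta> * ?N w x)" by (rule pw)
    qed
    also have "\<dots> = C * ((L2_norm L u)\<^sup>2 / \<delta> + \<delta> * (L2_norm L w)\<^sup>2)"
      unfolding L2_norm_sq using L2_space_components(2)[OF u] L2_space_components(2)[OF w] by simp
    finally show ?thesis .
  qed
  ultimately show thesis by (rule that)
qed

text \<open>W is quadratic. Inserting y(s) = y(t) + (s - t) d, where d is y'(t) plus the error of
  the difference quotient, leaves a cross term with that error and a term of order s - t.\<close>

lemma energy_has_derivative:
  assumes y: "C1_L2_derivative L y y'" and t: "t \<ge> 0"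
  shows "((\<lambda>s. W_fun L g \<mu> H V (y s)) has_real_derivative 2 * energy_product (y' t) (y t)) (at t within {0..})"
proof -
  let ?M = "interval_measure_on L"
  obtain C where C: "C > 0"
    "\<And>u w \<delta>. u \<in> L2_space L \<Longrightarrow> w \<in> L2_space L \<Longrightarrow> \<delta> > 0 \<Longrightarrow>
       \<bar>2 * energy_product u w\<bar> \<le> C * ((L2_norm L u)\<^sup>2 / \<delta> + \<delta> * (L2_norm L w)\<^sup>2)"
    using energy_product_bound by blast
  define e where "e s = (\<lambda>x. (y s x - y t x) /\<^sub>R (s - t) - y' t x)" for s
  define N where "N s = L2_norm L (e s)" for s
  have y_L2: "y s \<in> L2_space L" if "s \<ge> 0" for s using y that by (simp add: C1_L2_derivative_def)
  have yt: "y t \<in> L2_space L" and y't: "y' t \<in> L2_space L"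
    and N0: "(N \<longlongrightarrow> 0) (at t within {0..})"
    using y t by (auto simp: C1_L2_derivative_def N_def[abs_def] e_def)
  have e_L2: "e s \<in> L2_space L" if "s \<ge> 0" for s
    unfolding e_def by (intro L2_space_diff L2_space_scaleR y_L2 that t y't)
  define Y Z where "Y = L2_norm L (y t)" and "Z = L2_norm L (y' t)"
  define bound where "bound s = C * (N s + (N s + \<bar>s - t\<bar>) * Y\<^sup>2) + \<bar>s - t\<bar> * (C * (2 * (N s)\<^sup>2 + 2 * Z\<^sup>2))" for s
  have "(bound \<longlongrightarrow> C * (0 + (0 + \<bar>t - t\<bar>) * Y\<^sup>2) + \<bar>t - t\<bar> * (C * (2 * 0\<^sup>2 + 2 * Z\<^sup>2))) (at t within {0..})"
    unfolding bound_def by (intro tendsto_intros N0)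
  then have bound0: "(bound \<longlongrightarrow> 0) (at t within {0..})" by simp
  have est: "\<bar>(W_fun L g \<mu> H V (y s) - W_fun L g \<mu> H V (y t)) / (s - t) - 2 * energy_product (y' t) (y t)\<bar> \<le> bound s"
    if s: "s \<ge> 0" "s \<noteq> t" for s
  proof -
    define d where "d = (\<lambda>x. e s x + y' t x)"
    have d_L2: "d \<in> L2_space L" and d_norm: "(L2_norm L d)\<^sup>2 \<le> 2 * (N s)\<^sup>2 + 2 * Z\<^sup>2"
      unfolding d_def N_def Z_def using L2_space_add[OF e_L2[OF s(1)] y't] by auto
    have ys: "y s x = y t x + (s - t) *\<^sub>R d x" for x
      using s(2) by (simp add: d_def e_def)
    note i = integrable_energy_integrand
    have "energy_integrand (y s) (y s) x = energy_integrand (y t) (y t) x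
        + (s - t) * (2 * energy_integrand (e s) (y t) x + 2 * energy_integrand (y' t) (y t) x)
        + (s - t)\<^sup>2 * energy_integrand d d x" for x
      unfolding energy_integrand_def ys by (simp add: d_def power2_eq_square algebra_simps)
    then have "energy_product (y s) (y s) = (\<integral>x. energy_integrand (y t) (y t) x
        + (s - t) * (2 * energy_integrand (e s) (y t) x + 2 * energy_integrand (y' t) (y t) x)
        + (s - t)\<^sup>2 * energy_integrand d d x \<partial>?M)"
      by (simp only: energy_product_def)
    also have "\<dots> = energy_product (y t) (y t)
        + (s - t) * (2 * energy_product (e s) (y t) + 2 * energy_product (y' t) (y t))
        + (s - t)\<^sup>2 * energy_product d d"
      using i[OF yt yt] i[OF e_L2[OF s(1)] yt] i[OF y't yt] i[OF d_L2 d_L2]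
      by (simp add: energy_product_def)
    finally have eq: "(W_fun L g \<mu> H V (y s) - W_fun L g \<mu> H V (y t)) / (s - t) - 2 * energy_product (y' t) (y t)
        = 2 * energy_product (e s) (y t) + (s - t) * energy_product d d"
      using s(2) by (simp add: W_fun_eq power2_eq_square field_simps)
    have "\<bar>2 * energy_product (e s) (y t) + (s - t) * energy_product d d\<bar> \<le> \<bar>2 * energy_product (e s) (y t)\<bar> + \<bar>s - t\<bar> * \<bar>energy_product d d\<bar>"
      using abs_triangle_ineq[of "2 * energy_product (e s) (y t)" "(s - t) * energy_product d d"]
      by (simp add: abs_mult)
    also have "\<dots> \<le> bound s"
      unfolding bound_def
    proof (rule add_mono)
      \<comment> \<open>N s alone could be 0; adding \<bar>s - t\<bar> keeps \<delta> positive,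
        while (N s)^2 / \<delta> \<le> N s and \<delta> still tends to 0.\<close>
      define \<delta> where "\<delta> = N s + \<bar>s - t\<bar>"
      have N: "N s \<ge> 0" by (simp add: N_def L2_norm_nonneg)
      then have \<delta>: "\<delta> > 0" "N s \<le> \<delta>" using s(2) by (auto simp: \<delta>_def)
      have "(N s)\<^sup>2 / \<delta> \<le> N s"
        using \<delta> N by (simp add: pos_divide_le_eq power2_eq_square mult_left_mono)
      then have "C * ((N s)\<^sup>2 / \<delta> + \<delta> * Y\<^sup>2) \<le> C * (N s + \<delta> * Y\<^sup>2)"
        using C(1) by (intro mult_left_mono add_right_mono) auto
      then show "\<bar>2 * energy_product (e s) (y t)\<bar> \<le> C * (N s + (N s + \<bar>s - t\<bar>) * Y\<^sup>2)"
        using C(2)[OF e_L2[OF s(1)] yt \<delta>(1)] by (simp add: \<delta>_def N_def Y_def)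
      have "\<bar>2 * energy_product d d\<bar> \<le> C * (2 * (L2_norm L d)\<^sup>2)"
        using C(2)[OF d_L2 d_L2, of 1] by simp
      also have "\<dots> \<le> C * (2 * (2 * (N s)\<^sup>2 + 2 * Z\<^sup>2))"
        using C(1) d_norm by (intro mult_left_mono) auto
      finally have "\<bar>energy_product d d\<bar> \<le> C * (2 * (N s)\<^sup>2 + 2 * Z\<^sup>2)" by (simp add: abs_mult algebra_simps)
      then show "\<bar>s - t\<bar> * \<bar>energy_product d d\<bar> \<le> \<bar>s - t\<bar> * (C * (2 * (N s)\<^sup>2 + 2 * Z\<^sup>2))"
        by (rule mult_left_mono) simp
    qed
    finally show ?thesis unfolding eq .
  qed
  have "((\<lambda>s. (W_fun L g \<mu> H V (y s) - W_fun L g \<mu> H V (y t)) / (s - t) - 2 * energy_product (y' t) (y t)) \<longlongrightarrow> 0) (at t within {0..})"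
  proof (rule Lim_null_comparison[OF _ bound0])
    show "\<forall>\<^sub>F s in at t within {0..}. norm ((W_fun L g \<mu> H V (y s) - W_fun L g \<mu> H V (y t)) / (s - t)
        - 2 * energy_product (y' t) (y t)) \<le> bound s"
      using est by (auto simp: eventually_at_filter)
  qed
  then show ?thesis unfolding has_field_derivative_iff by (rule LIM_zero_cancel)
qed

text \<open>The budget at fixed \<mu>: c is the margin of the interior form, \<epsilon> bounds the
  defect g - p(L), and K is the price of that defect per v(L)^2. By the trace inequality this price
  is paid with half of the interior dissipation in v and with the whole viscous term. Half of the
  interior dissipation remains, and W is bounded by a multiple of it.\<close>

lemma dissipation:
  assumes y: "y \<in> L2_space L" and F: "F \<in> L2_space L" and op: "operator_value L g \<kappa> \<mu> H V y F"
    and bc: "boundary_conditions L \<mu> b0 b1 c1 y"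
    and b0: "b0 \<in> {b0_bound (-1) g (H 0) (V 0) <..< b0_bound 1 g (H 0) (V 0)}"
    and c1: "c1 \<in> {c1_bound (-1) g b1 (H L) (V L) <..< c1_bound 1 g b1 (H L) (V L)}"
    and form: "\<And>x h v. x \<in> {0..L} \<Longrightarrow> c * (h\<^sup>2 + v\<^sup>2) \<le>
       form_hh g \<kappa> (H0 * V0) \<mu> (V x) (V' x / \<mu>) * h\<^sup>2 - form_hv g \<kappa> (H0 * V0) \<mu> (V x) (V' x / \<mu>) * (h * v)
       + form_vv \<kappa> (H0 * V0) \<mu> (V x) (V' x / \<mu>) * v\<^sup>2"
    and c: "c > 0"
    and eps: "4 * \<mu> * V' L / H L \<le> \<epsilon>" "\<epsilon> \<le> g / 4"
    and K: "2 * V L * ((4 * H L * (b1 / c1) + g * H L) / (g * V L))\<^sup>2 + (H L)\<^sup>2 / (2 * V L) \<le> K"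
    and small: "\<epsilon> * K * (1 / L + 1) \<le> \<mu> * c / 2" "\<epsilon> * K \<le> 4 * \<mu> * h1"
    and h1: "\<And>x. x \<in> {0..L} \<Longrightarrow> h1 \<le> H x"
    and M: "\<And>x. x \<in> {0..L} \<Longrightarrow> p x \<le> M" "\<And>x. x \<in> {0..L} \<Longrightarrow> H x \<le> M"
  shows "2 * energy_product F y \<le> - (\<mu> * c / M) * W_fun L g \<mu> H V y"
proof -
  let ?M = "interval_measure_on L"
  have L0: "0 \<in> {0..L}" "L \<in> {0..L}" using L by auto
  have Mpos: "M > 0" using M(2)[OF L0(1)] pos(1)[OF L0(1)] by linarith
  obtain h v where h: "continuous_on {0..L} h" and v: "C1_on L v"
    and ae: "AE x in ?M. y x $ 1 = h x \<and> y x $ 2 = v x"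
    and bcs: "v 0 = - b0 * h 0" "ddx L v 0 = 0" "v L = b1 * h L + \<mu> * c1 * ddx L v L"
    using bc unfolding boundary_conditions_def by blast
  note cv = C1_on_continuous[OF v]
  define Ah A B where "Ah = (\<integral>x. (h x)\<^sup>2 \<partial>?M)" and "A = (\<integral>x. (v x)\<^sup>2 \<partial>?M)" and "B = (\<integral>x. (ddx L v x)\<^sup>2 \<partial>?M)"
  have nn: "Ah \<ge> 0" "A \<ge> 0" "B \<ge> 0" by (auto simp: Ah_def A_def B_def)
  have i: "integrable ?M (\<lambda>x. (h x)\<^sup>2)" "integrable ?M (\<lambda>x. (v x)\<^sup>2)" "integrable ?M (\<lambda>x. (ddx L v x)\<^sup>2)"
    by (intro integrable_continuous_interval continuous_intros cv h)+
  have inlet: "boundary_form h v 0 \<ge> 0"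
  proof -
    \<comment> \<open>Because V'(0) = 0, the weight p equals g exactly at the inlet. No error arises
      there, in contrast to the outlet.\<close>
    have "p 0 = g" using init by (simp add: p_def)
    then have "boundary_form h v 0 = - ((H 0 * V 0 * b0\<^sup>2 / 2 - g * H 0 * b0 + g * V 0 / 2) * (h 0)\<^sup>2)"
      unfolding boundary_form_def bcs(1,2) by (simp add: algebra_simps power2_eq_square add_divide_distrib)
    moreover have "H 0 * V 0 * b0\<^sup>2 / 2 - g * H 0 * b0 + g * V 0 / 2 < 0"
      by (rule inlet_feedback) (use g pos[OF L0(1)] b0 in auto)
    ultimately show ?thesis by (simp add: mult_nonpos_nonneg)
  qed
  define e where "e = 4 * \<mu> * V' L / H L"
  have e0: "e \<ge> 0" using V'_nonneg[OF L0(2)] pos(1)[OF L0(2)] \<mu> by (simp add: e_def)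
  have Kpos: "K \<ge> 0" using pos[OF L0(2)] by (intro order.trans[OF _ K] add_nonneg_nonneg) auto
  have outlet: "boundary_form h v L \<le> \<epsilon> * K * (v L)\<^sup>2"
  proof -
    have o: "c1 \<noteq> 0" "(g * H L - (V L)\<^sup>2) * c1\<^sup>2 + 8 * (V L + b1 * H L) * c1 + 16 * H L * b1\<^sup>2 / g < 0"
      using outlet_feedback[OF g pos(1)[OF L0(2)] pos(2)[OF L0(2)] pos(3)[OF L0(2)], of b1 c1] c1 by auto
    have "boundary_form h v L = 4 * H L * v L * (\<mu> * ddx L v L) - (g - e) * H L * h L * v L
        - (g - e) * V L * (h L)\<^sup>2 / 2 - H L * V L * (v L)\<^sup>2 / 2"
      by (simp add: boundary_form_def p_def e_def)
    also have "\<dots> \<le> e * (2 * V L * ((4 * H L * (b1 / c1) + g * H L) / (g * V L))\<^sup>2 + (H L)\<^sup>2 / (2 * V L)) * (v L)\<^sup>2"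
      by (rule outlet_form_le[OF g pos(1)[OF L0(2)] pos(2)[OF L0(2)] o _ e0])
        (use bcs(3) eps in \<open>auto simp: e_def\<close>)
    also have "\<dots> \<le> \<epsilon> * K * (v L)\<^sup>2"
      using eps e0 K Kpos pos[OF L0(2)]
      by (intro mult_right_mono mult_mono) (auto simp: e_def[symmetric])
    finally show ?thesis .
  qed
  have "\<epsilon> * K * (v L)\<^sup>2 \<le> \<epsilon> * K * ((1 / L + 1) * A + B)"
    using trace_inequality[OF L v] eps e0 Kpos unfolding A_def B_def e_def
    by (intro mult_left_mono) auto
  also have "\<dots> = \<epsilon> * K * (1 / L + 1) * A + \<epsilon> * K * B" by (simp add: distrib_left mult.assoc)
  also have "\<dots> \<le> \<mu> * c / 2 * A + 4 * \<mu> * h1 * B"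
    using small nn by (intro add_mono mult_right_mono) auto
  finally have tr: "\<epsilon> * K * (v L)\<^sup>2 \<le> \<mu> * c / 2 * A + 4 * \<mu> * h1 * B" .
  have "(\<integral>x. interior_form h v x \<partial>?M) \<le> (\<integral>x. - (\<mu> * c) * ((h x)\<^sup>2 + (v x)\<^sup>2) - 4 * \<mu> * h1 * (ddx L v x)\<^sup>2 \<partial>?M)"
  proof (rule integral_mono)
    show "integrable ?M (interior_form h v)"
      unfolding interior_form_def[abs_def]
      by (intro integrable_continuous_interval continuous_intros cont cont_coef h cv) auto
    show "integrable ?M (\<lambda>x. - (\<mu> * c) * ((h x)\<^sup>2 + (v x)\<^sup>2) - 4 * \<mu> * h1 * (ddx L v x)\<^sup>2)"
      using i by simp
    fix x assume "x \<in> space ?M"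
    then have x: "x \<in> {0..L}" by auto
    show "interior_form h v x \<le> - (\<mu> * c) * ((h x)\<^sup>2 + (v x)\<^sup>2) - 4 * \<mu> * h1 * (ddx L v x)\<^sup>2"
      unfolding interior_form_eq[OF x]
    proof (rule diff_mono)
      show "4 * \<mu> * h1 * (ddx L v x)\<^sup>2 \<le> 4 * \<mu> * H x * (ddx L v x)\<^sup>2"
        using h1[OF x] \<mu> by (intro mult_right_mono mult_left_mono) auto
      show "- \<mu> * (form_hh g \<kappa> (H0 * V0) \<mu> (V x) (V' x / \<mu>) * (h x)\<^sup>2
          - form_hv g \<kappa> (H0 * V0) \<mu> (V x) (V' x / \<mu>) * (h x * v x) + form_vv \<kappa> (H0 * V0) \<mu> (V x) (V' x / \<mu>) * (v x)\<^sup>2)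
        \<le> - (\<mu> * c) * ((h x)\<^sup>2 + (v x)\<^sup>2)"
        using mult_left_mono[OF form[OF x, of "h x" "v x"], of \<mu>] \<mu> by (simp add: mult.assoc)
    qed
  qed
  also have "\<dots> = - (\<mu> * c) * (Ah + A) - 4 * \<mu> * h1 * B"
    using i by (simp add: Ah_def A_def B_def)
  finally have int: "(\<integral>x. interior_form h v x \<partial>?M) \<le> - (\<mu> * c) * (Ah + A) - 4 * \<mu> * h1 * B" .
  have total: "boundary_form h v L - boundary_form h v 0 + (\<integral>x. interior_form h v x \<partial>?M) \<le> - (\<mu> * c / 2) * (Ah + A)"
  proof -
    have "0 \<le> \<mu> * c / 2 * Ah" using \<mu> c nn by simp
    moreover have "- (\<mu> * c) * (Ah + A) = - (\<mu> * c / 2) * (Ah + A) - \<mu> * c / 2 * Ah - \<mu> * c / 2 * A"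
      by (simp add: field_simps)
    ultimately show ?thesis using int tr outlet inlet by linarith
  qed
  have "energy_product F y = (\<integral>x. (1 + \<mu>) * (p x * h x * F x $ 1 + H x * v x * F x $ 2) \<partial>?M)"
    unfolding energy_product_def
  proof (rule integral_cong_AE)
    show "energy_integrand F y \<in> borel_measurable ?M"
      by (rule borel_measurable_integrable[OF integrable_energy_integrand[OF F y]])
    show "(\<lambda>x. (1 + \<mu>) * (p x * h x * F x $ 1 + H x * v x * F x $ 2)) \<in> borel_measurable ?M"
      by (intro borel_measurable_integrable integrable_mult_right Bochner_Integration.integrable_add
          integrable_continuous_mult[OF _ L2_space_components(3)[OF F]] continuous_intros cont cont_coef h cv)
    show "AE x in ?M. energy_integrand F y x = (1 + \<mu>) * (p x * h x * F x $ 1 + H x * v x * F x $ 2)"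
      using ae by eventually_elim (simp add: energy_integrand_def)
  qed
  also have "\<dots> = (1 + \<mu>) * (boundary_form h v L - boundary_form h v 0 + (\<integral>x. interior_form h v x \<partial>?M))"
    using energy_identity[OF y F op h v ae] by simp
  also have "\<dots> \<le> (1 + \<mu>) * (- (\<mu> * c / 2) * (Ah + A))"
    using total \<mu> by (intro mult_left_mono) auto
  finally have upper: "2 * energy_product F y \<le> - (\<mu> * c) * ((1 + \<mu>) * (Ah + A))" by (simp add: field_simps)
  have "W_fun L g \<mu> H V y = (\<integral>x. energy_integrand y y x \<partial>?M)" by (simp add: W_fun_eq energy_product_def)
  also have "\<dots> \<le> (\<integral>x. (1 + \<mu>) * (M * ((h x)\<^sup>2 + (v x)\<^sup>2)) \<partial>?M)"
  proof (rule integral_mono_AE[OF integrable_energy_integrand[OF y y]])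
    show "integrable ?M (\<lambda>x. (1 + \<mu>) * (M * ((h x)\<^sup>2 + (v x)\<^sup>2)))" using i by simp
    show "AE x in ?M. energy_integrand y y x \<le> (1 + \<mu>) * (M * ((h x)\<^sup>2 + (v x)\<^sup>2))"
      using ae AE_interval_measure_in
    proof eventually_elim
      case (elim x)
      then have x: "x \<in> {0..L}" by auto
      have "p x * (h x)\<^sup>2 + H x * (v x)\<^sup>2 \<le> M * (h x)\<^sup>2 + M * (v x)\<^sup>2"
        using M[OF x] by (intro add_mono mult_right_mono) auto
      then show ?case unfolding energy_integrand_def conjunct1[OF elim(1)] conjunct2[OF elim(1)]
        using \<mu> by (intro mult_left_mono) (auto simp: power2_eq_square distrib_left)
    qed
  qed
  also have "\<dots> = M * ((1 + \<mu>) * (Ah + A))" using i by (simp add: Ah_def A_def)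
  finally have "\<mu> * c / M * W_fun L g \<mu> H V y \<le> \<mu> * c / M * (M * ((1 + \<mu>) * (Ah + A)))"
    using \<mu> c Mpos by (intro mult_left_mono) auto
  also have "\<dots> = \<mu> * c * ((1 + \<mu>) * (Ah + A))" using Mpos by simp
  finally show ?thesis using upper by simp
qed

lemma W_fun_equivalent:
  assumes m: "m > 0" "\<And>x. x \<in> {0..L} \<Longrightarrow> m \<le> p x" "\<And>x. x \<in> {0..L} \<Longrightarrow> m \<le> H x"
    and M: "\<And>x. x \<in> {0..L} \<Longrightarrow> p x \<le> M" "\<And>x. x \<in> {0..L} \<Longrightarrow> H x \<le> M"
    and y: "y \<in> L2_space L"
  shows "(1 + \<mu>) * m * (L2_norm L y)\<^sup>2 \<le> W_fun L g \<mu> H V y"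
    and "W_fun L g \<mu> H V y \<le> (1 + \<mu>) * M * (L2_norm L y)\<^sup>2"
proof -
  let ?M = "interval_measure_on L"
  let ?N = "\<lambda>x. (y x $ 1)\<^sup>2 + (y x $ 2)\<^sup>2"
  have pw: "(1 + \<mu>) * m * ?N x \<le> energy_integrand y y x \<and> energy_integrand y y x \<le> (1 + \<mu>) * M * ?N x"
    if x: "x \<in> {0..L}" for x
  proof -
    have "m * (y x $ 1)\<^sup>2 + m * (y x $ 2)\<^sup>2 \<le> p x * (y x $ 1)\<^sup>2 + H x * (y x $ 2)\<^sup>2"
      "p x * (y x $ 1)\<^sup>2 + H x * (y x $ 2)\<^sup>2 \<le> M * (y x $ 1)\<^sup>2 + M * (y x $ 2)\<^sup>2"
      using m M x by (auto intro!: add_mono mult_right_mono)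
    then have "(1 + \<mu>) * (m * (y x $ 1)\<^sup>2 + m * (y x $ 2)\<^sup>2) \<le> (1 + \<mu>) * (p x * (y x $ 1)\<^sup>2 + H x * (y x $ 2)\<^sup>2)"
      "(1 + \<mu>) * (p x * (y x $ 1)\<^sup>2 + H x * (y x $ 2)\<^sup>2) \<le> (1 + \<mu>) * (M * (y x $ 1)\<^sup>2 + M * (y x $ 2)\<^sup>2)"
      using \<mu> by (auto intro!: mult_left_mono)
    then show ?thesis unfolding energy_integrand_def power2_eq_square mult.assoc distrib_left by blast
  qed
  have i: "integrable ?M (\<lambda>x. c * ?N x)" for c using integrable_norm_sq[OF y] by simp
  have "(\<integral>x. (1 + \<mu>) * m * ?N x \<partial>?M) \<le> W_fun L g \<mu> H V y"
    unfolding W_fun_eq energy_product_def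
    by (rule integral_mono[OF i integrable_energy_integrand[OF y y]]) (use pw in force)
  then show "(1 + \<mu>) * m * (L2_norm L y)\<^sup>2 \<le> W_fun L g \<mu> H V y" unfolding L2_norm_sq by simp
  have "W_fun L g \<mu> H V y \<le> (\<integral>x. (1 + \<mu>) * M * ?N x \<partial>?M)"
    unfolding W_fun_eq energy_product_def
    by (rule integral_mono[OF integrable_energy_integrand[OF y y] i]) (use pw in force)
  then show "W_fun L g \<mu> H V y \<le> (1 + \<mu>) * M * (L2_norm L y)\<^sup>2" unfolding L2_norm_sq by simp
qed

end

section \<open>Choice of the smallness of \<mu> and conclusion\<close>

lemma eventually_small_mult:
  fixes A B :: real
  assumes "B > 0"
  shows "\<forall>\<^sub>F \<mu> in at_right 0. \<mu> * A < B"
proof (rule order_tendstoD(2))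
  show "((\<lambda>\<mu>. \<mu> * A) \<longlongrightarrow> 0 * A) (at_right 0)" by (intro tendsto_intros)
qed (use assms in simp)

theorem proposition4p1:
  fixes L g \<kappa> H0 V0 b0 b1 c1 :: real
    and H V :: "real \<Rightarrow> real \<Rightarrow> real"
  assumes "L > 0" "g > 0" "\<kappa> > 0" "H0 > 0" "V0 > 0"
    and "g * H0 > V0\<^sup>2"
    and "g * H0 < (2 + sqrt 2) * V0\<^sup>2"
    and "\<forall>\<^sub>F \<mu> in at_right 0. steady_state L g \<kappa> \<mu> H0 V0 (H \<mu>) (V \<mu>)"
  shows "(\<forall>\<^sub>F \<mu> in at_right 0.
            \<exists>m1>0. \<exists>m2>0. \<forall>y\<in>L2_space L.
              m1 * (L2_norm L y)\<^sup>2 \<le> W_fun L g \<mu> (H \<mu>) (V \<mu>) y \<and>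
              W_fun L g \<mu> (H \<mu>) (V \<mu>) y \<le> m2 * (L2_norm L y)\<^sup>2)
       \<and>
         ((\<forall>\<^sub>F \<mu> in at_right 0.
             b0 \<in> {b0_bound (-1) g (H \<mu> 0) (V \<mu> 0) <..< b0_bound 1 g (H \<mu> 0) (V \<mu> 0)} \<and>
             b1 \<notin> {b1_bound (-1) g (H \<mu> L) (V \<mu> L) .. b1_bound 1 g (H \<mu> L) (V \<mu> L)} \<and>
             c1 \<in> {c1_bound (-1) g b1 (H \<mu> L) (V \<mu> L) <..< c1_bound 1 g b1 (H \<mu> L) (V \<mu> L)})
          \<longrightarrow>
          (\<forall>\<^sub>F \<mu> in at_right 0.
             \<exists>\<gamma>>0. \<forall>y. linearized_solution L g \<kappa> \<mu> (H \<mu>) (V \<mu>) b0 b1 c1 y \<longrightarrow>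
               (\<forall>t\<ge>0. \<exists>D. ((\<lambda>s. W_fun L g \<mu> (H \<mu>) (V \<mu>) (y s)) has_real_derivative D)
                               (at t within {0..}) \<and>
                         D \<le> - \<gamma> * W_fun L g \<mu> (H \<mu>) (V \<mu>) (y t))))"
proof -
  note L = assms(1) and g = assms(2) and H0 = assms(4) and V0 = assms(5)
  define q where "q = H0 * V0"
  obtain c W m where c: "c > 0" and W: "W > V0" and m: "m > 0" and sub: "g * (q / W) > W\<^sup>2"
    and form: "\<And>\<mu> V s h v. 0 < \<mu> \<Longrightarrow> \<mu> < m \<Longrightarrow> V0 \<le> V \<Longrightarrow> V \<le> W \<Longrightarrow> 0 \<le> s \<Longrightarrow> s \<le> slope_bound g q W \<Longrightarrow>
       c * (h\<^sup>2 + v\<^sup>2) \<le> form_hh g \<kappa> q \<mu> V s * h\<^sup>2 - form_hv g \<kappa> q \<mu> V s * (h * v) + form_vv \<kappa> q \<mu> V s * v\<^sup>2"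
    using form_uniform[OF assms(2-7)] unfolding q_def by blast
  define \<sigma> h1 where "\<sigma> = slope_bound g q W" and "h1 = q / W"
  \<comment> \<open>\<Lambda> and K dominate the outlet constants for every small \<mu> at once, by
    means of H \<le> H0 and V0 \<le> V \<le> W.\<close>
  define \<Lambda> where "\<Lambda> = (4 * H0 * \<bar>b1 / c1\<bar> + g * H0) / (g * V0)"
  define K where "K = 2 * W * \<Lambda>\<^sup>2 + H0\<^sup>2 / (2 * V0)"
  have h1: "h1 > 0" and \<sigma>: "\<sigma> > 0"
    using W V0 H0 sub unfolding h1_def \<sigma>_def q_def slope_bound_def by (auto intro!: divide_pos_pos mult_pos_pos)
  \<comment> \<open>Apart from positivity of \<mu> and the steady state itself, every requirement
    has the form \<mu> A < B with A and B independent of \<mu>.\<close>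
  define good where "good \<mu> \<longleftrightarrow> 0 < \<mu> \<and> \<mu> < m \<and> \<mu> * (\<sigma> * L) < W - V0 \<and> \<mu> < 1 \<and> \<mu> * (4 * \<sigma> / h1) < g / 4 \<and>
     \<mu> * (4 * \<sigma> / h1 * K * (1 / L + 1)) < c / 2 \<and> \<mu> * (4 * \<sigma> / h1 * K) < 4 * h1 \<and>
     steady_state L g \<kappa> \<mu> H0 V0 (H \<mu>) (V \<mu>)" for \<mu>
  have good: "\<forall>\<^sub>F \<mu> in at_right 0. good \<mu>"
    unfolding good_def
    using eventually_small_mult[of m 1] eventually_small_mult[of 1 1] eventually_at_right_less[of "0::real"]
      m W g c h1 assms(8)
    by (intro eventually_conj eventually_small_mult) auto
  have est: "steady L g \<kappa> \<mu> H0 V0 (H \<mu>) (V \<mu>) \<and>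
      (\<forall>x\<in>{0..L}. V0 \<le> V \<mu> x \<and> V \<mu> x \<le> W \<and> 0 \<le> ddx L (V \<mu>) x \<and> ddx L (V \<mu>) x \<le> \<mu> * \<sigma> \<and>
         h1 \<le> H \<mu> x \<and> H \<mu> x \<le> H0 \<and> 4 * \<mu> * ddx L (V \<mu>) x / H \<mu> x \<le> \<mu> * (\<mu> * (4 * \<sigma> / h1)) \<and>
         3 * g / 4 \<le> steady.p L g \<mu> (H \<mu>) (V \<mu>) x \<and> steady.p L g \<mu> (H \<mu>) (V \<mu>) x \<le> g)"
    if gd: "good \<mu>" for \<mu>
  proof
    show st: "steady L g \<kappa> \<mu> H0 V0 (H \<mu>) (V \<mu>)"
      using gd assms by (simp add: steady_def good_def)
    interpret steady L g \<kappa> \<mu> H0 V0 "H \<mu>" "V \<mu>" by (rule st)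
    show "\<forall>x\<in>{0..L}. V0 \<le> V \<mu> x \<and> V \<mu> x \<le> W \<and> 0 \<le> ddx L (V \<mu>) x \<and> ddx L (V \<mu>) x \<le> \<mu> * \<sigma> \<and>
         h1 \<le> H \<mu> x \<and> H \<mu> x \<le> H0 \<and> 4 * \<mu> * ddx L (V \<mu>) x / H \<mu> x \<le> \<mu> * (\<mu> * (4 * \<sigma> / h1)) \<and>
         3 * g / 4 \<le> p x \<and> p x \<le> g"
    proof
      fix x assume x: "x \<in> {0..L}"
      have small: "\<mu> * slope_bound g (H0 * V0) W * L < W - V0"
        using gd by (simp add: good_def \<sigma>_def q_def mult.assoc)
      have Vx: "V \<mu> x \<le> W" "ddx L (V \<mu>) x \<le> \<mu> * \<sigma>"
        using V_bounds[OF W sub[unfolded q_def] small x] unfolding \<sigma>_def q_def .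
      have Hx: "H \<mu> x = q / V \<mu> x" using mass[OF x] nz[OF x] by (simp add: q_def field_simps)
      have q: "q > 0" using H0 V0 by (simp add: q_def)
      have lo: "h1 \<le> H \<mu> x"
        unfolding Hx h1_def using Vx pos[OF x] q W V0 by (intro divide_left_mono) auto
      have "q / V \<mu> x \<le> q / V0" using V_ge[OF x] pos[OF x] q V0 by (intro divide_left_mono) auto
      then have hi: "H \<mu> x \<le> H0" unfolding Hx using V0 by (simp add: q_def)
      have "4 * \<mu> * ddx L (V \<mu>) x / H \<mu> x \<le> 4 * \<mu> * (\<mu> * \<sigma>) / h1"
        using Vx lo h1 \<mu> \<sigma> by (intro frac_le mult_left_mono) auto
      then have e: "4 * \<mu> * ddx L (V \<mu>) x / H \<mu> x \<le> \<mu> * (\<mu> * (4 * \<sigma> / h1))" by (simp add: mult_ac)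
      also have "\<dots> \<le> 1 * (\<mu> * (4 * \<sigma> / h1))"
        using gd h1 \<sigma> by (intro mult_right_mono) (auto simp: good_def)
      also have "\<dots> < g / 4" using gd by (simp add: good_def)
      finally have p_lo: "3 * g / 4 \<le> p x" by (simp add: p_def)
      have "0 \<le> 4 * \<mu> * ddx L (V \<mu>) x / H \<mu> x" using V'_nonneg[OF x] pos[OF x] \<mu> by simp
      then have "p x \<le> g" by (simp add: p_def)
      then show "V0 \<le> V \<mu> x \<and> V \<mu> x \<le> W \<and> 0 \<le> ddx L (V \<mu>) x \<and> ddx L (V \<mu>) x \<le> \<mu> * \<sigma> \<and>
         h1 \<le> H \<mu> x \<and> H \<mu> x \<le> H0 \<and> 4 * \<mu> * ddx L (V \<mu>) x / H \<mu> x \<le> \<mu> * (\<mu> * (4 * \<sigma> / h1)) \<and>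
         3 * g / 4 \<le> p x \<and> p x \<le> g"
        using V_ge[OF x] Vx V'_nonneg[OF x] lo hi e p_lo by blast
    qed
  qed
  have "\<exists>m1>0. \<exists>m2>0. \<forall>y\<in>L2_space L.
              m1 * (L2_norm L y)\<^sup>2 \<le> W_fun L g \<mu> (H \<mu>) (V \<mu>) y \<and>
              W_fun L g \<mu> (H \<mu>) (V \<mu>) y \<le> m2 * (L2_norm L y)\<^sup>2" if gd: "good \<mu>" for \<mu>
  proof -
    interpret steady L g \<kappa> \<mu> H0 V0 "H \<mu>" "V \<mu>" using est[OF gd] by blast
    have b: "min (3 * g / 4) h1 > 0" "\<And>x. x \<in> {0..L} \<Longrightarrow> min (3 * g / 4) h1 \<le> p x"
      "\<And>x. x \<in> {0..L} \<Longrightarrow> min (3 * g / 4) h1 \<le> H \<mu> x"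
      "\<And>x. x \<in> {0..L} \<Longrightarrow> p x \<le> max g H0" "\<And>x. x \<in> {0..L} \<Longrightarrow> H \<mu> x \<le> max g H0"
      using est[OF gd] g h1 by (auto intro: min.coboundedI1 min.coboundedI2 max.coboundedI1 max.coboundedI2)
    show ?thesis
    proof (intro exI conjI ballI)
      show "(1 + \<mu>) * min (3 * g / 4) h1 > 0" "(1 + \<mu>) * max g H0 > 0"
        using \<mu> b(1) g by (auto intro!: mult_pos_pos)
      fix y assume y: "y \<in> L2_space L"
      show "(1 + \<mu>) * min (3 * g / 4) h1 * (L2_norm L y)\<^sup>2 \<le> W_fun L g \<mu> (H \<mu>) (V \<mu>) y"
        by (rule W_fun_equivalent(1)[OF b y])
      show "W_fun L g \<mu> (H \<mu>) (V \<mu>) y \<le> (1 + \<mu>) * max g H0 * (L2_norm L y)\<^sup>2"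
        by (rule W_fun_equivalent(2)[OF b y])
    qed
  qed
  then have part1: "\<forall>\<^sub>F \<mu> in at_right 0. \<exists>m1>0. \<exists>m2>0. \<forall>y\<in>L2_space L.
              m1 * (L2_norm L y)\<^sup>2 \<le> W_fun L g \<mu> (H \<mu>) (V \<mu>) y \<and>
              W_fun L g \<mu> (H \<mu>) (V \<mu>) y \<le> m2 * (L2_norm L y)\<^sup>2"
    by (rule eventually_mono[OF good])
  have "\<exists>\<gamma>>0. \<forall>y. linearized_solution L g \<kappa> \<mu> (H \<mu>) (V \<mu>) b0 b1 c1 y \<longrightarrow>
               (\<forall>t\<ge>0. \<exists>D. ((\<lambda>s. W_fun L g \<mu> (H \<mu>) (V \<mu>) (y s)) has_real_derivative D)
                               (at t within {0..}) \<and>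
                         D \<le> - \<gamma> * W_fun L g \<mu> (H \<mu>) (V \<mu>) (y t))"
    if gd: "good \<mu>"
      and b0: "b0 \<in> {b0_bound (-1) g (H \<mu> 0) (V \<mu> 0) <..< b0_bound 1 g (H \<mu> 0) (V \<mu> 0)}"
      and c1: "c1 \<in> {c1_bound (-1) g b1 (H \<mu> L) (V \<mu> L) <..< c1_bound 1 g b1 (H \<mu> L) (V \<mu> L)}" for \<mu>
  proof -
    interpret steady L g \<kappa> \<mu> H0 V0 "H \<mu>" "V \<mu>" using est[OF gd] by blast
    have bounds: "V0 \<le> V \<mu> x" "V \<mu> x \<le> W" "0 \<le> ddx L (V \<mu>) x" "ddx L (V \<mu>) x \<le> \<mu> * \<sigma>"
         "h1 \<le> H \<mu> x" "H \<mu> x \<le> H0" "4 * \<mu> * ddx L (V \<mu>) x / H \<mu> x \<le> \<mu> * (\<mu> * (4 * \<sigma> / h1))"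
         "p x \<le> g" if "x \<in> {0..L}" for x
      using est[OF gd] that by blast+
    have L1: "L \<in> {0..L}" using L by simp
    \<comment> \<open>The defect g - p = 4 \<mu> V' / H is of order \<mu>^2 since V' is of order
      \<mu>. Compared with a dissipation of order \<mu>, one factor \<mu> is left to make it
      small.\<close>
    define \<epsilon> where "\<epsilon> = \<mu> * (\<mu> * (4 * \<sigma> / h1))"
    have form': "c * (h\<^sup>2 + v\<^sup>2) \<le>
       form_hh g \<kappa> (H0 * V0) \<mu> (V \<mu> x) (ddx L (V \<mu>) x / \<mu>) * h\<^sup>2 - form_hv g \<kappa> (H0 * V0) \<mu> (V \<mu> x) (ddx L (V \<mu>) x / \<mu>) * (h * v)
       + form_vv \<kappa> (H0 * V0) \<mu> (V \<mu> x) (ddx L (V \<mu>) x / \<mu>) * v\<^sup>2" if x: "x \<in> {0..L}" for x h v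
    proof (rule form[unfolded q_def])
      show "ddx L (V \<mu>) x / \<mu> \<le> slope_bound g (H0 * V0) W"
        using bounds(4)[OF x] \<mu> by (simp add: pos_divide_le_eq \<sigma>_def q_def mult.commute)
      show "0 \<le> ddx L (V \<mu>) x / \<mu>" using bounds(3)[OF x] \<mu> by simp
    qed (use gd \<mu> bounds[OF x] in \<open>auto simp: good_def\<close>)
    have \<epsilon>: "\<epsilon> \<le> g / 4"
    proof -
      have "\<epsilon> \<le> 1 * (\<mu> * (4 * \<sigma> / h1))"
        unfolding \<epsilon>_def using gd \<mu> h1 \<sigma> by (intro mult_right_mono) (auto simp: good_def)
      also have "\<dots> < g / 4" using gd by (simp add: good_def)
      finally show ?thesis by simp
    qed
    have K_bound: "2 * V \<mu> L * ((4 * H \<mu> L * (b1 / c1) + g * H \<mu> L) / (g * V \<mu> L))\<^sup>2 + (H \<mu> L)\<^sup>2 / (2 * V \<mu> L) \<le> K"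
    proof -
      note B = bounds[OF L1] and P = pos[OF L1]
      have "\<bar>4 * H \<mu> L * (b1 / c1) + g * H \<mu> L\<bar> \<le> \<bar>4 * H \<mu> L * (b1 / c1)\<bar> + \<bar>g * H \<mu> L\<bar>"
        by (rule abs_triangle_ineq)
      also have "\<dots> = 4 * H \<mu> L * \<bar>b1 / c1\<bar> + g * H \<mu> L" using P g by (simp add: abs_mult)
      also have "\<dots> \<le> 4 * H0 * \<bar>b1 / c1\<bar> + g * H0"
        using B g by (intro add_mono mult_left_mono mult_right_mono) auto
      finally have "\<bar>(4 * H \<mu> L * (b1 / c1) + g * H \<mu> L) / (g * V \<mu> L)\<bar> \<le> \<Lambda>"
        unfolding \<Lambda>_def abs_divide using B P g V0 H0 by (intro frac_le) auto
      then have "\<bar>(4 * H \<mu> L * (b1 / c1) + g * H \<mu> L) / (g * V \<mu> L)\<bar>\<^sup>2 \<le> \<Lambda>\<^sup>2"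
        by (rule power_mono) simp
      then have sq: "((4 * H \<mu> L * (b1 / c1) + g * H \<mu> L) / (g * V \<mu> L))\<^sup>2 \<le> \<Lambda>\<^sup>2"
        by (simp only: power2_abs)
      show ?thesis
        unfolding K_def
      proof (rule add_mono)
        show "2 * V \<mu> L * ((4 * H \<mu> L * (b1 / c1) + g * H \<mu> L) / (g * V \<mu> L))\<^sup>2 \<le> 2 * W * \<Lambda>\<^sup>2"
          by (rule mult_mono[OF _ sq]) (use B W V0 in auto)
        show "(H \<mu> L)\<^sup>2 / (2 * V \<mu> L) \<le> H0\<^sup>2 / (2 * V0)"
          using B P V0 by (intro frac_le power_mono) auto
      qed
    qed
    have small: "\<epsilon> * K * (1 / L + 1) \<le> \<mu> * c / 2" "\<epsilon> * K \<le> 4 * \<mu> * h1"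
    proof -
      have "\<mu> * (\<mu> * (4 * \<sigma> / h1 * K * (1 / L + 1))) \<le> \<mu> * (c / 2)"
        using gd \<mu> by (intro mult_left_mono) (auto simp: good_def)
      then show "\<epsilon> * K * (1 / L + 1) \<le> \<mu> * c / 2" by (simp add: \<epsilon>_def mult.assoc)
      have "\<mu> * (\<mu> * (4 * \<sigma> / h1 * K)) \<le> \<mu> * (4 * h1)"
        using gd \<mu> by (intro mult_left_mono) (auto simp: good_def)
      then show "\<epsilon> * K \<le> 4 * \<mu> * h1" by (simp add: \<epsilon>_def mult_ac)
    qed
    have Mx: "\<And>x. x \<in> {0..L} \<Longrightarrow> p x \<le> max g H0" "\<And>x. x \<in> {0..L} \<Longrightarrow> H \<mu> x \<le> max g H0"
      using bounds(6,8) by (auto intro: max.coboundedI1 max.coboundedI2)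
    show ?thesis
    \<comment> \<open>The rate is the interior dissipation \<mu> c divided by the upper bound of the
      weights, p \<le> g and H \<le> H0; the factor 1 + \<mu> occurs on both sides and
      cancels.\<close>
    proof (rule exI[of _ "\<mu> * c / max g H0"], intro conjI allI impI)
      show "0 < \<mu> * c / max g H0" using \<mu> c g by (simp add: less_max_iff_disj)
      fix y t assume sol: "linearized_solution L g \<kappa> \<mu> (H \<mu>) (V \<mu>) b0 b1 c1 y" and t: "0 \<le> (t::real)"
      obtain y' where y': "C1_L2_derivative L y y'"
        and dom: "y t \<in> operator_domain L g \<kappa> \<mu> (H \<mu>) (V \<mu>) b0 b1 c1"
        and op: "operator_value L g \<kappa> \<mu> (H \<mu>) (V \<mu>) (y t) (y' t)"
        using sol t unfolding linearized_solution_def by blast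
      have y'_L2: "y' t \<in> L2_space L" using y' t by (simp add: C1_L2_derivative_def)
      have y_L2: "y t \<in> L2_space L" and bc: "boundary_conditions L \<mu> b0 b1 c1 (y t)"
        using dom by (auto simp: operator_domain_def)
      have "2 * energy_product (y' t) (y t) \<le> - (\<mu> * c / max g H0) * W_fun L g \<mu> (H \<mu>) (V \<mu>) (y t)"
        by (rule dissipation[OF y_L2 y'_L2 op bc b0 c1 form' c _ \<epsilon> K_bound small bounds(5) Mx])
          (use bounds(7)[OF L1] in \<open>auto simp: \<epsilon>_def\<close>)
      then show "\<exists>D. ((\<lambda>s. W_fun L g \<mu> (H \<mu>) (V \<mu>) (y s)) has_real_derivative D) (at t within {0..}) \<and>
          D \<le> - (\<mu> * c / max g H0) * W_fun L g \<mu> (H \<mu>) (V \<mu>) (y t)"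
        using energy_has_derivative[OF y' t] by blast
    qed
  qed
  note part2 = this
  show ?thesis
  proof (intro conjI impI part1)
    assume "\<forall>\<^sub>F \<mu> in at_right 0.
             b0 \<in> {b0_bound (-1) g (H \<mu> 0) (V \<mu> 0) <..< b0_bound 1 g (H \<mu> 0) (V \<mu> 0)} \<and>
             b1 \<notin> {b1_bound (-1) g (H \<mu> L) (V \<mu> L) .. b1_bound 1 g (H \<mu> L) (V \<mu> L)} \<and>
             c1 \<in> {c1_bound (-1) g b1 (H \<mu> L) (V \<mu> L) <..< c1_bound 1 g b1 (H \<mu> L) (V \<mu> L)}"
    with good show "\<forall>\<^sub>F \<mu> in at_right 0.
             \<exists>\<gamma>>0. \<forall>y. linearized_solution L g \<kappa> \<mu> (H \<mu>) (V \<mu>) b0 b1 c1 y \<longrightarrow>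
               (\<forall>t\<ge>0. \<exists>D. ((\<lambda>s. W_fun L g \<mu> (H \<mu>) (V \<mu>) (y s)) has_real_derivative D)
                               (at t within {0..}) \<and>
                         D \<le> - \<gamma> * W_fun L g \<mu> (H \<mu>) (V \<mu>) (y t))"
    proof eventually_elim
      case (elim \<mu>)
      from elim(2) show ?case by (intro part2[OF elim(1)]; elim conjE)
    qed
  qed
qed

end
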